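(* Let $\epsilon_2$, $C_S$, $\xi$ be the constants of the stability property (S) and $\epsilon_4$ the constant of the regularity property (R) in the context. Assume that the boundary functions satisfy $$\max_{i=1,2}\|\phi_{i_b}''(t)\|_{L^\infty}\le M_2<+\infty .$$ Then there exist constants $C_S^*>0$ and $\epsilon_5\in(0,\min\{\epsilon_2,\epsilon_4\})$ such that for any given $\epsilon\in(0,\epsilon_5)$, for data $\phi_0,\phi_{1_b},\phi_{2_b}$ as in (S), the solution $\phi$ of (IBVP) satisfies not only the $C^0$ convergence $$\|\phi(t,\cdot)-\phi^{(T_* )}(t,\cdot)\|_{C^0}\le C_S\,\epsilon\,\xi^{[t/T_0]},\qquad\forall t\ge0,$$ but also the $C^1$ exponential convergence $$\max\{\|\partial_t\phi(t,\cdot)-\partial_t\phi^{(T_* )}(t,\cdot)\|_{C^0},\ \|\partial_x\phi(t,\cdot)-\partial_x\phi^{(T_* )}(t,\cdot)\|_{C^0}\}\le A_0C_S^*\,\epsilon\,\xi^{[t/T_0]},\qquad\forall t\ge0,$$ where $\phi^{(T_* )}$ is the time-periodic solution provided by the existence property (E) for $\phi_{1_b},\phi_{2_b}$.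
   Context: Setting. $\gamma>1$, $\underline\rho>0$, $L>0$, $T_*>0$, $\beta_*<0$ and $\kappa_1,\kappa_2$ with $|\kappa_1|<1$, $|\kappa_2|<1$ are constants; $D=\{(t,x):t\in\mathbb{R}_+,\ x\in[0,L]\}$; $[s]$ is the integer part of $s$. For $(m,n)\in\mathbb{R}^2$, $\lambda_1(m,n)=\frac{\gamma+1}{2}m+\frac{3-\gamma}{2}n$ and $\lambda_2(m,n)=\frac{3-\gamma}{2}m+\frac{\gamma+1}{2}n$. $\Phi=(\underline m,\underline n)^\top$ with $-\underline m=\underline n=\frac{\sqrt\gamma}{\gamma-1}\underline\rho^{\frac{\gamma-1}{2}}$, so that $\lambda_1(\Phi)<0<\lambda_2(\Phi)$; $\Psi$ is a small neighborhood of $0\in\mathbb{R}^2$ such that $\lambda_1(\phi+\Phi)<0<\lambda_2(\phi+\Phi)$ for all $\phi\in\Psi$; $A_0>0$ is a constant with $\max_{i=1,2}\sup_{\phi\in\Psi}|\lambda_i(\phi+\Phi)^{-1}|\le A_0$; and $T_0=\max_{i=1,2}\sup_{\phi\in\Psi}\frac{L}{|\lambda_i(\phi+\Phi)|}$. The damping coefficient $\beta=\beta(t,x)$ is a $C^2$ function on $D$ satisfying, with the same small constant $\epsilon$ as in the statements, $$\beta_*\le\beta(t,x)\le0,\qquad |\partial_t\beta|,|\partial_x\beta|\le\epsilon,\qquad \beta(t+T_*,x)=\beta(t,x).$$ The $C^1$ norm is the maximum, over components, of the sup norms of the function and its first-order derivatives. (IBVP): for $\phi=(\phi_1,\phi_2)^\top$,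 $$\partial_t\phi_i+\lambda_i(\phi+\Phi)\partial_x\phi_i=\tfrac{\beta}{2}(\phi_1+\phi_2)\ \text{ on } D,\quad i=1,2,$$ $$\phi(0,x)=\phi_0(x),\qquad \phi_2(t,0)=\phi_{2_b}(t)+\kappa_2\phi_1(t,0),\qquad \phi_1(t,L)=\phi_{1_b}(t)+\kappa_1\phi_2(t,L)\quad(t\ge0).$$ (E) Existence property, which fixes $\epsilon_1$ and $C_E$: there exist a small enough constant $\epsilon_1>0$ and a constant $C_E>0$ such that for any $0<\epsilon<\epsilon_1$ and any $C^1$ functions $\phi_{i_b}$ $(i=1,2)$ with $\phi_{i_b}(t+T_* )=\phi_{i_b}(t)$ for $t>0$ and $\|\phi_{i_b}\|_{C^1(\mathbb{R}_+)}\le\epsilon$, there exists a $C^1$ function $\phi_0$ with $\|\phi_0\|_{C^1([0,L])}\le C_E\epsilon$ such that (IBVP) admits a $C^1$ solution $\phi^{(T_* )}$ on $D$ with $\phi^{(T_* )}(t+T_*,x)=\phi^{(T_* )}(t,x)$ on $D$ and $\|\phi^{(T_* )}\|_{C^1(D)}\le C_E\epsilon$. (S) Stability property, which fixes $\epsilon_2$, $C_S$ and $\xi$: there exist a small constant $\epsilon_2\in(0,\epsilon_1)$, a constant $C_S>0$ and a constant $\xi\in(0,1)$ such that for any $\epsilon\in(0,\epsilon_2)$, any $C^1$ functions $\phi_{i_b}$ as in (E) and any $C^1$ function $\phi_0$ with $\|\phi_0\|_{C^1([0,L])}\le C_E\epsilon$ satisfying the compatibility conditions (C), (IBVP) has a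 unique global $C^1$ classical solution $\phi$ on $D$, and $\|\phi(t,\cdot)-\phi^{(T_* )}(t,\cdot)\|_{C^0}\le C_S\epsilon\,\xi^{[t/T_0]}$ for all $t\ge0$, where $\phi^{(T_* )}$ is the time-periodic solution given by (E) for $\phi_{1_b},\phi_{2_b}$. (R) Regularity property, which fixes $C_R$ and $\epsilon_4$: if the $\phi_{i_b}$ are as in (E) and in addition are $W^{2,\infty}$ with $\max_{i=1,2}\|\phi_{i_b}''\|_{L^\infty}\le M_2<+\infty$, then there exist constants $C_R>0$ and $\epsilon_4\in(0,\epsilon_1)$ such that for any $\epsilon\in(0,\epsilon_4)$ the solution $\phi^{(T_* )}$ of (E) is also a $W^{2,\infty}$ function, with all second-order derivatives bounded in $L^\infty$ by $(1+A_0)^2C_R$. (C) Compatibility conditions: with $\phi_0=(\phi_{1_0},\phi_{2_0})^\top$ and $q_i(x)=-\lambda_i(\phi_0(x)+\Phi)\phi_{i_0}'(x)+\frac{\beta(0,x)}{2}(\phi_{1_0}(x)+\phi_{2_0}(x))$, $$\phi_{2_0}(0)=\phi_{2_b}(0)+\kappa_2\phi_{1_0}(0),\quad q_2(0)=\phi_{2_b}'(0)+\kappa_2q_1(0),$$ $$\phi_{1_0}(L)=\phi_{1_b}(0)+\kappa_1\phi_{2_0}(L),\quad q_1(L)=\phi_{1_b}'(0)+\kappa_1q_2(L).$$ *)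

theory Defs
  imports "HOL-Analysis.Analysis" "HOL-Probability.Essential_Supremum"
begin

section \<open>Constants and wave speeds\<close>

record params =
  gam :: real      \<comment> \<open>adiabatic exponent \<open>\<gamma>\<close>\<close>
  rho :: real      \<comment> \<open>reference density \<open>\<rho>\<close> (underlined in the mathematical text)\<close>
  len :: real      \<comment> \<open>length \<open>L\<close> of the duct\<close>
  period :: real   \<comment> \<open>time period \<open>T\<^sub>*\<close>\<close>
  beta_lo :: real  \<comment> \<open>lower bound \<open>\<beta>\<^sub>*\<close> of the damping coefficient\<close>
  kap1 :: real     \<comment> \<open>reflection coefficient at \<open>x = L\<close>\<close>
  kap2 :: real     \<comment> \<open>reflection coefficient at \<open>x = 0\<close>\<close>

definition valid_params :: "params \<Rightarrow> bool" where
  "valid_params p \<longleftrightarrow> gam p > 1 \<and> rho p > 0 \<and> len p > 0 \<and> period p > 0 \<and> beta_lo p < 0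
     \<and> \<bar>kap1 p\<bar> < 1 \<and> \<bar>kap2 p\<bar> < 1"

text \<open>Vectors in the plane are of type \<^typ>\<open>real ^ 2\<close>; the index type \<^typ>\<open>2\<close> has the two
  elements \<open>1\<close> and \<open>2\<close>.\<close>

definition lam :: "params \<Rightarrow> 2 \<Rightarrow> real ^ 2 \<Rightarrow> real" where
  "lam p i v =
     (if i = 1 then (gam p + 1) / 2 * v $ 1 + (3 - gam p) / 2 * v $ 2
      else (3 - gam p) / 2 * v $ 1 + (gam p + 1) / 2 * v $ 2)"

definition Phi :: "params \<Rightarrow> real ^ 2" where
  "Phi p = (let n = sqrt (gam p) / (gam p - 1) * rho p powr ((gam p - 1) / 2)
            in \<chi> i. if i = 1 then - n else n)"

text \<open>\<open>Psi\<close> is a (not necessarily open) neighbourhood of the origin on which the wave speeds keep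
  their sign, and \<open>A0\<close> bounds the inverse speeds on it.\<close>

definition valid_nbhd :: "params \<Rightarrow> (real ^ 2) set \<Rightarrow> real \<Rightarrow> bool" where
  "valid_nbhd p Psi A0 \<longleftrightarrow>
     0 \<in> interior Psi \<and>
     (\<forall>v\<in>Psi. lam p 1 (v + Phi p) < 0 \<and> 0 < lam p 2 (v + Phi p)) \<and>
     0 < A0 \<and> (\<forall>i. \<forall>v\<in>Psi. \<bar>inverse (lam p i (v + Phi p))\<bar> \<le> A0)"

definition T0 :: "params \<Rightarrow> (real ^ 2) set \<Rightarrow> real" where
  "T0 p Psi = (MAX i\<in>UNIV. SUP v\<in>Psi. len p / \<bar>lam p i (v + Phi p)\<bar>)"

section \<open>Function spaces and norms\<close>

text \<open>Functions on \<open>D\<close> are curried, the time variable coming first; only their values on \<open>D\<close>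
  matter. Derivatives at boundary points are one-sided.\<close>

definition Dom :: "params \<Rightarrow> (real \<times> real) set" where
  "Dom p = {0..} \<times> {0..len p}"

definition dt :: "(real \<Rightarrow> real \<Rightarrow> 'a::real_normed_vector) \<Rightarrow> real \<Rightarrow> real \<Rightarrow> 'a" where
  "dt f t x = vector_derivative (\<lambda>s. f s x) (at t within {0..})"

definition dx :: "params \<Rightarrow> (real \<Rightarrow> real \<Rightarrow> 'a::real_normed_vector) \<Rightarrow> real \<Rightarrow> real \<Rightarrow> 'a" where
  "dx p f t x = vector_derivative (\<lambda>y. f t y) (at x within {0..len p})"

definition d1 :: "real set \<Rightarrow> (real \<Rightarrow> 'a::real_normed_vector) \<Rightarrow> real \<Rightarrow> 'a" where
  "d1 S f s = vector_derivative f (at s within S)"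

definition C1_D :: "params \<Rightarrow> (real \<Rightarrow> real \<Rightarrow> 'a::real_normed_vector) \<Rightarrow> bool" where
  "C1_D p f \<longleftrightarrow>
     (\<forall>(t, x)\<in>Dom p. (\<lambda>s. f s x) differentiable (at t within {0..}) \<and>
                     (\<lambda>y. f t y) differentiable (at x within {0..len p})) \<and>
     continuous_on (Dom p) (\<lambda>(t, x). f t x) \<and>
     continuous_on (Dom p) (\<lambda>(t, x). dt f t x) \<and>
     continuous_on (Dom p) (\<lambda>(t, x). dx p f t x)"

definition C2_D :: "params \<Rightarrow> (real \<Rightarrow> real \<Rightarrow> 'a::real_normed_vector) \<Rightarrow> bool" where
  "C2_D p f \<longleftrightarrow> C1_D p f \<and> C1_D p (dt f) \<and> C1_D p (dx p f)"

definition C1_I :: "real set \<Rightarrow> (real \<Rightarrow> 'a::real_normed_vector) \<Rightarrow> bool" where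
  "C1_I S f \<longleftrightarrow> f differentiable_on S \<and> continuous_on S (d1 S f)"

text \<open>Norms take values in the extended reals, so that \<open>norm \<le> ereal c\<close> includes
  boundedness.\<close>

definition sup_norm :: "'a set \<Rightarrow> ('a \<Rightarrow> real ^ 2) \<Rightarrow> ereal" where
  "sup_norm S f = (MAX i\<in>UNIV. SUP z\<in>S. ereal \<bar>f z $ i\<bar>)"

definition C1_norm_I :: "real set \<Rightarrow> (real \<Rightarrow> real ^ 2) \<Rightarrow> ereal" where
  "C1_norm_I S f = max (sup_norm S f) (sup_norm S (d1 S f))"

definition C1_norm_D :: "params \<Rightarrow> (real \<Rightarrow> real \<Rightarrow> real ^ 2) \<Rightarrow> ereal" where
  "C1_norm_D p f = Max {sup_norm (Dom p) (\<lambda>(t, x). f t x),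
                        sup_norm (Dom p) (\<lambda>(t, x). dt f t x),
                        sup_norm (Dom p) (\<lambda>(t, x). dx p f t x)}"

text \<open>Weak first-order derivative of \<open>u\<close> in direction \<open>e\<close> on an open set \<open>U\<close>, tested, as usual for
  first-order derivatives, against compactly supported \<open>C\<^sup>1\<close> functions.\<close>

definition test_fun :: "'a::euclidean_space set \<Rightarrow> ('a \<Rightarrow> real) \<Rightarrow> bool" where
  "test_fun U \<psi> \<longleftrightarrow>
     (\<forall>z. \<psi> differentiable (at z)) \<and>
     (\<forall>e. continuous_on UNIV (\<lambda>z. frechet_derivative \<psi> (at z) e)) \<and>
     (\<exists>K. compact K \<and> K \<subseteq> U \<and> (\<forall>z. z \<notin> K \<longrightarrow> \<psi> z = 0))"

definition is_weak_deriv ::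
    "'a::euclidean_space set \<Rightarrow> 'a \<Rightarrow> ('a \<Rightarrow> real) \<Rightarrow> ('a \<Rightarrow> real) \<Rightarrow> bool" where
  "is_weak_deriv U e u g \<longleftrightarrow>
     (\<forall>\<psi>. test_fun U \<psi> \<longrightarrow>
        integral\<^sup>L (lebesgue_on U) (\<lambda>z. u z * frechet_derivative \<psi> (at z) e)
        = - integral\<^sup>L (lebesgue_on U) (\<lambda>z. g z * \<psi> z))"

definition Linf_norm :: "'a::euclidean_space set \<Rightarrow> ('a \<Rightarrow> real) \<Rightarrow> ereal" where
  "Linf_norm U g = esssup (lebesgue_on U) (\<lambda>z. ereal \<bar>g z\<bar>)"

definition weak_deriv_Linf_le ::
    "'a::euclidean_space set \<Rightarrow> 'a \<Rightarrow> ('a \<Rightarrow> real) \<Rightarrow> real \<Rightarrow> bool" where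
  "weak_deriv_Linf_le U e u M \<longleftrightarrow>
     (\<exists>g. g \<in> borel_measurable (lebesgue_on U) \<and> is_weak_deriv U e u g \<and>
          Linf_norm U g \<le> ereal M)"

text \<open>The next two predicates express membership in \<open>W\<^sup>2\<^sup>,\<^sup>\<infinity>\<close> together with a bound on all second-order
  derivatives. They are only applied to functions with finite \<open>C\<^sup>1\<close> norm, so that the
  derivatives of order at most one are classical and bounded.\<close>

definition W2inf_bdry :: "(real \<Rightarrow> real ^ 2) \<Rightarrow> real \<Rightarrow> bool" where
  "W2inf_bdry b M \<longleftrightarrow> (\<forall>i. weak_deriv_Linf_le {0<..} 1 (\<lambda>t. d1 {0..} b t $ i) M)"

definition W2inf_D :: "params \<Rightarrow> (real \<Rightarrow> real \<Rightarrow> real ^ 2) \<Rightarrow> real \<Rightarrow> bool" where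
  "W2inf_D p f M \<longleftrightarrow>
     (\<forall>i. \<forall>e\<in>{(1, 0), (0, 1)}.
        weak_deriv_Linf_le ({0<..} \<times> {0<..<len p}) e (\<lambda>(t, x). dt f t x $ i) M \<and>
        weak_deriv_Linf_le ({0<..} \<times> {0<..<len p}) e (\<lambda>(t, x). dx p f t x $ i) M)"

section \<open>The initial-boundary value problem\<close>

text \<open>Damping coefficients admissible for a given \<open>\<epsilon>\<close>. The bound on the slopes involves the same
  \<open>\<epsilon>\<close> as the size of the data, hence the coefficient has to be chosen after \<open>\<epsilon>\<close>.\<close>

definition damping :: "params \<Rightarrow> real \<Rightarrow> (real \<Rightarrow> real \<Rightarrow> real) \<Rightarrow> bool" where
  "damping p \<epsilon> \<beta> \<longleftrightarrow> C2_D p \<beta> \<and>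
     (\<forall>(t, x)\<in>Dom p. beta_lo p \<le> \<beta> t x \<and> \<beta> t x \<le> 0 \<and>
        \<bar>dt \<beta> t x\<bar> \<le> \<epsilon> \<and> \<bar>dx p \<beta> t x\<bar> \<le> \<epsilon> \<and> \<beta> (t + period p) x = \<beta> t x)"

text \<open>The pair of boundary functions is a curve \<open>b\<close> in the plane, with components \<open>\<phi>\<^sub>1\<^sub>b\<close> (imposed at
  \<open>x = L\<close>) and \<open>\<phi>\<^sub>2\<^sub>b\<close> (imposed at \<open>x = 0\<close>).\<close>

definition bdry_data :: "params \<Rightarrow> real \<Rightarrow> (real \<Rightarrow> real ^ 2) \<Rightarrow> bool" where
  "bdry_data p \<epsilon> b \<longleftrightarrow> C1_I {0..} b \<and> (\<forall>t>0. b (t + period p) = b t) \<and>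
     C1_norm_I {0..} b \<le> ereal \<epsilon>"

definition init_data :: "params \<Rightarrow> real \<Rightarrow> (real \<Rightarrow> real ^ 2) \<Rightarrow> bool" where
  "init_data p r \<phi>0 \<longleftrightarrow> C1_I {0..len p} \<phi>0 \<and> C1_norm_I {0..len p} \<phi>0 \<le> ereal r"

definition IBVP_sol ::
    "params \<Rightarrow> (real \<Rightarrow> real \<Rightarrow> real) \<Rightarrow> (real \<Rightarrow> real ^ 2) \<Rightarrow> (real \<Rightarrow> real ^ 2) \<Rightarrow>
     (real \<Rightarrow> real \<Rightarrow> real ^ 2) \<Rightarrow> bool" where
  "IBVP_sol p \<beta> b \<phi>0 \<phi> \<longleftrightarrow> C1_D p \<phi> \<and>
     (\<forall>(t, x)\<in>Dom p. \<forall>i.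
        dt \<phi> t x $ i + lam p i (\<phi> t x + Phi p) * dx p \<phi> t x $ i
        = \<beta> t x / 2 * (\<phi> t x $ 1 + \<phi> t x $ 2)) \<and>
     (\<forall>x\<in>{0..len p}. \<phi> 0 x = \<phi>0 x) \<and>
     (\<forall>t\<ge>0. \<phi> t 0 $ 2 = b t $ 2 + kap2 p * \<phi> t 0 $ 1) \<and>
     (\<forall>t\<ge>0. \<phi> t (len p) $ 1 = b t $ 1 + kap1 p * \<phi> t (len p) $ 2)"

definition compat_q ::
    "params \<Rightarrow> (real \<Rightarrow> real \<Rightarrow> real) \<Rightarrow> (real \<Rightarrow> real ^ 2) \<Rightarrow> 2 \<Rightarrow> real \<Rightarrow> real" where
  "compat_q p \<beta> \<phi>0 i x =
     - lam p i (\<phi>0 x + Phi p) * d1 {0..len p} \<phi>0 x $ i + \<beta> 0 x / 2 * (\<phi>0 x $ 1 + \<phi>0 x $ 2)"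

definition compatible ::
    "params \<Rightarrow> (real \<Rightarrow> real \<Rightarrow> real) \<Rightarrow> (real \<Rightarrow> real ^ 2) \<Rightarrow> (real \<Rightarrow> real ^ 2) \<Rightarrow> bool" where
  "compatible p \<beta> b \<phi>0 \<longleftrightarrow>
     \<phi>0 0 $ 2 = b 0 $ 2 + kap2 p * \<phi>0 0 $ 1 \<and>
     compat_q p \<beta> \<phi>0 2 0 = d1 {0..} b 0 $ 2 + kap2 p * compat_q p \<beta> \<phi>0 1 0 \<and>
     \<phi>0 (len p) $ 1 = b 0 $ 1 + kap1 p * \<phi>0 (len p) $ 2 \<and>
     compat_q p \<beta> \<phi>0 1 (len p) = d1 {0..} b 0 $ 1 + kap1 p * compat_q p \<beta> \<phi>0 2 (len p)"

section \<open>Existence, stability and regularity properties\<close>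

text \<open>In the following, \<open>per \<epsilon> \<beta> b\<close> is the time-periodic solution which the existence
  property provides for \<open>\<epsilon>\<close>, \<open>\<beta>\<close> and \<open>b\<close>.\<close>

type_synonym periodic_solutions =
  "real \<Rightarrow> (real \<Rightarrow> real \<Rightarrow> real) \<Rightarrow> (real \<Rightarrow> real ^ 2) \<Rightarrow> real \<Rightarrow> real \<Rightarrow> real ^ 2"

definition existence_property :: "params \<Rightarrow> periodic_solutions \<Rightarrow> real \<Rightarrow> real \<Rightarrow> bool" where
  "existence_property p per \<epsilon>1 CE \<longleftrightarrow> 0 < \<epsilon>1 \<and> 0 < CE \<and>
     (\<forall>\<epsilon> \<beta> b. 0 < \<epsilon> \<and> \<epsilon> < \<epsilon>1 \<and> damping p \<epsilon> \<beta> \<and> bdry_data p \<epsilon> b \<longrightarrow>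
        (\<exists>\<phi>0. init_data p (CE * \<epsilon>) \<phi>0 \<and> IBVP_sol p \<beta> b \<phi>0 (per \<epsilon> \<beta> b)) \<and>
        (\<forall>(t, x)\<in>Dom p. per \<epsilon> \<beta> b (t + period p) x = per \<epsilon> \<beta> b t x) \<and>
        C1_norm_D p (per \<epsilon> \<beta> b) \<le> ereal (CE * \<epsilon>))"

definition C0_convergence ::
    "params \<Rightarrow> (real ^ 2) set \<Rightarrow> real \<Rightarrow> real \<Rightarrow> (real \<Rightarrow> real \<Rightarrow> real ^ 2) \<Rightarrow>
     (real \<Rightarrow> real \<Rightarrow> real ^ 2) \<Rightarrow> bool" where
  "C0_convergence p Psi C \<xi> \<phi> \<phi>T \<longleftrightarrow>
     (\<forall>t\<ge>0. sup_norm {0..len p} (\<lambda>x. \<phi> t x - \<phi>T t x) \<le> ereal (C * \<xi> ^ nat \<lfloor>t / T0 p Psi\<rfloor>))"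

definition C1_convergence ::
    "params \<Rightarrow> (real ^ 2) set \<Rightarrow> real \<Rightarrow> real \<Rightarrow> (real \<Rightarrow> real \<Rightarrow> real ^ 2) \<Rightarrow>
     (real \<Rightarrow> real \<Rightarrow> real ^ 2) \<Rightarrow> bool" where
  "C1_convergence p Psi C \<xi> \<phi> \<phi>T \<longleftrightarrow>
     (\<forall>t\<ge>0. max (sup_norm {0..len p} (\<lambda>x. dt \<phi> t x - dt \<phi>T t x))
                (sup_norm {0..len p} (\<lambda>x. dx p \<phi> t x - dx p \<phi>T t x))
            \<le> ereal (C * \<xi> ^ nat \<lfloor>t / T0 p Psi\<rfloor>))"

definition stability_property ::
    "params \<Rightarrow> (real ^ 2) set \<Rightarrow> periodic_solutions \<Rightarrow> real \<Rightarrow> real \<Rightarrow> real \<Rightarrow> real \<Rightarrow> real \<Rightarrow> bool" where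
  "stability_property p Psi per \<epsilon>1 CE \<epsilon>2 CS \<xi> \<longleftrightarrow>
     0 < \<epsilon>2 \<and> \<epsilon>2 < \<epsilon>1 \<and> 0 < CS \<and> 0 < \<xi> \<and> \<xi> < 1 \<and>
     (\<forall>\<epsilon> \<beta> b \<phi>0. 0 < \<epsilon> \<and> \<epsilon> < \<epsilon>2 \<and> damping p \<epsilon> \<beta> \<and> bdry_data p \<epsilon> b \<and>
        init_data p (CE * \<epsilon>) \<phi>0 \<and> compatible p \<beta> b \<phi>0 \<longrightarrow>
        (\<exists>\<phi>. IBVP_sol p \<beta> b \<phi>0 \<phi> \<and>
             (\<forall>\<phi>'. IBVP_sol p \<beta> b \<phi>0 \<phi>' \<longrightarrow> (\<forall>(t, x)\<in>Dom p. \<phi>' t x = \<phi> t x)) \<and>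
             C0_convergence p Psi (CS * \<epsilon>) \<xi> \<phi> (per \<epsilon> \<beta> b)))"

text \<open>Boundary functions with second derivatives bounded by \<open>M2\<close>. The threshold \<open>\<epsilon>4\<close> is
  uniform in the damping coefficient. The constant \<open>CR\<close> may depend on it: second derivatives of
  the solution involve those of \<open>\<beta>\<close>, on which \<^const>\<open>damping\<close> puts no uniform bound.\<close>

definition regularity_property ::
    "params \<Rightarrow> real \<Rightarrow> periodic_solutions \<Rightarrow> real \<Rightarrow> real \<Rightarrow>
     ((real \<Rightarrow> real \<Rightarrow> real) \<Rightarrow> real) \<Rightarrow> real \<Rightarrow> bool" where
  "regularity_property p A0 per \<epsilon>1 M2 CR \<epsilon>4 \<longleftrightarrow>
     (\<forall>\<beta>. 0 < CR \<beta>) \<and> 0 < \<epsilon>4 \<and> \<epsilon>4 < \<epsilon>1 \<and>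
     (\<forall>\<epsilon> \<beta> b. 0 < \<epsilon> \<and> \<epsilon> < \<epsilon>4 \<and> damping p \<epsilon> \<beta> \<and> bdry_data p \<epsilon> b \<and> W2inf_bdry b M2 \<longrightarrow>
        W2inf_D p (per \<epsilon> \<beta> b) ((1 + A0)\<^sup>2 * CR \<beta>))"

end

theory Submission
  imports Defs "HOL-Real_Asymp.Real_Asymp"
begin

text \<open>Let \<open>w = \<phi> - \<psi>\<close> be the difference of the solution and the periodic solution. Difference quotients
  of \<open>w\<close> in time satisfy a transport system whose source contains \<open>w\<close> times the (Lipschitz)
  derivative of \<open>\<psi>\<close>, of size \<open>\<epsilon> \<xi>\<^bsup>[t/T\<^sub>0]\<^esup>\<close> by the \<open>C\<^sup>0\<close> convergence. The damping couples the two components,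
  but the coupling is an exact derivative along characteristics up to small terms, so it can be
  traded for values of \<open>w\<close>. What remains decays, up to factors \<open>1 + O(\<epsilon>)\<close>, at the rate
  \<open>\<bar>\<kappa>\<^sub>1 \<kappa>\<^sub>2\<bar>\<close> per round trip \<open>2 L / c\<close>, where \<open>c\<close> is the sound speed of the background. A
  maximum principle with exponential weights turns this into the claim if \<open>\<xi>\<close> is strictly larger than
  that rate. Since \<open>\<xi>\<close> is only known to satisfy (S), this has to be extracted from (S) itself: for
  \<open>\<beta> = 0\<close> there are constant states with slower wave speeds, whose perturbations decay strictly more
  slowly.\<close>

section \<open>Maximum principle for a pair of transport equations\<close>

text \<open>The solutions are only C^1, so the equation cannot be differentiated; quotients with a
  finite step replace derivatives. The step is fixed after the time horizon, while no constant
  depends on either. Quotients are taken in time because the reflection laws survive a shift in time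
  but not one in space; the space derivative is read off from the equation afterwards. A second
  obstacle: (S) controls \<open>\<phi>\<close> only in C^0, whereas the estimate presupposes speeds
  that vary slowly in time, that is, a small \<open>dt \<phi>\<close>. The same estimate without
  decay, applied to \<open>\<phi>\<close> itself in a continuation argument, supplies this bound.
  The losses are affordable because the rate \<open>\<sigma>\<close> with
  \<open>exp (- \<sigma> * T0 p Psi) = \<xi>\<close> leaves a strict surplus; the smallness
  thresholds consume part of that surplus and are uniform in the damping coefficient. Only the final
  constant depends on the coefficient, through \<open>CR\<close>.\<close>

definition oth :: "2 \<Rightarrow> 2" where
  "oth i = (if i = 1 then 2 else 1)"

definition sg :: "2 \<Rightarrow> real" where
  "sg i = (if i = 1 then - 1 else 1)"

text \<open>Family 1 moves to the left and enters at \<open>L\<close>, family 2 enters at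
  \<open>0\<close>; the boundary condition prescribes component \<open>i\<close> exactly at this
  end.\<close>

definition inflow :: "real \<Rightarrow> 2 \<Rightarrow> real" where
  "inflow L i = (if i = 1 then L else 0)"

lemma oth_simps [simp]: "oth 1 = 2" "oth 2 = 1" "oth (oth i) = i"
  using exhaust_2[of i] by (auto simp: oth_def)

lemma sg_simps [simp]: "sg 1 = - 1" "sg 2 = 1" "sg (oth i) = - sg i" "\<bar>sg i\<bar> = 1" "sg i * sg i = 1"
  using exhaust_2[of i] by (auto simp: oth_def sg_def)

lemma inflow_simps [simp]: "inflow L 1 = L" "inflow L 2 = 0"
  by (auto simp: inflow_def)

lemma inflow_mem [simp]: "0 \<le> L \<Longrightarrow> inflow L i \<in> {0..L}"
  by (auto simp: inflow_def)

text \<open>The points of the box where some component is at least \<open>N\<close> form a compact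
  set, and one with least time is the touching point. The bound includes the touching time itself,
  so that the maximum can also be compared with its own time slice.\<close>

lemma first_touch:
  fixes f :: "2 \<Rightarrow> real \<Rightarrow> real \<Rightarrow> real"
  assumes cont: "\<And>i. continuous_on ({0..T} \<times> {0..L}) (\<lambda>(t, x). f i t x)"
    and init: "\<And>i x. x \<in> {0..L} \<Longrightarrow> f i 0 x < N"
    and ex: "t1 \<in> {0..T}" "x1 \<in> {0..L}" "N \<le> f i1 t1 x1"
  obtains i t x where "0 < t" "t \<le> T" "x \<in> {0..L}" "f i t x = N"
    "\<And>j s y. 0 \<le> s \<Longrightarrow> s \<le> t \<Longrightarrow> y \<in> {0..L} \<Longrightarrow> f j s y \<le> N"
proof -
  define B where "B = {0..T} \<times> {0..L}"
  define K where "K = (\<Union>i. {z \<in> B. N \<le> (\<lambda>(t, x). f i t x) z})"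
  have compB: "compact B"
    unfolding B_def by (intro compact_Times) auto
  have "compact {z \<in> B. N \<le> (\<lambda>(t, x). f i t x) z}" for i
  proof -
    have "closedin (top_of_set B) (B \<inter> (\<lambda>(t, x). f i t x) -` {N..})"
      by (rule continuous_closedin_preimage) (use cont[of i] in \<open>auto simp: B_def\<close>)
    then have "compact (B \<inter> (\<lambda>(t, x). f i t x) -` {N..})"
      by (rule closedin_compact[OF compB])
    moreover have "B \<inter> (\<lambda>(t, x). f i t x) -` {N..} = {z \<in> B. N \<le> (\<lambda>(t, x). f i t x) z}"
      by auto
    ultimately show ?thesis by simp
  qed
  then have "compact K"
    unfolding K_def by (intro compact_UN) auto
  moreover have "(t1, x1) \<in> K"
    unfolding K_def by (rule UN_I[of i1]) (use ex in \<open>auto simp: B_def\<close>)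
  then have "K \<noteq> {}" by (rule ex_in_conv[THEN iffD1, OF exI])
  ultimately obtain z where z: "z \<in> K" "\<And>y. y \<in> K \<Longrightarrow> fst z \<le> fst y"
    by (metis continuous_attains_inf continuous_on_fst continuous_on_id)
  obtain t x where tx: "z = (t, x)" by force
  obtain i where i: "N \<le> f i t x" and B: "t \<in> {0..T}" "x \<in> {0..L}"
    using z(1) tx unfolding K_def B_def by auto
  have low: "f j s y < N" if "0 \<le> s" "s < t" "y \<in> {0..L}" for j s y
  proof (rule ccontr)
    assume "\<not> f j s y < N"
    then have "(s, y) \<in> K"
      unfolding K_def by (intro UN_I[of j]) (use that B in \<open>auto simp: B_def\<close>)
    with z(2)[of "(s, y)"] tx that show False by simp
  qed
  have t0: "0 < t"
    using i init[OF B(2), of i] B(1) by (cases "t = 0") auto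
  have le: "f j s y \<le> N" if "0 \<le> s" "s \<le> t" "y \<in> {0..L}" for j s y
  proof (cases "s = t")
    case True
    show ?thesis
    proof (rule ccontr)
      assume "\<not> f j s y \<le> N"
      then have gt: "f j t y > N" using True by simp
      \<comment> \<open>A level strictly between \<open>N\<close> and the value: continuity in time
        forces it to be taken before \<open>t\<close>, where all values are below
        \<open>N\<close>.\<close>
      define M where "M = (f j t y + N) / 2"
      have M: "N < M" "M < f j t y" using gt by (auto simp: M_def)
      have "continuous_on {0..t} (\<lambda>r. (\<lambda>(t, x). f j t x) (r, y))"
        by (rule continuous_on_compose2[OF cont[of j]])
           (use that B in \<open>auto intro!: continuous_intros\<close>)
      then have c: "continuous_on {0..t} (\<lambda>r. f j r y)" by simp
      have "\<exists>r. 0 \<le> r \<and> r \<le> t \<and> f j r y = M"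
        by (rule IVT') (use M init[OF that(3), of j] t0 c in auto)
      then obtain r where r: "0 \<le> r" "r \<le> t" "f j r y = M" by blast
      then have "r < t" using M by (cases "r = t") auto
      with low[OF r(1) this that(3), of j] r(3) M show False by simp
    qed
  next
    case False
    then show ?thesis using low[of s y j] that by simp
  qed
  have "f i t x = N" using i le[of t x i] t0 B by simp
  then show ?thesis using that[of t x i] t0 B le by auto
qed

section \<open>One-sided derivative tests at a maximum\<close>

lemma deriv_at_left_max:
  fixes g :: "real \<Rightarrow> real"
  assumes "(g has_real_derivative d) (at t within S)" "0 < r" "{t - r..t} \<subseteq> S"
    and "\<And>s. s \<in> S \<Longrightarrow> s < t \<Longrightarrow> g s \<le> g t"
  shows "0 \<le> d"
proof (rule ccontr)
  assume "\<not> 0 \<le> d"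
  then obtain e where e: "e > 0" "\<And>h. h > 0 \<Longrightarrow> t - h \<in> S \<Longrightarrow> h < e \<Longrightarrow> g t < g (t - h)"
    using has_real_derivative_neg_dec_left[OF assms(1)] by force
  define h where "h = min r e / 2"
  have h: "h > 0" "h < e" "h \<le> r" using assms(2) e(1) by (auto simp: h_def)
  then have "t - h \<in> S" using assms(3) by auto
  with e(2)[OF h(1) this h(2)] assms(4)[OF this] h show False by simp
qed

lemma deriv_at_right_max:
  fixes g :: "real \<Rightarrow> real"
  assumes "(g has_real_derivative d) (at t within S)" "0 < r" "{t..t + r} \<subseteq> S"
    and "\<And>s. s \<in> S \<Longrightarrow> s > t \<Longrightarrow> g s \<le> g t"
  shows "d \<le> 0"
proof (rule ccontr)
  assume "\<not> d \<le> 0"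
  then obtain e where e: "e > 0" "\<And>h. h > 0 \<Longrightarrow> t + h \<in> S \<Longrightarrow> h < e \<Longrightarrow> g t < g (t + h)"
    using has_real_derivative_pos_inc_right[OF assms(1)] by force
  define h where "h = min r e / 2"
  have h: "h > 0" "h < e" "h \<le> r" using assms(2) e(1) by (auto simp: h_def)
  then have "t + h \<in> S" using assms(3) by auto
  with e(2)[OF h(1) this h(2)] assms(4)[OF this] h show False by simp
qed

text \<open>Away from the inflow end there is room on the upstream side of \<open>x\<close>, even
  when \<open>x\<close> is the outflow end, and a comparison on that side alone decides the
  sign.\<close>

lemma space_deriv_at_max:
  assumes dx: "(g has_real_derivative gx) (at x within {0..L})"
    and x: "x \<in> {0..L}" "x \<noteq> inflow L i" and L: "0 < L"
    and mx: "\<And>y. y \<in> {0..L} \<Longrightarrow> g y \<le> g x"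
  shows "0 \<le> sg i * gx"
proof (cases "i = 1")
  case True
  have "gx \<le> 0"
    by (rule deriv_at_right_max[OF dx, of "L - x"]) (use True x mx in auto)
  then show ?thesis using True by simp
next
  case False
  then have i: "i = 2" using exhaust_2[of i] by simp
  have "0 \<le> gx"
    by (rule deriv_at_left_max[OF dx, of x]) (use i x mx in auto)
  then show ?thesis using i by simp
qed

lemma transport_at_max:
  assumes "((\<lambda>s. u s x) has_real_derivative ut) (at t within {0..})" "0 < t"
    and "(u t has_real_derivative ux) (at x within {0..L})"
    and "x \<in> {0..L}" "x \<noteq> inflow L i" "0 < L" "0 \<le> sg i * l"
    and mx: "\<And>s y. 0 \<le> s \<Longrightarrow> s \<le> t \<Longrightarrow> y \<in> {0..L} \<Longrightarrow> u s y \<le> (u t x :: real)"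
  shows "0 \<le> ut + l * ux"
proof -
  have 1: "0 \<le> ut"
    by (rule deriv_at_left_max[OF assms(1), of t]) (use assms in auto)
  have "0 \<le> sg i * ux"
    by (rule space_deriv_at_max[OF assms(3)]) (use assms in auto)
  then have "0 \<le> (sg i * l) * (sg i * ux)"
    using assms(7) by (rule mult_nonneg_nonneg[rotated])
  also have "\<dots> = (sg i * sg i) * (l * ux)" by (simp only: mult_ac)
  finally show ?thesis using 1 by simp
qed

text \<open>The derivatives are explicit arguments, so that sums, products and time shifts come with
  their derivatives; at the edges of the strip they are one-sided.\<close>

definition C1s :: "real \<Rightarrow> (real \<Rightarrow> real \<Rightarrow> real) \<Rightarrow> (real \<Rightarrow> real \<Rightarrow> real) \<Rightarrow>
    (real \<Rightarrow> real \<Rightarrow> real) \<Rightarrow> bool" where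
  "C1s L f ft fx \<longleftrightarrow>
     (\<forall>t\<ge>0. \<forall>x\<in>{0..L}. ((\<lambda>s. f s x) has_real_derivative ft t x) (at t within {0..}) \<and>
        (f t has_real_derivative fx t x) (at x within {0..L})) \<and>
     continuous_on ({0..} \<times> {0..L}) (\<lambda>(t, x). f t x) \<and>
     continuous_on ({0..} \<times> {0..L}) (\<lambda>(t, x). ft t x) \<and>
     continuous_on ({0..} \<times> {0..L}) (\<lambda>(t, x). fx t x)"

text \<open>The weight decreases in the direction of travel: along characteristics of speed at least
  \<open>c'\<close> it falls at relative rate at least \<open>c' * \<alpha>\<close>, which pays for
  the growth of \<open>exp (\<sigma> * t)\<close>. The factors \<open>a\<close> balance the
  reflections at the two ends.\<close>

definition wgt :: "real \<Rightarrow> (2 \<Rightarrow> real) \<Rightarrow> 2 \<Rightarrow> real \<Rightarrow> real" where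
  "wgt \<alpha> a i x = a i * exp (- sg i * \<alpha> * x)"

lemma wgt_pos: "(\<And>i. 0 < a i) \<Longrightarrow> 0 < wgt \<alpha> a i x"
  by (simp add: wgt_def)

lemma weighted_derivs:
  assumes "((\<lambda>s. V s x) has_real_derivative vt) (at t within S)"
    and "(V t has_real_derivative vx) (at x within S')"
  shows "((\<lambda>s. z * V s x * (exp (\<sigma> * s) * wgt \<alpha> a i x)) has_real_derivative
       z * (vt + \<sigma> * V t x) * (exp (\<sigma> * t) * wgt \<alpha> a i x)) (at t within S)"
    and "((\<lambda>y. z * V t y * (exp (\<sigma> * t) * wgt \<alpha> a i y)) has_real_derivative
       z * (vx - sg i * \<alpha> * V t x) * (exp (\<sigma> * t) * wgt \<alpha> a i x)) (at x within S')"
  unfolding wgt_def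
  by (auto intro!: derivative_eq_intros assms simp: algebra_simps)

lemma abs_le_mult_bound:
  fixes z v c :: real
  assumes "\<bar>z\<bar> \<le> c"
  shows "z * v \<le> c * \<bar>v\<bar>"
proof -
  have "z * v \<le> \<bar>z\<bar> * \<bar>v\<bar>" using abs_ge_self[of "z * v"] by (simp add: abs_mult)
  also have "\<dots> \<le> c * \<bar>v\<bar>" using assms by (rule mult_right_mono) simp
  finally show ?thesis .
qed

text \<open>At a first point where the weighted maximum reaches \<open>N\<close> the transport operator applied to the
  weighted component is nonnegative, which the decay condition \<open>\<sigma> + \<theta> (1 + R) + \<mu> \<le> c' \<alpha>\<close> (interior) and the
  factor \<open>q < 1\<close> (inflow boundary) exclude.\<close>

lemma max_principle:
  fixes V Vt Vx lam :: "2 \<Rightarrow> real \<Rightarrow> real \<Rightarrow> real"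
  assumes L: "0 < L" and a: "\<And>i. 0 < a i"
    and V: "\<And>i. C1s L (V i) (Vt i) (Vx i)"
    and init: "\<And>i x. x \<in> {0..L} \<Longrightarrow> \<bar>V i 0 x\<bar> * wgt \<alpha> a i x < N"
    and bdry: "\<And>i t. 0 < t \<Longrightarrow> t \<le> T \<Longrightarrow>
       \<bar>V i t (inflow L i)\<bar> \<le> k i * \<bar>V (oth i) t (inflow L i)\<bar> + J * exp (- \<sigma> * t)"
    and q: "\<And>i. wgt \<alpha> a i (inflow L i) * k i \<le> q * wgt \<alpha> a (oth i) (inflow L i)" "0 \<le> q"
    and Amax: "\<And>i x. x \<in> {0..L} \<Longrightarrow> wgt \<alpha> a i x \<le> Amax" and J: "0 \<le> J"
    and N: "Amax * J < N * (1 - q)" "Amax * J < \<mu> * N"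
    and R: "\<And>i x. x \<in> {0..L} \<Longrightarrow> wgt \<alpha> a i x \<le> R * wgt \<alpha> a (oth i) x"
    and sp: "\<And>i t x. 0 < t \<Longrightarrow> t \<le> T \<Longrightarrow> x \<in> {0..L} \<Longrightarrow> c' \<le> sg i * lam i t x" "0 \<le> c'" "0 \<le> \<alpha>"
    and be: "\<And>t x. 0 < t \<Longrightarrow> t \<le> T \<Longrightarrow> x \<in> {0..L} \<Longrightarrow> \<beta> t x \<le> 0"
    and eq: "\<And>i t x. 0 < t \<Longrightarrow> t \<le> T \<Longrightarrow> x \<in> {0..L} \<Longrightarrow>
       \<bar>Vt i t x + lam i t x * Vx i t x - \<beta> t x / 2 * V i t x\<bar>
         \<le> \<theta> * (\<bar>V i t x\<bar> + \<bar>V (oth i) t x\<bar>) + J * exp (- \<sigma> * t)"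
    and th: "0 \<le> \<theta>" "\<sigma> + \<theta> * (1 + R) + \<mu> \<le> c' * \<alpha>"
    and t: "0 \<le> t" "t \<le> T" "x \<in> {0..L}"
  shows "\<bar>V i t x\<bar> * (exp (\<sigma> * t) * wgt \<alpha> a i x) < N"
proof (rule ccontr)
  define f where "f = (\<lambda>i t x. \<bar>V i t x\<bar> * (exp (\<sigma> * t) * wgt \<alpha> a i x))"
  have wp: "0 < wgt \<alpha> a i x" for i x using wgt_pos[OF a] .
  assume "\<not> ?thesis"
  then have ge: "N \<le> f i t x" by (simp add: f_def)
  have cont: "continuous_on ({0..T} \<times> {0..L}) (\<lambda>(t, x). f i t x)" for i
  proof -
    have "continuous_on ({0..T} \<times> {0..L}) (\<lambda>(t, x). V i t x)"
      by (rule continuous_on_subset[of "{0..} \<times> {0..L}"]) (use V[of i] in \<open>auto simp: C1s_def\<close>)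
    then show ?thesis
      unfolding f_def wgt_def by (auto intro!: continuous_intros simp: case_prod_unfold)
  qed
  have i0: "f i 0 x < N" if "x \<in> {0..L}" for i x
    using init[OF that, of i] by (simp add: f_def)
  have "t \<in> {0..T}" using t by simp
  from first_touch[where f=f, OF cont i0 this t(3) ge] obtain j s y where
    s: "0 < s" "s \<le> T" "y \<in> {0..L}" and eqN: "f j s y = N"
    and le: "\<And>k r z. 0 \<le> r \<Longrightarrow> r \<le> s \<Longrightarrow> z \<in> {0..L} \<Longrightarrow> f k r z \<le> N"
    by metis
  define W where "W = exp (\<sigma> * s) * wgt \<alpha> a j y"
  have W: "0 < W" unfolding W_def using wp by simp
  have NV: "N = \<bar>V j s y\<bar> * W" using eqN by (simp add: f_def W_def)
  have ee: "exp (- \<sigma> * s) * exp (\<sigma> * s) = 1" by (simp add: exp_minus)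
  \<comment> \<open>The forcing decays like \<open>exp (- \<sigma> * s)\<close>; the time weight
    cancels this and a constant remains.\<close>
  have JW: "J * exp (- \<sigma> * s) * W \<le> Amax * J"
  proof -
    have "J * exp (- \<sigma> * s) * W = J * wgt \<alpha> a j y * (exp (- \<sigma> * s) * exp (\<sigma> * s))"
      by (simp add: W_def)
    also have "\<dots> = J * wgt \<alpha> a j y" by (simp only: ee mult_1_right)
    also have "\<dots> \<le> J * Amax" using Amax[OF s(3)] J by (intro mult_left_mono)
    finally show ?thesis by (simp add: mult.commute)
  qed
  show False
  proof (cases "y = inflow L j")
    case True
    have "N = \<bar>V j s y\<bar> * W" by (rule NV)
    also have "\<dots> \<le> (k j * \<bar>V (oth j) s y\<bar> + J * exp (- \<sigma> * s)) * W"
      using bdry[OF s(1,2), of j] True W by (intro mult_right_mono) auto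
    also have "\<dots> = \<bar>V (oth j) s y\<bar> * exp (\<sigma> * s) * (wgt \<alpha> a j y * k j) + J * exp (- \<sigma> * s) * W"
      by (simp add: W_def algebra_simps)
    also have "\<dots> \<le> \<bar>V (oth j) s y\<bar> * exp (\<sigma> * s) * (q * wgt \<alpha> a (oth j) y) + Amax * J"
      using q(1)[of j] True JW by (intro add_mono mult_left_mono) auto
    also have "\<bar>V (oth j) s y\<bar> * exp (\<sigma> * s) * (q * wgt \<alpha> a (oth j) y) = q * f (oth j) s y"
      by (simp add: f_def)
    also have "\<dots> \<le> q * N" using le[of s y "oth j"] s q(2) by (intro mult_left_mono) auto
    finally show False using N(1) by (simp add: algebra_simps)
  next
    case False
    \<comment> \<open>Freezing the sign at the touching point replaces the absolute value by a
      differentiable function that lies below it everywhere and agrees with it at that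
      point.\<close>
    define z where "z = sgn (V j s y)"
    have zV: "z * V j s y = \<bar>V j s y\<bar>" by (simp add: z_def abs_sgn)
    have z1: "\<bar>z\<bar> \<le> 1" by (simp add: z_def sgn_if)
    define u where "u = (\<lambda>r x. z * V j r x * (exp (\<sigma> * r) * wgt \<alpha> a j x))"
    have d: "((\<lambda>r. V j r y) has_real_derivative Vt j s y) (at s within {0..})"
      "(V j s has_real_derivative Vx j s y) (at y within {0..L})"
      using V[of j] s by (auto simp: C1s_def)
    note wd = weighted_derivs[OF d, where z=z and \<sigma>=\<sigma> and \<alpha>=\<alpha> and a=a and i=j]
    have zle: "z * V j r x \<le> \<bar>V j r x\<bar>" for r x
    proof -
      have "z * V j r x \<le> 1 * \<bar>V j r x\<bar>" by (intro abs_le_mult_bound z1)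
      then show ?thesis by simp
    qed
    have umax: "u r x \<le> u s y" if "0 \<le> r" "r \<le> s" "x \<in> {0..L}" for r x
    proof -
      have "u r x \<le> f j r x" unfolding u_def f_def
        using zle[of r x] wp[of j x] by (intro mult_right_mono) auto
      also have "\<dots> \<le> N" using le that by simp
      also have "\<dots> = u s y" using eqN zV by (simp add: u_def f_def)
      finally show ?thesis .
    qed
    have sl: "0 \<le> sg j * lam j s y" using sp(1)[OF s, of j] sp(2) by linarith
    have "0 \<le> z * (Vt j s y + \<sigma> * V j s y) * W + lam j s y * (z * (Vx j s y - sg j * \<alpha> * V j s y) * W)"
      unfolding W_def
      by (rule transport_at_max[where u=u, OF _ s(1) _ s(3) False L sl umax])
         (use wd in \<open>auto simp: u_def\<close>)
    also have "\<dots> = (z * (Vt j s y + lam j s y * Vx j s y - \<beta> s y / 2 * V j s y)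
        + (\<beta> s y / 2 + \<sigma> - sg j * lam j s y * \<alpha>) * (z * V j s y)) * W"
      by (simp add: algebra_simps)
    finally have "0 \<le> z * (Vt j s y + lam j s y * Vx j s y - \<beta> s y / 2 * V j s y)
        + (\<beta> s y / 2 + \<sigma> - sg j * lam j s y * \<alpha>) * \<bar>V j s y\<bar>"
      using W zV by (simp add: zero_le_mult_iff)
    also have "z * (Vt j s y + lam j s y * Vx j s y - \<beta> s y / 2 * V j s y)
       \<le> 1 * \<bar>Vt j s y + lam j s y * Vx j s y - \<beta> s y / 2 * V j s y\<bar>"
      by (intro abs_le_mult_bound z1)
    also have "\<dots> \<le> \<theta> * (\<bar>V j s y\<bar> + \<bar>V (oth j) s y\<bar>) + J * exp (- \<sigma> * s)"
      using eq[OF s, of j] by simp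
    \<comment> \<open>The weighted maximum sits at component \<open>j\<close>, so it dominates the
      other component too; \<open>R\<close> is the price of comparing the two weights.\<close>
    also have "\<bar>V (oth j) s y\<bar> \<le> R * \<bar>V j s y\<bar>"
    proof -
      have "\<bar>V (oth j) s y\<bar> * (exp (\<sigma> * s) * wgt \<alpha> a (oth j) y) \<le> N"
        using le[of s y "oth j"] s by (simp add: f_def)
      also have "N \<le> \<bar>V j s y\<bar> * (exp (\<sigma> * s) * (R * wgt \<alpha> a (oth j) y))"
        unfolding NV W_def using R[OF s(3), of j] by (intro mult_left_mono) auto
      also have "\<dots> = R * \<bar>V j s y\<bar> * (exp (\<sigma> * s) * wgt \<alpha> a (oth j) y)" by simp
      finally show ?thesis using wp[of "oth j" y] by simp
    qed
    finally have "0 \<le> \<theta> * (\<bar>V j s y\<bar> + R * \<bar>V j s y\<bar>) + J * exp (- \<sigma> * s)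
        + (\<beta> s y / 2 + \<sigma> - sg j * lam j s y * \<alpha>) * \<bar>V j s y\<bar>"
      using th(1) by (simp add: mult_left_mono)
    also have "(\<beta> s y / 2 + \<sigma> - sg j * lam j s y * \<alpha>) * \<bar>V j s y\<bar> \<le> (- \<theta> * (1 + R) - \<mu>) * \<bar>V j s y\<bar>"
    proof (intro mult_right_mono)
      have "c' * \<alpha> \<le> sg j * lam j s y * \<alpha>" using sp(1)[OF s, of j] sp(3) by (intro mult_right_mono)
      then show "\<beta> s y / 2 + \<sigma> - sg j * lam j s y * \<alpha> \<le> - \<theta> * (1 + R) - \<mu>"
        using th(2) be[OF s] by (simp add: algebra_simps)
    qed simp
    finally have "\<mu> * \<bar>V j s y\<bar> \<le> J * exp (- \<sigma> * s)" by (simp add: algebra_simps)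
    then have "\<mu> * \<bar>V j s y\<bar> * W \<le> J * exp (- \<sigma> * s) * W" using W by (intro mult_right_mono) auto
    then show False using JW N(2) NV by (simp add: mult.assoc)
  qed
qed

section \<open>Difference quotients in time\<close>

lemma C1s_D:
  assumes "C1s L f ft fx" "0 \<le> t" "x \<in> {0..L}"
  shows "((\<lambda>s. f s x) has_real_derivative ft t x) (at t within {0..})"
    "(f t has_real_derivative fx t x) (at x within {0..L})"
  using assms unfolding C1s_def by auto

lemma C1s_cont:
  assumes "C1s L f ft fx"
  shows "continuous_on ({0..} \<times> {0..L}) (\<lambda>(t, x). f t x)"
    "continuous_on ({0..} \<times> {0..L}) (\<lambda>(t, x). ft t x)"
    "continuous_on ({0..} \<times> {0..L}) (\<lambda>(t, x). fx t x)"
  using assms unfolding C1s_def by auto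

lemma C1s_add:
  assumes "C1s L f ft fx" "C1s L g gt gx"
  shows "C1s L (\<lambda>t x. f t x + g t x) (\<lambda>t x. ft t x + gt t x) (\<lambda>t x. fx t x + gx t x)"
  using assms unfolding C1s_def
  by (auto intro!: derivative_eq_intros continuous_intros simp: case_prod_unfold)

lemma C1s_const: "C1s L (\<lambda>t x. k) (\<lambda>t x. 0) (\<lambda>t x. 0)"
  unfolding C1s_def by (auto intro!: derivative_eq_intros)

lemma C1s_diff:
  assumes "C1s L f ft fx" "C1s L g gt gx"
  shows "C1s L (\<lambda>t x. f t x - g t x) (\<lambda>t x. ft t x - gt t x) (\<lambda>t x. fx t x - gx t x)"
  using assms unfolding C1s_def
  by (auto intro!: derivative_eq_intros continuous_intros simp: case_prod_unfold)

lemma C1s_mult: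
  assumes "C1s L f ft fx" "C1s L g gt gx"
  shows "C1s L (\<lambda>t x. f t x * g t x) (\<lambda>t x. ft t x * g t x + f t x * gt t x)
    (\<lambda>t x. fx t x * g t x + f t x * gx t x)"
  using assms unfolding C1s_def
  by (auto intro!: derivative_eq_intros continuous_intros simp: case_prod_unfold)

lemma C1s_cmult:
  assumes "C1s L f ft fx"
  shows "C1s L (\<lambda>t x. k * f t x) (\<lambda>t x. k * ft t x) (\<lambda>t x. k * fx t x)"
  using assms unfolding C1s_def
  by (auto intro!: derivative_eq_intros continuous_intros simp: case_prod_unfold)

lemma continuous_on_shift:
  fixes f :: "real \<Rightarrow> real \<Rightarrow> real"
  assumes "continuous_on ({0..} \<times> {0..L}) (\<lambda>(t, x). f t x)" "0 \<le> h"
  shows "continuous_on ({0..} \<times> {0..L}) (\<lambda>(t, x). f (t + h) x)"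
proof -
  have "continuous_on ({0..} \<times> {0..L}) (\<lambda>z. (\<lambda>(t, x). f t x) (fst z + h, snd z))"
    by (rule continuous_on_compose2[OF assms(1)])
       (use assms(2) in \<open>auto intro!: continuous_intros\<close>)
  then show ?thesis by (simp add: case_prod_unfold)
qed

lemma C1s_shift:
  assumes f: "C1s L f ft fx" and h: "0 \<le> h"
  shows "C1s L (\<lambda>t x. f (t + h) x) (\<lambda>t x. ft (t + h) x) (\<lambda>t x. fx (t + h) x)"
  unfolding C1s_def
proof (intro conjI allI impI ballI)
  fix t x :: real assume t: "0 \<le> t" and x: "x \<in> {0..L}"
  have "((\<lambda>s. f s x) has_real_derivative ft (t + h) x) (at (t + h) within (\<lambda>s. s + h) ` {0..})"
    by (rule DERIV_subset[OF C1s_D(1)[OF f]]) (use t x h in auto)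
  moreover have "((\<lambda>s. s + h) has_real_derivative 1) (at t within {0..})"
    by (auto intro!: derivative_eq_intros)
  ultimately
  show "((\<lambda>s. f (s + h) x) has_real_derivative ft (t + h) x) (at t within {0..})"
    using DERIV_image_chain by (fastforce simp: o_def)
  show "(f (t + h) has_real_derivative fx (t + h) x) (at x within {0..L})"
    using C1s_D(2)[OF f] t x h by auto
qed (use C1s_cont[OF f] continuous_on_shift h in auto)

text \<open>Uniform continuity on a compact box. All intermediate shifts \<open>r\<close> are
  covered because \<open>unif_quot\<close> evaluates the derivative at an intermediate time of the
  mean value theorem.\<close>

lemma unif_shift:
  fixes f :: "real \<Rightarrow> real \<Rightarrow> real"
  assumes "continuous_on ({0..} \<times> {0..L}) (\<lambda>(t, x). f t x)" "0 < e"
  shows "\<forall>\<^sub>F h in at_right 0. \<forall>t\<in>{0..T}. \<forall>x\<in>{0..L}. \<forall>r\<in>{0..h}. \<bar>f (t + r) x - f t x\<bar> < e"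
proof -
  \<comment> \<open>Shifted times leave \<open>{0..T}\<close>; a margin of length one suffices for
    \<open>h < 1\<close>.\<close>
  have "uniformly_continuous_on ({0..T + 1} \<times> {0..L}) (\<lambda>(t, x). f t x)"
    by (rule compact_uniformly_continuous[OF continuous_on_subset[OF assms(1)]])
       (auto intro!: compact_Times)
  then obtain d where d: "d > 0"
    "\<And>z z'. z \<in> {0..T + 1} \<times> {0..L} \<Longrightarrow> z' \<in> {0..T + 1} \<times> {0..L} \<Longrightarrow> dist z' z < d \<Longrightarrow>
        dist ((\<lambda>(t, x). f t x) z') ((\<lambda>(t, x). f t x) z) < e"
    using assms(2) unfolding uniformly_continuous_on_def by metis
  have "\<forall>\<^sub>F h in at_right 0. h < min d 1"
    using d(1) eventually_at_right_real[of 0 "min d 1"] by (auto elim!: eventually_mono)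
  then show ?thesis
  proof eventually_elim
    case (elim h)
    show ?case
    proof (intro ballI)
      fix t x r assume *: "t \<in> {0..T}" "x \<in> {0..L}" "r \<in> {0..h}"
      have "dist (t + r, x) (t, x) < d"
        using elim * by (simp add: dist_Pair_Pair dist_real_def)
      from d(2)[OF _ _ this] show "\<bar>f (t + r) x - f t x\<bar> < e"
        using * elim by (auto simp: dist_real_def)
    qed
  qed
qed

lemma unif_quot:
  assumes f: "C1s L f ft fx" and e: "0 < e"
  shows "\<forall>\<^sub>F h in at_right 0. \<forall>t\<in>{0..T}. \<forall>x\<in>{0..L}. \<bar>(f (t + h) x - f t x) / h - ft t x\<bar> < e"
  using unif_shift[OF C1s_cont(2)[OF f] e, of T] eventually_at_right_less[of 0]
proof eventually_elim
  case (elim h)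
  show ?case
  proof (intro ballI)
    fix t x assume *: "t \<in> {0..T}" "x \<in> {0..L}"
    have "\<exists>z\<in>{t<..<t + h}. f (t + h) x - f t x = (\<lambda>y. ft z x * y) (t + h - t)"
    proof (rule mvt_simple)
      fix y assume "t \<le> y" "y \<le> t + h"
      then have "((\<lambda>s. f s x) has_real_derivative ft y x) (at y within {t..t + h})"
        by (intro DERIV_subset[OF C1s_D(1)[OF f]]) (use * in auto)
      then show "((\<lambda>s. f s x) has_derivative (*) (ft y x)) (at y within {t..t + h})"
        by (simp add: has_field_derivative_def)
    qed (use elim in simp)
    then obtain z where z: "t < z" "z < t + h" "f (t + h) x - f t x = ft z x * h" by auto
    have "\<bar>ft (t + (z - t)) x - ft t x\<bar> < e"
      using elim(1) * z by (intro elim(1)[rule_format]) auto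
    then show "\<bar>(f (t + h) x - f t x) / h - ft t x\<bar> < e"
      using z elim(2) by simp
  qed
qed

text \<open>By continuity the strict gap survives for some \<open>\<alpha>\<close> beyond
  \<open>\<sigma> / c\<close>; the surplus \<open>c * \<alpha> - \<sigma>\<close> pays for all small
  terms later. \<open>K\<close> is the ratio of the two weights: it must lie above
  \<open>exp (2 * \<alpha> * L) * \<bar>k1\<bar>\<close> and below \<open>1 / \<bar>k2\<bar>\<close>
  for both reflections to contract, and the gap says that this interval is nonempty.\<close>

lemma weights_exist:
  fixes c L \<sigma> k1 k2 :: real
  assumes c: "0 < c" and L: "0 < L" and s: "0 \<le> \<sigma>" and gap: "\<bar>k1 * k2\<bar> * exp (2 * \<sigma> * L / c) < 1"
  obtains \<alpha> K where "0 < \<alpha>" "\<sigma> < c * \<alpha>" "0 < K" "K * \<bar>k2\<bar> < 1" "exp (2 * \<alpha> * L) * \<bar>k1\<bar> < K"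
proof -
  have "((\<lambda>\<alpha>. \<bar>k1 * k2\<bar> * exp (2 * \<alpha> * L)) \<longlongrightarrow> \<bar>k1 * k2\<bar> * exp (2 * (\<sigma> / c) * L)) (at_right (\<sigma> / c))"
    by (intro tendsto_intros)
  then have "\<forall>\<^sub>F \<alpha> in at_right (\<sigma> / c). \<bar>k1 * k2\<bar> * exp (2 * \<alpha> * L) < 1"
    by (rule order_tendstoD) (use gap in simp)
  moreover have "\<forall>\<^sub>F \<alpha> in at_right (\<sigma> / c). \<sigma> / c < \<alpha>"
    by (rule eventually_at_right_less)
  ultimately have "\<forall>\<^sub>F \<alpha> in at_right (\<sigma> / c). \<bar>k1 * k2\<bar> * exp (2 * \<alpha> * L) < 1 \<and> \<sigma> / c < \<alpha>"
    by eventually_elim simp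
  from eventually_happens'[OF _ this] obtain \<alpha> where
    al: "\<bar>k1 * k2\<bar> * exp (2 * \<alpha> * L) < 1" "\<sigma> / c < \<alpha>" by auto
  have "0 \<le> \<sigma> / c" using s c by simp
  with al have a0: "0 < \<alpha>" by linarith
  have sc: "\<sigma> < c * \<alpha>" using al(2) c by (simp add: field_simps)
  define m where "m = exp (2 * \<alpha> * L) * \<bar>k1\<bar>"
  have m0: "0 \<le> m" by (simp add: m_def)
  have mk: "m * \<bar>k2\<bar> < 1" using al(1) by (simp add: m_def abs_mult mult_ac)
  show ?thesis
  proof (cases "k2 = 0")
    case True
    have "0 < m + 1" "m < m + 1" using m0 by auto
    with that[of \<alpha> "m + 1"] show ?thesis using True a0 sc unfolding m_def by simp
  next
    case False
    then have "m < 1 / \<bar>k2\<bar>" using mk by (simp add: field_simps)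
    then obtain K where K: "m < K" "K < 1 / \<bar>k2\<bar>" using dense by blast
    then have "K * \<bar>k2\<bar> < 1" using False by (simp add: field_simps)
    then show ?thesis using that[of \<alpha> K] a0 sc m0 K by (simp add: m_def)
  qed
qed

lemma abs_sum_7: "\<bar>a + b + c + d - e - f - g\<bar> \<le> \<bar>a\<bar> + \<bar>b\<bar> + \<bar>c\<bar> + \<bar>d\<bar> + \<bar>e\<bar> + \<bar>f\<bar> + \<bar>g\<bar>"
  for a b c d e f g :: real
  by linarith

text \<open>Pointwise arithmetic of the decoupling. A prime marks the other component, the suffix
  \<open>q\<close> a difference quotient in time, the suffix \<open>s\<close> a value at the shifted
  time. As \<open>lam'\<close> is nearly \<open>- lam\<close> and the equation expresses
  \<open>lam' * wx'\<close> by \<open>wt'\<close>, the term \<open>lam * wx'\<close> is nearly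
  \<open>wt'\<close>. Hence \<open>\<beta> / 4 * (wt' + lam * wx')\<close> matches the coupling
  \<open>\<beta> / 2 * wq'\<close> up to multiples of \<open>\<theta> * Z\<close> and
  \<open>e\<close>.\<close>

lemma transport_diff_bound:
  fixes \<beta> \<beta>t \<beta>x \<beta>q w w' ws ws' wt wt' wx wx' wxs wq wq' S S' Sq lam lam' lamq c \<theta> b0 e :: real
  assumes c: "0 < c" and th: "0 \<le> \<theta>" "\<theta> \<le> c / 2" "\<theta> \<le> 1" and e: "0 \<le> e" and b0: "\<bar>\<beta>\<bar> \<le> b0"
    and be: "\<bar>\<beta>t\<bar> \<le> 1" "\<bar>\<beta>x\<bar> \<le> 1" "\<bar>\<beta>q\<bar> \<le> 2"
    and w: "\<bar>w\<bar> \<le> e" "\<bar>w'\<bar> \<le> e" "\<bar>ws\<bar> \<le> e" "\<bar>ws'\<bar> \<le> e" "\<bar>S\<bar> \<le> e" "\<bar>S'\<bar> \<le> e"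
    and lam: "c / 2 \<le> \<bar>lam\<bar>" "c / 2 \<le> \<bar>lam'\<bar>" "\<bar>lam\<bar> \<le> 3 * c / 2" "\<bar>lam + lam'\<bar> \<le> 2 * \<theta>" "\<bar>lamq\<bar> \<le> 2 * \<theta>"
    and eq: "wt + lam * wx = \<beta> / 2 * (w + w') - S" "wt' + lam' * wx' = \<beta> / 2 * (w + w') - S'"
    and q: "\<bar>wq' - wt'\<bar> \<le> e" "\<bar>wxs - wx\<bar> \<le> e"
    and Z: "\<bar>wt\<bar> \<le> Z" "\<bar>wt'\<bar> \<le> Z" and Sq: "\<bar>Sq\<bar> \<le> 2 * e + \<theta> * Z"
  shows "\<bar>(\<beta> / 2 * (wq + wq') + \<beta>q / 2 * (ws + ws') - Sq - lamq * wxs)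
       - (\<beta>t + lam * \<beta>x) / 4 * w' - \<beta> / 4 * (wt' + lam * wx') - \<beta> / 2 * (wq - \<beta> / 4 * w')\<bar>
     \<le> \<theta> * (1 + 4 / c + b0 / c) * Z
       + (b0\<^sup>2 / 8 + b0 / 2 + 3 * b0 * (b0 + 1) / 4 + 6 + 2 * (b0 + 1) + 2 * c) * e"
proof -
  have b00: "0 \<le> b0" using b0 by simp
  have Z0: "0 \<le> Z" using Z by simp
  have lam'0: "lam' \<noteq> 0" using lam(2) c by auto
  define F where "F = \<beta> / 2 * (w + w') - S"
  define F' where "F' = \<beta> / 2 * (w + w') - S'"
  have ww: "\<bar>\<beta> / 2 * (w + w')\<bar> \<le> b0 * e"
  proof -
    have "\<bar>\<beta> / 2 * (w + w')\<bar> = \<bar>\<beta>\<bar> * (\<bar>w + w'\<bar> / 2)" by (simp add: abs_mult)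
    also have "\<dots> \<le> b0 * e" using b0 w by (intro mult_mono) auto
    finally show ?thesis .
  qed
  have F: "\<bar>F\<bar> \<le> (b0 + 1) * e" "\<bar>F'\<bar> \<le> (b0 + 1) * e"
    using ww w unfolding F_def F'_def distrib_right by linarith+
  have wx: "\<bar>wx\<bar> \<le> 2 / c * (Z + (b0 + 1) * e)"
  proof -
    have "lam * wx = F - wt" using eq(1) by (simp add: F_def)
    then have "\<bar>lam\<bar> * \<bar>wx\<bar> \<le> Z + (b0 + 1) * e"
      using F Z by (simp flip: abs_mult)
    moreover have "c / 2 * \<bar>wx\<bar> \<le> \<bar>lam\<bar> * \<bar>wx\<bar>" using lam by (intro mult_right_mono) auto
    ultimately show ?thesis using c by (simp add: field_simps)
  qed
  have t1: "\<bar>\<beta> * \<beta> / 8 * w'\<bar> \<le> b0\<^sup>2 / 8 * e"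
  proof -
    have "\<bar>\<beta> * \<beta> / 8 * w'\<bar> = \<bar>\<beta>\<bar> * \<bar>\<beta>\<bar> / 8 * \<bar>w'\<bar>" by (simp add: abs_mult)
    also have "\<dots> \<le> b0 * b0 / 8 * e" using b0 b00 w by (intro mult_mono divide_right_mono) auto
    finally show ?thesis by (simp add: power2_eq_square)
  qed
  have t2: "\<bar>\<beta> / 2 * (wq' - wt')\<bar> \<le> b0 / 2 * e"
  proof -
    have "\<bar>\<beta> / 2 * (wq' - wt')\<bar> = \<bar>\<beta>\<bar> / 2 * \<bar>wq' - wt'\<bar>" by (simp add: abs_mult)
    also have "\<dots> \<le> b0 / 2 * e" using b0 q by (intro mult_mono) auto
    finally show ?thesis .
  qed
  have t3: "\<bar>\<beta> / 4 * (wt' - lam * wx')\<bar> \<le> b0 / 4 * (4 * \<theta> / c * Z + 3 * ((b0 + 1) * e))"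
  proof -
    have wx': "wx' = (F' - wt') / lam'" using eq(2) lam'0 by (simp add: F'_def field_simps)
    have "wt' - lam * wx' = (lam + lam') / lam' * wt' - lam / lam' * F'"
      unfolding wx' using lam'0 by (simp add: field_simps)
    moreover have "\<bar>(lam + lam') / lam' * wt'\<bar> \<le> 4 * \<theta> / c * Z"
    proof -
      have "\<bar>(lam + lam') / lam'\<bar> \<le> 2 * \<theta> / (c / 2)"
        unfolding abs_divide using lam c th by (intro frac_le) auto
      then show ?thesis unfolding abs_mult using Z Z0 th c by (intro mult_mono) auto
    qed
    moreover have "\<bar>lam / lam' * F'\<bar> \<le> 3 * ((b0 + 1) * e)"
    proof -
      have "\<bar>lam / lam'\<bar> \<le> (3 * c / 2) / (c / 2)"
        unfolding abs_divide using lam c by (intro frac_le) auto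
      then have "\<bar>lam / lam'\<bar> \<le> 3" using c by simp
      then show ?thesis unfolding abs_mult[of "lam / lam'"] using F e b00 by (intro mult_mono) auto
    qed
    ultimately have *: "\<bar>wt' - lam * wx'\<bar> \<le> 4 * \<theta> / c * Z + 3 * ((b0 + 1) * e)" by linarith
    show ?thesis unfolding abs_mult using b0 * by (intro mult_mono) auto
  qed
  have t4: "\<bar>\<beta>q / 2 * (ws + ws')\<bar> \<le> 2 * e"
  proof -
    have "\<bar>ws + ws'\<bar> \<le> 2 * e" using w by linarith
    have "\<bar>\<beta>q / 2 * (ws + ws')\<bar> = \<bar>\<beta>q\<bar> / 2 * \<bar>ws + ws'\<bar>" by (simp add: abs_mult)
    also have "\<dots> \<le> 1 * (2 * e)"
      using be \<open>\<bar>ws + ws'\<bar> \<le> 2 * e\<close> by (intro mult_mono) auto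
    finally show ?thesis by simp
  qed
  have t5: "\<bar>lamq * wxs\<bar> \<le> 4 * \<theta> / c * Z + 2 * (b0 + 1) * e + c * e"
  proof -
    have "\<bar>lamq * wxs\<bar> = \<bar>lamq\<bar> * \<bar>wxs\<bar>" by (simp add: abs_mult)
    also have "\<dots> \<le> 2 * \<theta> * (2 / c * (Z + (b0 + 1) * e) + e)"
      using lam wx q th by (intro mult_mono) auto
    also have "\<dots> = 4 * \<theta> / c * Z + (2 * \<theta>) * (2 / c * ((b0 + 1) * e) + e)"
      by (simp add: algebra_simps)
    also have "(2 * \<theta>) * (2 / c * ((b0 + 1) * e) + e) \<le> c * (2 / c * ((b0 + 1) * e) + e)"
      using th c b00 e by (intro mult_right_mono) auto
    also have "c * (2 / c * ((b0 + 1) * e) + e) = 2 * (b0 + 1) * e + c * e"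
      using c by (simp add: field_simps)
    finally show ?thesis by simp
  qed
  have t6: "\<bar>(\<beta>t + lam * \<beta>x) / 4 * w'\<bar> \<le> (1 + c) * e"
  proof -
    have "\<bar>lam * \<beta>x\<bar> \<le> (3 * c / 2) * 1" unfolding abs_mult using lam be c by (intro mult_mono) auto
    then have "\<bar>\<beta>t + lam * \<beta>x\<bar> \<le> 1 + 3 * c / 2"
      using abs_triangle_ineq[of \<beta>t "lam * \<beta>x"] be(1) by linarith
    then have "\<bar>(\<beta>t + lam * \<beta>x) / 4\<bar> \<le> 1 + c" using c by simp
    then show ?thesis unfolding abs_mult using w c by (intro mult_mono) auto
  qed
  \<comment> \<open>\<open>wq\<close> itself drops out, and the coupling survives only in the small
    differences \<open>wq' - wt'\<close> and \<open>wt' - lam * wx'\<close>; each of the seven terms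
    already has its bound.\<close>
  have "(\<beta> / 2 * (wq + wq') + \<beta>q / 2 * (ws + ws') - Sq - lamq * wxs)
       - (\<beta>t + lam * \<beta>x) / 4 * w' - \<beta> / 4 * (wt' + lam * wx') - \<beta> / 2 * (wq - \<beta> / 4 * w')
     = \<beta> * \<beta> / 8 * w' + \<beta> / 2 * (wq' - wt') + \<beta> / 4 * (wt' - lam * wx') + \<beta>q / 2 * (ws + ws')
       - Sq - lamq * wxs - (\<beta>t + lam * \<beta>x) / 4 * w'"
    by (simp add: field_simps)
  then have "\<bar>(\<beta> / 2 * (wq + wq') + \<beta>q / 2 * (ws + ws') - Sq - lamq * wxs)
       - (\<beta>t + lam * \<beta>x) / 4 * w' - \<beta> / 4 * (wt' + lam * wx') - \<beta> / 2 * (wq - \<beta> / 4 * w')\<bar>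
     \<le> b0\<^sup>2 / 8 * e + b0 / 2 * e + b0 / 4 * (4 * \<theta> / c * Z + 3 * ((b0 + 1) * e)) + 2 * e
       + (2 * e + \<theta> * Z) + (4 * \<theta> / c * Z + 2 * (b0 + 1) * e + c * e) + (1 + c) * e"
    by (simp only:) (rule order_trans[OF abs_sum_7], intro add_mono t1 t2 t3 t4 Sq t5 t6)
  also have "\<dots> \<le> \<theta> * (1 + 4 / c + b0 / c) * Z
       + (b0\<^sup>2 / 8 + b0 / 2 + 3 * b0 * (b0 + 1) / 4 + 6 + 2 * (b0 + 1) + 2 * c) * e"
    using e by (simp add: field_simps)
  finally show ?thesis .
qed

section \<open>Decay of the time derivative\<close>

lemma sum_2: "f 1 + f 2 = f i + f (oth i)" for f :: "2 \<Rightarrow> real"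
  using exhaust_2[of i] by auto

text \<open>\<^term>\<open>w\<close> is the perturbation, \<^term>\<open>S\<close> a source that need only be Lipschitz in time; no second
  derivatives occur. For small \<open>\<theta>\<close> the conclusion of \<open>transport_pair_dt_bound\<close> is uniform in the
  damping coefficient, and \<open>J\<close> enters it only linearly.\<close>

locale transport_pair =
  fixes L c b0 \<sigma> :: real and kap :: "2 \<Rightarrow> real" and \<theta> T J :: real
    and \<beta> \<beta>t \<beta>x :: "real \<Rightarrow> real \<Rightarrow> real" and lam lamt lamx w wt wx S :: "2 \<Rightarrow> real \<Rightarrow> real \<Rightarrow> real"
  assumes J: "0 < J" and be: "C1s L \<beta> \<beta>t \<beta>x" and lam: "\<And>i. C1s L (lam i) (lamt i) (lamx i)"
    and w: "\<And>i. C1s L (w i) (wt i) (wx i)"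
    and beb: "\<And>t x. 0 \<le> t \<Longrightarrow> x \<in> {0..L} \<Longrightarrow> -b0 \<le> \<beta> t x \<and> \<beta> t x \<le> 0 \<and> \<bar>\<beta>t t x\<bar> \<le> 1 \<and> \<bar>\<beta>x t x\<bar> \<le> 1"
    and lamb: "\<And>i t x. 0 \<le> t \<Longrightarrow> x \<in> {0..L} \<Longrightarrow> \<bar>lam i t x - sg i * c\<bar> \<le> \<theta>"
    and lamtb: "\<And>i t x. 0 \<le> t \<Longrightarrow> t \<le> T \<Longrightarrow> x \<in> {0..L} \<Longrightarrow> \<bar>lamt i t x\<bar> \<le> \<theta>"
    and pde: "\<And>i t x. 0 \<le> t \<Longrightarrow> x \<in> {0..L} \<Longrightarrow>
        wt i t x + lam i t x * wx i t x = \<beta> t x / 2 * (w 1 t x + w 2 t x) - S i t x"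
    and wb: "\<And>i t x. 0 \<le> t \<Longrightarrow> x \<in> {0..L} \<Longrightarrow> \<bar>w i t x\<bar> \<le> J * exp (- \<sigma> * t)"
    and Sb: "\<And>i t x. 0 \<le> t \<Longrightarrow> x \<in> {0..L} \<Longrightarrow> \<bar>S i t x\<bar> \<le> J * exp (- \<sigma> * t)"
    and Sq: "\<And>i e. 0 < e \<Longrightarrow> \<forall>\<^sub>F h in at_right 0. \<forall>t\<in>{0..T}. \<forall>x\<in>{0..L}.
        \<bar>(S i (t + h) x - S i t x) / h\<bar> \<le> J * exp (- \<sigma> * t) + \<theta> * (\<bar>wt 1 t x\<bar> + \<bar>wt 2 t x\<bar>) + e"
    and bd: "\<And>i t. 0 \<le> t \<Longrightarrow> t \<le> T \<Longrightarrow>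
        \<bar>wt i t (inflow L i) - kap i * wt (oth i) t (inflow L i)\<bar> \<le> J * exp (- \<sigma> * t)"
    and init: "\<And>i x. x \<in> {0..L} \<Longrightarrow> \<bar>wt i 0 x\<bar> \<le> J"

lemma transport_pair_dt_bound:
  fixes c L b0 \<sigma> :: real and kap :: "2 \<Rightarrow> real"
  assumes c: "0 < c" and L: "0 < L" and b0: "0 \<le> b0" and s0: "0 \<le> \<sigma>"
    and kap: "\<And>i. \<bar>kap i\<bar> \<le> 1"
    and gap: "\<bar>kap 1 * kap 2\<bar> * exp (2 * \<sigma> * L / c) < 1"
  obtains \<theta> C :: real where "0 < \<theta>" "0 < C"
    "\<And>T J \<beta> \<beta>t \<beta>x lam lamt lamx w wt wx S i t x.
      \<lbrakk>transport_pair L c b0 \<sigma> kap \<theta> T J \<beta> \<beta>t \<beta>x lam lamt lamx w wt wx S; 0 \<le> t; t \<le> T; x \<in> {0..L}\<rbrakk>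
      \<Longrightarrow> \<bar>wt i t x\<bar> \<le> C * J * exp (- \<sigma> * t)"
proof -
  obtain \<alpha> K where al: "0 < \<alpha>" "\<sigma> < c * \<alpha>" and K: "0 < K" "K * \<bar>kap 2\<bar> < 1" "exp (2 * \<alpha> * L) * \<bar>kap 1\<bar> < K"
    using weights_exist[OF c L s0 gap] by blast
  define a where "a = (\<lambda>i::2. if i = 1 then 1 else K)"
  have a: "0 < a i" for i using K by (simp add: a_def)
  \<comment> \<open>The contraction factor of the weighted reflection at the worse of the two
    ends.\<close>
  define q where "q = max (exp (2 * \<alpha> * L) * \<bar>kap 1\<bar> / K) (K * \<bar>kap 2\<bar>)"
  have "0 \<le> K * \<bar>kap 2\<bar>" using K(1) by simp
  then have q: "0 \<le> q" "q < 1" unfolding q_def le_max_iff_disj using K by auto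
  have A1: "wgt \<alpha> a 1 x = exp (\<alpha> * x)" and A2: "wgt \<alpha> a 2 x = K * exp (- \<alpha> * x)" for x
    by (simp_all add: wgt_def a_def)
  have two: "2 * \<alpha> * L = \<alpha> * L + \<alpha> * L" by simp
  have qA: "wgt \<alpha> a i (inflow L i) * \<bar>kap i\<bar> \<le> q * wgt \<alpha> a (oth i) (inflow L i)" for i
  proof (cases "i = 1")
    case True
    have "exp (2 * \<alpha> * L) * \<bar>kap 1\<bar> \<le> q * K" using K(1) by (simp add: q_def field_simps max_def)
    then have "exp (\<alpha> * L) * \<bar>kap 1\<bar> \<le> q * (K * exp (- \<alpha> * L))"
      unfolding two exp_add by (simp add: exp_minus field_simps)
    then show ?thesis using True by (simp add: A1 A2)
  next
    case False
    then have "i = 2" using exhaust_2[of i] by simp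
    then show ?thesis by (simp add: A1 A2 q_def)
  qed
  define R where "R = max (exp (2 * \<alpha> * L) / K) K"
  have R: "wgt \<alpha> a i x \<le> R * wgt \<alpha> a (oth i) x" if x: "x \<in> {0..L}" for i x
  proof (cases "i = 1")
    case True
    have "exp (\<alpha> * x) * exp (\<alpha> * x) \<le> exp (2 * \<alpha> * L)"
      using x al by (auto simp: two simp flip: exp_add intro!: add_mono)
    also have "\<dots> \<le> R * K" using K(1) by (simp add: R_def field_simps max_def)
    finally have "exp (\<alpha> * x) \<le> R * (K * exp (- \<alpha> * x))"
      by (simp add: exp_minus field_simps)
    then show ?thesis using True by (simp add: A1 A2)
  next
    case False
    then have i: "i = 2" using exhaust_2[of i] by simp
    have "exp (- \<alpha> * x) \<le> exp (\<alpha> * x)" using x al by simp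
    then have "K * exp (- \<alpha> * x) \<le> R * exp (\<alpha> * x)"
      using K(1) by (intro mult_mono) (auto simp: R_def)
    then show ?thesis using i by (simp add: A1 A2)
  qed
  define M where "M = max (exp (\<alpha> * L)) K"
  have M: "wgt \<alpha> a i x \<le> M" if x: "x \<in> {0..L}" for i x
  proof (cases "i = 1")
    case True
    have "exp (\<alpha> * x) \<le> exp (\<alpha> * L)" using x al by simp
    then show ?thesis using True by (simp add: A1 M_def le_max_iff_disj)
  next
    case False
    then have i: "i = 2" using exhaust_2[of i] by simp
    have "K * exp (- \<alpha> * x) \<le> K" using x al K by simp
    then show ?thesis using i by (simp add: A2 M_def le_max_iff_disj)
  qed
  have M0: "0 < M" using K by (simp add: M_def)
  define m where "m = min 1 (K * exp (- \<alpha> * L))"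
  have m: "m \<le> wgt \<alpha> a i x" if x: "x \<in> {0..L}" for i x
  proof (cases "i = 1")
    case True
    have "1 \<le> exp (\<alpha> * x)" using x al by simp
    then show ?thesis using True by (simp add: A1 m_def min_le_iff_disj)
  next
    case False
    then have i: "i = 2" using exhaust_2[of i] by simp
    have "K * exp (- \<alpha> * L) \<le> K * exp (- \<alpha> * x)" using x al K by simp
    then show ?thesis using i by (simp add: A2 m_def min_le_iff_disj)
  qed
  have m0: "0 < m" using K by (simp add: m_def)
  have R0: "0 \<le> R" using K by (simp add: R_def)
  define H where "H = 1 + 4 / c + b0 / c"
  have H0: "0 < H" using c b0 by (simp add: H_def add_pos_nonneg)
  \<comment> \<open>The surplus is split in three: one share each for the defect of the speeds
    (\<open>th1\<close>), for the remaining coupling (\<open>th2\<close>) and for the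
    forcing.\<close>
  define \<mu> where "\<mu> = (c * \<alpha> - \<sigma>) / 3"
  have mu3: "\<mu> + \<mu> + \<mu> = c * \<alpha> - \<sigma>" by (simp add: \<mu>_def field_simps)
  have mu: "0 < \<mu>" using al by (simp add: \<mu>_def)
  define D where "D = b0\<^sup>2 / 8 + b0 / 2 + 3 * b0 * (b0 + 1) / 4 + 6 + 2 * (b0 + 1) + 2 * c"
  have D0: "0 < D" unfolding D_def using b0 c by (intro add_nonneg_pos add_pos_pos add_nonneg_nonneg) auto
  \<comment> \<open>\<open>D\<close> is the error constant of \<open>transport_diff_bound\<close>,
    the multiple of \<open>H\<close> arises when \<open>wt\<close> is replaced by \<open>V\<close>,
    and \<open>CC1\<close> lets \<open>CC\<close> cover the boundary and initial errors as
    well.\<close>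
  define CC where "CC = D + H * (b0 / 2 + 2) + 5 + b0"
  have CC0: "0 < CC" unfolding CC_def using b0 D0 H0 by (simp add: add_pos_pos add_pos_nonneg)
  have "0 \<le> H * (b0 / 2 + 2)" using H0 b0 by simp
  then have CC1: "b0 / 2 + 3 \<le> CC" unfolding CC_def using D0 b0 by linarith
  define \<theta> where "\<theta> = min (min (c / 2) 1) (min (\<mu> / \<alpha>) (\<mu> / (H * (1 + R))))"
  have th: "0 < \<theta>" "\<theta> \<le> c / 2" "\<theta> \<le> 1" using mu al c H0 R0 unfolding \<theta>_def
    by (simp, intro min.coboundedI1 min.cobounded1, intro min.coboundedI1 min.cobounded2)
  have th1: "\<theta> * \<alpha> \<le> \<mu>"
  proof -
    have "\<theta> \<le> \<mu> / \<alpha>" by (simp add: \<theta>_def)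
    then show ?thesis using al by (simp add: field_simps)
  qed
  have th2: "\<theta> * H * (1 + R) \<le> \<mu>"
  proof -
    have "\<theta> \<le> \<mu> / (H * (1 + R))" by (simp add: \<theta>_def)
    moreover have "0 < H * (1 + R)" using H0 R0 by simp
    ultimately have "\<theta> * (H * (1 + R)) \<le> \<mu>" by (simp only: pos_le_divide_eq)
    then show ?thesis by (simp add: mult.assoc)
  qed
  \<comment> \<open>Large enough to beat, in this order, the inflow condition, the interior forcing
    and the initial values.\<close>
  define N0 where "N0 = max (M * CC / (1 - q)) (M * CC / \<mu>) + M * CC"
  have MC: "0 < M * CC" using M0 CC0 by simp
  have N0: "M * CC < N0 * (1 - q)" "M * CC < \<mu> * N0" "M * CC \<le> N0"
  proof -
    have "M * CC / (1 - q) < N0" "M * CC / \<mu> < N0" using MC by (auto simp: N0_def)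
    then show "M * CC < N0 * (1 - q)" "M * CC < \<mu> * N0" using q mu by (simp_all add: field_simps)
    have "0 \<le> M * CC / \<mu>" using MC mu by simp
    then show "M * CC \<le> N0" unfolding N0_def by linarith
  qed
  define C where "C = N0 / m + b0 / 4 + 1"
  have N00: "0 < N0" using N0(3) MC by linarith
  have C0: "0 < C" unfolding C_def using N00 m0 b0 by (simp add: add_pos_nonneg)
  show thesis
  proof (rule that[OF th(1) C0])
    fix T J \<beta> \<beta>t \<beta>x lam lamt lamx w wt wx S i t x
    assume tp: "transport_pair L c b0 \<sigma> kap \<theta> T J \<beta> \<beta>t \<beta>x lam lamt lamx w wt wx S"
      and t: "0 \<le> t" and tT: "t \<le> T" and x: "x \<in> {0..L}"
    interpret transport_pair L c b0 \<sigma> kap \<theta> T J \<beta> \<beta>t \<beta>x lam lamt lamx w wt wx S by (rule tp)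
    \<comment> \<open>The smallest value of the forcing bound on \<open>{0..T}\<close>: an
      approximation error below \<open>e\<close> is absorbed by the forcing at every time of the
      interval. The step \<open>h\<close> chosen for it depends on \<open>T\<close> and the
      solution, but \<open>C\<close> does not.\<close>
    define e where "e = J * exp (- \<sigma> * T)"
    have e0: "0 < e" using J by (simp add: e_def)
    have eE: "e \<le> J * exp (- \<sigma> * s)" if "s \<le> T" for s
      unfolding e_def using that s0 J by (simp add: mult_left_mono)
    define P where "P = (\<lambda>h. 0 < h \<and>
      (\<forall>i. \<forall>t\<in>{0..T}. \<forall>x\<in>{0..L}. \<bar>(w i (t + h) x - w i t x) / h - wt i t x\<bar> < e) \<and>
      (\<forall>t\<in>{0..T}. \<forall>x\<in>{0..L}. \<bar>(\<beta> (t + h) x - \<beta> t x) / h - \<beta>t t x\<bar> < 1) \<and>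
      (\<forall>i. \<forall>t\<in>{0..T}. \<forall>x\<in>{0..L}. \<bar>(lam i (t + h) x - lam i t x) / h - lamt i t x\<bar> < \<theta>) \<and>
      (\<forall>i. \<forall>t\<in>{0..T}. \<forall>x\<in>{0..L}. \<forall>r\<in>{0..h}. \<bar>wx i (t + r) x - wx i t x\<bar> < e) \<and>
      (\<forall>i. \<forall>t\<in>{0..T}. \<forall>x\<in>{0..L}. \<bar>(S i (t + h) x - S i t x) / h\<bar>
          \<le> J * exp (- \<sigma> * t) + \<theta> * (\<bar>wt 1 t x\<bar> + \<bar>wt 2 t x\<bar>) + e))"
    have "\<forall>\<^sub>F h in at_right 0. P h"
      unfolding P_def
      by (intro eventually_conj eventually_all_finite eventually_at_right_less
          unif_quot[OF w e0] unif_quot[OF be] unif_quot[OF lam th(1)] unif_shift[OF C1s_cont(3)[OF w] e0] Sq[OF e0]) auto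
    from eventually_happens'[OF _ this] obtain h where P: "P h" by auto
    then have h: "0 < h" by (simp add: P_def)
    have P1: "\<bar>(w i (t + h) x - w i t x) / h - wt i t x\<bar> \<le> e" 
      and P2: "\<bar>(\<beta> (t + h) x - \<beta> t x) / h - \<beta>t t x\<bar> \<le> 1"
      and P3: "\<bar>(lam i (t + h) x - lam i t x) / h - lamt i t x\<bar> \<le> \<theta>"
      and P4: "\<bar>wx i (t + h) x - wx i t x\<bar> \<le> e"
      and P5: "\<bar>(S i (t + h) x - S i t x) / h\<bar>
          \<le> J * exp (- \<sigma> * t) + \<theta> * (\<bar>wt 1 t x\<bar> + \<bar>wt 2 t x\<bar>) + e"
      if "0 \<le> t" "t \<le> T" "x \<in> {0..L}" for i t x
      using P that unfolding P_def by (auto intro: less_imp_le)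
    define wq where "wq = (\<lambda>i t x. (1 / h) * (w i (t + h) x - w i t x))"
    \<comment> \<open>Along the \<open>i\<close>-th characteristics the other difference quotient is, up to terms of order
      \<open>\<theta>\<close>, one half of the derivative of the other component, because the two speeds are nearly
      opposite. Subtracting a quarter of \<open>\<beta>\<close> times that component therefore decouples the pair.\<close>
    define V where "V = (\<lambda>i t x. wq i t x - 1 / 4 * (\<beta> t x * w (oth i) t x))"
    define Vt where "Vt = (\<lambda>i t x. (1 / h) * (wt i (t + h) x - wt i t x)
       - 1 / 4 * (\<beta>t t x * w (oth i) t x + \<beta> t x * wt (oth i) t x))"
    define Vx where "Vx = (\<lambda>i t x. (1 / h) * (wx i (t + h) x - wx i t x)
       - 1 / 4 * (\<beta>x t x * w (oth i) t x + \<beta> t x * wx (oth i) t x))"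
    have h': "0 \<le> h" using h by simp
    have V: "C1s L (V i) (Vt i) (Vx i)" for i
      unfolding V_def Vt_def Vx_def wq_def
      by (intro C1s_diff C1s_cmult C1s_mult C1s_shift w be h')
    define E where "E = (\<lambda>t. J * exp (- \<sigma> * t))"
    have E0: "0 < E t" for t using J by (simp add: E_def)
    have bw: "\<bar>1 / 4 * (\<beta> t x * w i t x)\<bar> \<le> b0 / 4 * E t" if "0 \<le> t" "x \<in> {0..L}" for i t x
    proof -
      have "\<bar>\<beta> t x * w i t x\<bar> \<le> b0 * E t"
        unfolding abs_mult using beb[OF that] wb[OF that, of i] b0 by (intro mult_mono) (auto simp: E_def)
      then show ?thesis by (simp add: abs_mult)
    qed
    have wqb: "\<bar>wq i t x - wt i t x\<bar> \<le> E t" if "0 \<le> t" "t \<le> T" "x \<in> {0..L}" for i t x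
      using P1[OF that, of i] eE[OF that(2)] by (simp add: wq_def E_def)
    have wtV: "\<bar>wt i t x\<bar> \<le> \<bar>V i t x\<bar> + (b0 / 4 + 1) * E t" if "0 \<le> t" "t \<le> T" "x \<in> {0..L}" for i t x
    proof -
      have "wt i t x = V i t x - (wq i t x - wt i t x) + 1 / 4 * (\<beta> t x * w (oth i) t x)"
        by (simp add: V_def)
      then show ?thesis using wqb[OF that, of i] bw[OF that(1,3), of "oth i"]
        unfolding distrib_right by linarith
    qed
    have Vwt: "\<bar>V i t x\<bar> \<le> \<bar>wt i t x\<bar> + (b0 / 4 + 1) * E t" if "0 \<le> t" "t \<le> T" "x \<in> {0..L}" for i t x
    proof -
      have "V i t x = wt i t x + (wq i t x - wt i t x) - 1 / 4 * (\<beta> t x * w (oth i) t x)"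
        by (simp add: V_def)
      then show ?thesis using wqb[OF that, of i] bw[OF that(1,3), of "oth i"]
        unfolding distrib_right by linarith
    qed
    have T0: "0 \<le> T" using t tT by simp
    have lamc: "c - \<theta> \<le> sg i * lam i t x" "c / 2 \<le> \<bar>lam i t x\<bar>" "\<bar>lam i t x\<bar> \<le> 3 * c / 2"
      "\<bar>lam i t x + lam (oth i) t x\<bar> \<le> 2 * \<theta>"
      if "0 \<le> t" "x \<in> {0..L}" for i t x
      using lamb[OF that, of 1] lamb[OF that, of 2] th exhaust_2[of i] by auto
    have inw: "inflow L i \<in> {0..L}" for i using L by (intro inflow_mem) simp
    have "\<bar>V i t x\<bar> * (exp (\<sigma> * t) * wgt \<alpha> a i x) < J * N0"
    proof (rule max_principle[where V=V and Vt=Vt and Vx=Vx and lam=lam and \<beta>=\<beta> and k="\<lambda>i. \<bar>kap i\<bar>"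
          and J="J * CC" and q=q and Amax=M and \<mu>=\<mu> and R=R and c'="c - \<theta>" and \<theta>="\<theta> * H",
          OF L a V _ _ qA q(1) M _ _ _ R _ _ _ _ _ _ _ t tT x])
      fix i x assume x: "x \<in> {0..L}"
      have "\<bar>V i 0 x\<bar> \<le> J + (b0 / 4 + 1) * J"
        using Vwt[of 0 x i] init[OF x, of i] x T0 by (simp add: E_def)
      also have "\<dots> = (2 + b0 / 4) * J" by (simp add: algebra_simps)
      also have "(2 + b0 / 4) * J < CC * J" using CC1 b0 J by (intro mult_strict_right_mono) linarith+
      finally have "\<bar>V i 0 x\<bar> < CC * J" .
      then have "\<bar>V i 0 x\<bar> * wgt \<alpha> a i x < (CC * J) * wgt \<alpha> a i x" using wgt_pos[OF a] by simp
      also have "\<dots> \<le> (CC * J) * M" using M[OF x] CC0 J by simp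
      also have "\<dots> = J * (M * CC)" by simp
      also have "\<dots> \<le> J * N0" using N0(3) J by simp
      finally show "\<bar>V i 0 x\<bar> * wgt \<alpha> a i x < J * N0" .
    next
      fix i t assume t: "0 < t" "t \<le> T"
      define y where "y = inflow L i"
      have y: "y \<in> {0..L}" using inw by (simp add: y_def)
      have t': "0 \<le> t" using t by simp
      have "\<bar>V i t y\<bar> \<le> \<bar>wt i t y\<bar> + (b0 / 4 + 1) * E t" using Vwt[OF t' t(2) y] .
      also have "\<bar>wt i t y\<bar> \<le> \<bar>kap i\<bar> * \<bar>wt (oth i) t y\<bar> + E t"
        using bd[OF t' t(2), of i] unfolding y_def E_def by (simp flip: abs_mult)
      also have "\<bar>kap i\<bar> * \<bar>wt (oth i) t y\<bar> \<le> \<bar>kap i\<bar> * \<bar>V (oth i) t y\<bar> + \<bar>kap i\<bar> * ((b0 / 4 + 1) * E t)"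
        unfolding distrib_left[symmetric] using wtV[OF t' t(2) y, of "oth i"] by (intro mult_left_mono) auto
      also have "\<bar>kap i\<bar> * ((b0 / 4 + 1) * E t) \<le> 1 * ((b0 / 4 + 1) * E t)"
        using kap[of i] b0 E0[of t] by (intro mult_right_mono) auto
      finally have "\<bar>V i t y\<bar> \<le> \<bar>kap i\<bar> * \<bar>V (oth i) t y\<bar> + (b0 / 2 + 3) * E t"
        by (simp add: algebra_simps)
      also have "(b0 / 2 + 3) * E t \<le> CC * E t"
        using E0[of t] CC1 by (intro mult_right_mono) auto
      finally show "\<bar>V i t (inflow L i)\<bar>
          \<le> \<bar>kap i\<bar> * \<bar>V (oth i) t (inflow L i)\<bar> + J * CC * exp (- \<sigma> * t)"
        by (simp add: y_def E_def mult_ac)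
    next
      show "0 \<le> J * CC" using J CC0 by simp
      show "M * (J * CC) < J * N0 * (1 - q)" using N0(1) J by (simp add: mult_ac)
      show "M * (J * CC) < \<mu> * (J * N0)" using N0(2) J by (simp add: mult_ac)
      show "0 \<le> c - \<theta>" using th c by simp
      show "0 \<le> \<alpha>" using al by simp
      show "0 \<le> \<theta> * H" using th H0 by simp
      show "\<sigma> + \<theta> * H * (1 + R) + \<mu> \<le> (c - \<theta>) * \<alpha>"
        using th1 th2 mu3 unfolding left_diff_distrib by linarith
    next
      fix i t x assume t: "0 < t" "t \<le> T" and x: "x \<in> {0..L}"
      then show "c - \<theta> \<le> sg i * lam i t x" using lamc(1)[of t x i] by simp
      have t': "0 \<le> t" "0 \<le> t + h" using t h by auto
      show "\<bar>Vt i t x + lam i t x * Vx i t x - \<beta> t x / 2 * V i t x\<bar>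
         \<le> \<theta> * H * (\<bar>V i t x\<bar> + \<bar>V (oth i) t x\<bar>) + J * CC * exp (- \<sigma> * t)"
      proof -
        define \<beta>q where "\<beta>q = (\<beta> (t + h) x - \<beta> t x) / h"
        define lamq where "lamq = (lam i (t + h) x - lam i t x) / h"
        define Sq where "Sq = (S i (t + h) x - S i t x) / h"
        have ss: "w 1 s y + w 2 s y = w i s y + w (oth i) s y" for s y
          using sum_2[of "\<lambda>i. w i s y"] .
        have Es: "E (t + h) \<le> E t" using h s0 J by (simp add: E_def mult_left_mono)
        have p1: "wt i (t + h) x + lam i (t + h) x * wx i (t + h) x
            = \<beta> (t + h) x / 2 * (w i (t + h) x + w (oth i) (t + h) x) - S i (t + h) x"
          and p2: "wt i t x + lam i t x * wx i t x = \<beta> t x / 2 * (w i t x + w (oth i) t x) - S i t x"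
          and p3: "wt (oth i) t x + lam (oth i) t x * wx (oth i) t x
            = \<beta> t x / 2 * (w i t x + w (oth i) t x) - S (oth i) t x"
          using pde[OF t'(2) x, of i] pde[OF t'(1) x] unfolding ss by auto
        \<comment> \<open>Discrete product rule: the equations at times \<open>t + h\<close> and
          \<open>t\<close> are subtracted, and the increment of the speed meets \<open>wx\<close> at
          the shifted time, so no second derivative appears.\<close>
        have "h * (Vt i t x + lam i t x * Vx i t x) =
           (wt i (t + h) x + lam i (t + h) x * wx i (t + h) x) - (wt i t x + lam i t x * wx i t x)
           - (lam i (t + h) x - lam i t x) * wx i (t + h) x
           - h * ((\<beta>t t x + lam i t x * \<beta>x t x) / 4 * w (oth i) t x
              + \<beta> t x / 4 * (wt (oth i) t x + lam i t x * wx (oth i) t x))"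
          using h unfolding Vt_def Vx_def by (simp add: field_simps)
        also have "\<dots> = h * ((\<beta> t x / 2 * (wq i t x + wq (oth i) t x)
             + \<beta>q / 2 * (w i (t + h) x + w (oth i) (t + h) x) - Sq - lamq * wx i (t + h) x)
           - (\<beta>t t x + lam i t x * \<beta>x t x) / 4 * w (oth i) t x
           - \<beta> t x / 4 * (wt (oth i) t x + lam i t x * wx (oth i) t x))"
          unfolding p1 p2 wq_def \<beta>q_def Sq_def lamq_def using h by (simp add: field_simps)
        finally have eq: "Vt i t x + lam i t x * Vx i t x = (\<beta> t x / 2 * (wq i t x + wq (oth i) t x)
             + \<beta>q / 2 * (w i (t + h) x + w (oth i) (t + h) x) - Sq - lamq * wx i (t + h) x)
           - (\<beta>t t x + lam i t x * \<beta>x t x) / 4 * w (oth i) t x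
           - \<beta> t x / 4 * (wt (oth i) t x + lam i t x * wx (oth i) t x)"
          using h by simp
        have Veq: "V i t x = wq i t x - \<beta> t x / 4 * w (oth i) t x" by (simp add: V_def)
        define Z where "Z = \<bar>wt 1 t x\<bar> + \<bar>wt 2 t x\<bar>"
        have Z: "Z = \<bar>wt i t x\<bar> + \<bar>wt (oth i) t x\<bar>" unfolding Z_def by (rule sum_2)
        have bq: "\<bar>\<beta>q\<bar> \<le> 2" using P2[OF t'(1) t(2) x] beb[OF t'(1) x] unfolding \<beta>q_def by linarith
        have lq: "\<bar>lamq\<bar> \<le> 2 * \<theta>" using P3[OF t'(1) t(2) x, of i] lamtb[OF t'(1) t(2) x, of i] unfolding lamq_def by linarith
        have bb: "\<bar>\<beta> t x\<bar> \<le> b0" using beb[OF t'(1) x] by simp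
        have ws: "\<bar>w k (t + h) x\<bar> \<le> E t" for k using wb[OF t'(2) x, of k] Es by (simp add: E_def)
        have wb': "\<bar>w k t x\<bar> \<le> E t" "\<bar>S k t x\<bar> \<le> E t" for k
          using wb[OF t'(1) x, of k] Sb[OF t'(1) x, of k] by (simp_all add: E_def)
        have wxs: "\<bar>wx i (t + h) x - wx i t x\<bar> \<le> E t"
          using P4[OF t'(1) t(2) x, of i] eE[OF t(2)] by (simp add: E_def)
        have Sqb: "\<bar>Sq\<bar> \<le> 2 * E t + \<theta> * Z"
          using P5[OF t'(1) t(2) x, of i] eE[OF t(2)] by (simp add: E_def Sq_def Z_def)
        note lc = lamc[OF t'(1) x, of i]
        have b1: "\<bar>\<beta>t t x\<bar> \<le> 1" and b2: "\<bar>\<beta>x t x\<bar> \<le> 1" using beb[OF t'(1) x] by auto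
        have Z1: "\<bar>wt i t x\<bar> \<le> Z" and Z2: "\<bar>wt (oth i) t x\<bar> \<le> Z" unfolding Z by auto
        have "\<bar>Vt i t x + lam i t x * Vx i t x - \<beta> t x / 2 * V i t x\<bar>
            \<le> \<theta> * (1 + 4 / c + b0 / c) * Z
              + (b0\<^sup>2 / 8 + b0 / 2 + 3 * b0 * (b0 + 1) / 4 + 6 + 2 * (b0 + 1) + 2 * c) * E t"
          unfolding eq Veq
          by (rule transport_diff_bound[OF c less_imp_le[OF th(1)] th(2,3) less_imp_le[OF E0] bb b1 b2 bq
                wb'(1) wb'(1) ws ws wb'(2) wb'(2) lc(2) lamc(2)[OF t'(1) x] lc(3,4) lq p2 p3
                wqb[OF t'(1) t(2) x] wxs Z1 Z2 Sqb])
        also have "\<dots> = \<theta> * H * Z + D * E t" by (simp add: H_def D_def)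
        \<comment> \<open>\<open>Z\<close> is measured in \<open>wt\<close>, the maximum principle
          in \<open>V\<close>; the exchange costs a multiple of \<open>E t\<close>.\<close>
        also have "\<theta> * H * Z \<le> \<theta> * H * (\<bar>V i t x\<bar> + \<bar>V (oth i) t x\<bar> + (b0 / 2 + 2) * E t)"
          using wtV[OF t'(1) t(2) x, of i] wtV[OF t'(1) t(2) x, of "oth i"] th H0
          by (intro mult_left_mono) (auto simp: Z algebra_simps)
        also have "\<dots> = \<theta> * H * (\<bar>V i t x\<bar> + \<bar>V (oth i) t x\<bar>) + \<theta> * (H * (b0 / 2 + 2) * E t)"
          by (simp add: algebra_simps)
        also have "\<theta> * (H * (b0 / 2 + 2) * E t) \<le> 1 * (H * (b0 / 2 + 2) * E t)"
          using th H0 b0 E0[of t] by (intro mult_right_mono) auto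
        finally have "\<bar>Vt i t x + lam i t x * Vx i t x - \<beta> t x / 2 * V i t x\<bar>
            \<le> \<theta> * H * (\<bar>V i t x\<bar> + \<bar>V (oth i) t x\<bar>) + (D + H * (b0 / 2 + 2)) * E t"
          by (simp add: algebra_simps)
        also have "(D + H * (b0 / 2 + 2)) * E t \<le> CC * E t"
          using E0[of t] b0 by (intro mult_right_mono) (auto simp: CC_def)
        finally show ?thesis by (simp add: E_def mult_ac)
      qed
    next
      fix t x :: real assume "0 < t" "t \<le> T" "x \<in> {0..L}"
      then show "\<beta> t x \<le> 0" using beb[of t x] by simp
    qed
    moreover have "\<bar>V i t x\<bar> * (exp (\<sigma> * t) * m) \<le> \<bar>V i t x\<bar> * (exp (\<sigma> * t) * wgt \<alpha> a i x)"
      using m[OF x] by (intro mult_left_mono) auto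
    ultimately have "\<bar>V i t x\<bar> * (exp (\<sigma> * t) * m) \<le> J * N0" by linarith
    then have "\<bar>V i t x\<bar> \<le> N0 / m * E t"
      using m0 by (simp add: E_def exp_minus field_simps)
    then have "\<bar>wt i t x\<bar> \<le> (N0 / m + (b0 / 4 + 1)) * E t"
      using wtV[OF t tT x, of i] unfolding distrib_right by linarith
    then show "\<bar>wt i t x\<bar> \<le> C * J * exp (- \<sigma> * t)"
      by (simp add: C_def E_def algebra_simps)
  qed
qed

section \<open>Bounded weak derivatives\<close>

lemma pos_part_sq_deriv: "((\<lambda>y::real. (max 0 y)\<^sup>2) has_real_derivative 2 * max 0 y) (at y)"
proof -
  consider "y < 0" | "y > 0" | "y = 0" by linarith
  then show ?thesis
  proof cases
    case 1
    have d: "((\<lambda>y. 0) has_real_derivative 2 * max 0 y) (at y)" using 1 by auto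
    have "\<forall>\<^sub>F z in nhds y. (max 0 z)\<^sup>2 = 0"
      using eventually_nhds_in_open[of "{..<0}" y] 1 by (auto elim!: eventually_mono)
    from DERIV_cong_ev[THEN iffD2, OF refl this refl d] show ?thesis .
  next
    case 2
    have "((\<lambda>y. y\<^sup>2) has_real_derivative 2 * max 0 y) (at y)"
      using 2 by (auto intro!: derivative_eq_intros)
    note d = this
    have "\<forall>\<^sub>F z in nhds y. (max 0 z)\<^sup>2 = z\<^sup>2"
      using eventually_nhds_in_open[of "{0<..}" y] 2 by (auto elim!: eventually_mono)
    from DERIV_cong_ev[THEN iffD2, OF refl this refl d] show ?thesis .
  next
    case 3
    have "((\<lambda>h::real. (max 0 h)\<^sup>2 / h) \<longlongrightarrow> 0) (at 0)"
    proof (rule Lim_null_comparison[where g="\<lambda>h. \<bar>h\<bar>"])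
      show "\<forall>\<^sub>F h in at (0::real). norm ((max 0 h)\<^sup>2 / h) \<le> \<bar>h\<bar>"
        by (rule always_eventually) (auto simp: max_def power2_eq_square)
    qed (intro tendsto_eq_intros | simp)+
    then show ?thesis using 3 by (simp add: DERIV_def)
  qed
qed

text \<open>A quadratic spline rising from 0 to 1 across \<open>{a..a + 2 * r}\<close> for positive
  \<open>r\<close>; its derivative \<open>hat\<close> is a tent of mass one on that interval.
  Squares of positive parts give a closed form that is C^1, which is all that
  \<open>test_fun\<close> demands.\<close>

definition ramp :: "real \<Rightarrow> real \<Rightarrow> real \<Rightarrow> real" where
  "ramp a r t = ((max 0 (t - a))\<^sup>2 - 2 * (max 0 (t - a - r))\<^sup>2 + (max 0 (t - a - 2 * r))\<^sup>2) / (2 * r\<^sup>2)"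

definition hat :: "real \<Rightarrow> real \<Rightarrow> real \<Rightarrow> real" where
  "hat a r t = (max 0 (t - a) - 2 * max 0 (t - a - r) + max 0 (t - a - 2 * r)) / r\<^sup>2"

lemma pos_part_sq_chain [derivative_intros]:
  "(g has_real_derivative D) (at t within S) \<Longrightarrow>
   ((\<lambda>t. (max 0 (g t))\<^sup>2) has_real_derivative 2 * max 0 (g t) * D) (at t within S)"
  using DERIV_chain[OF pos_part_sq_deriv, of g D t S] by (simp add: o_def)

lemma ramp_deriv: "r \<noteq> 0 \<Longrightarrow> (ramp a r has_real_derivative hat a r t) (at t within S)"
proof -
  assume r: "r \<noteq> 0"
  have "(ramp a r has_real_derivative (2 * max 0 (t - a) * (1 - 0) - 2 * (2 * max 0 (t - a - r) * (1 - 0 - 0))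
      + 2 * max 0 (t - a - 2 * r) * (1 - 0 - 0)) / (2 * r\<^sup>2)) (at t within S)"
    unfolding ramp_def[abs_def]
    by (intro DERIV_cdivide DERIV_add DERIV_diff DERIV_cmult pos_part_sq_chain DERIV_ident DERIV_const)
  moreover have "(2 * max 0 (t - a) * (1 - 0) - 2 * (2 * max 0 (t - a - r) * (1 - 0 - 0))
      + 2 * max 0 (t - a - 2 * r) * (1 - 0 - 0)) / (2 * r\<^sup>2) = hat a r t"
    unfolding hat_def using r by (simp add: field_simps)
  ultimately show ?thesis by simp
qed

lemma hat_nonneg: "0 < r \<Longrightarrow> 0 \<le> hat a r t"
  unfolding hat_def by (intro divide_nonneg_nonneg) (auto simp: max_def)

lemma hat_outside: "0 < r \<Longrightarrow> t \<notin> {a..a + 2 * r} \<Longrightarrow> hat a r t = 0"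
  unfolding hat_def by (auto simp: max_def)

lemma ramp_left: "0 < r \<Longrightarrow> t \<le> a \<Longrightarrow> ramp a r t = 0"
  unfolding ramp_def by (auto simp: max_def)

lemma ramp_right: "0 < r \<Longrightarrow> a + 2 * r \<le> t \<Longrightarrow> ramp a r t = 1"
  unfolding ramp_def by (auto simp: max_def field_simps power2_eq_square)

lemma ramp_mono: "0 < r \<Longrightarrow> s \<le> t \<Longrightarrow> ramp a r s \<le> ramp a r t"
  by (rule DERIV_nonneg_imp_nondecreasing[of s t])
     (auto intro: ramp_deriv hat_nonneg simp: exI[of _ "hat a r _"])

lemma ramp_bounds: "0 < r \<Longrightarrow> 0 \<le> ramp a r t" "0 < r \<Longrightarrow> ramp a r t \<le> 1"
  using ramp_mono[of r "min t a" t a] ramp_left[of r "min t a" a]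
    ramp_mono[of r t "max t (a + 2 * r)" a] ramp_right[of r a "max t (a + 2 * r)"] by auto

lemma ramp_shift: "ramp (a + h) r t = ramp a r (t - h)"
  by (simp add: ramp_def algebra_simps)

lemma hat_cont [continuous_intros]: "continuous_on S f \<Longrightarrow> continuous_on S (\<lambda>z. hat a r (f z))"
  unfolding hat_def by (cases "r = 0") (auto intro!: continuous_intros)

lemma ramp_cont [continuous_intros]: "continuous_on S f \<Longrightarrow> continuous_on S (\<lambda>z. ramp a r (f z))"
  unfolding ramp_def by (cases "r = 0") (auto intro!: continuous_intros)

definition bump :: "real \<Rightarrow> real \<Rightarrow> real \<Rightarrow> real" where
  "bump a b x = (max 0 (x - a))\<^sup>2 * (max 0 (b - x))\<^sup>2"

definition bump' :: "real \<Rightarrow> real \<Rightarrow> real \<Rightarrow> real" where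
  "bump' a b x = 2 * max 0 (x - a) * (max 0 (b - x))\<^sup>2 - 2 * (max 0 (x - a))\<^sup>2 * max 0 (b - x)"

lemma bump_deriv: "(bump a b has_real_derivative bump' a b x) (at x within S)"
  unfolding bump_def[abs_def] bump'_def by (auto intro!: derivative_eq_intros)

lemma bump_cont [continuous_intros]:
  "continuous_on S f \<Longrightarrow> continuous_on S (\<lambda>z. bump a b (f z))"
  "continuous_on S f \<Longrightarrow> continuous_on S (\<lambda>z. bump' a b (f z))"
  unfolding bump_def bump'_def by (auto intro!: continuous_intros)

lemma bump_nonneg: "0 \<le> bump a b x"
  by (simp add: bump_def)

lemma bump_outside: "x \<notin> {a<..<b} \<Longrightarrow> bump a b x = 0" "x \<notin> {a<..<b} \<Longrightarrow> bump' a b x = 0"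
  unfolding bump_def bump'_def by (auto simp: max_def)

lemma bump_pos: "x \<in> {a<..<b} \<Longrightarrow> 0 < bump a b x"
  by (simp add: bump_def max_def)

lemma bump_integral_pos: "a < b \<Longrightarrow> 0 < integral {a..b} (bump a b)"
proof -
  assume ab: "a < b"
  have c: "continuous_on {a..b} (bump a b)"
    using bump_cont(1)[OF continuous_on_id] by simp
  have "0 \<le> integral {a..b} (bump a b)"
    by (rule integral_nonneg[OF integrable_continuous_interval[OF c]]) (simp add: bump_nonneg)
  moreover have "integral {a..b} (bump a b) \<noteq> 0"
    using integral_eq_0_iff[OF c ab] bump_nonneg[of a b] bump_pos[of "(a + b) / 2" a b] ab by force
  ultimately show ?thesis by linarith
qed

lemma integral_prod_mult:
  fixes f g :: "real \<Rightarrow> real"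
  assumes "continuous_on {a..b} f" "continuous_on {c..d} g"
  shows "integral (cbox (a, c) (b, d)) (\<lambda>z. f (fst z) * g (snd z)) = integral {a..b} f * integral {c..d} g"
proof -
  have "continuous_on (cbox (a, c) (b, d)) (\<lambda>z. f (fst z) * g (snd z))"
    by (intro continuous_intros continuous_on_compose2[OF assms(1)] continuous_on_compose2[OF assms(2)])
       (auto simp: cbox_Pair_eq)
  from integral_prod_continuous[OF this] show ?thesis
    by (simp add: cbox_interval)
qed

text \<open>Moves from the Lebesgue integral in the weak formulation to the gauge integral over a
  box, where iterated integration and the fundamental theorem are applied.\<close>

lemma lebesgue_on_supported:
  fixes f :: "'a::euclidean_space \<Rightarrow> real"
  assumes K: "cbox a b \<subseteq> U" and U: "open U" and f: "continuous_on (cbox a b) f"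
    and z: "\<And>z. z \<in> U \<Longrightarrow> z \<notin> cbox a b \<Longrightarrow> f z = 0"
  shows "integrable (lebesgue_on U) f" "integral\<^sup>L (lebesgue_on U) f = integral (cbox a b) f"
proof -
  have Us: "U \<in> sets lebesgue" using U by simp
  have ai: "f absolutely_integrable_on cbox a b" by (rule absolutely_integrable_continuous[OF f])
  have eq: "(\<lambda>x. indicat_real U x *\<^sub>R f x) = (\<lambda>x. indicat_real (cbox a b) x *\<^sub>R f x)"
    using K z by (auto simp: indicator_def fun_eq_iff)
  show 1: "integrable (lebesgue_on U) f"
    using ai unfolding set_integrable_def
    by (subst integrable_restrict_space) (use Us eq in auto)
  have "integral\<^sup>L (lebesgue_on U) f = (LINT x|lebesgue. indicat_real U x *\<^sub>R f x)"
    by (subst integral_restrict_space) (use Us in auto)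
  also have "\<dots> = (LINT x:cbox a b|lebesgue. f x)"
    unfolding eq set_lebesgue_integral_def ..
  also have "\<dots> = integral (cbox a b) f"
    by (rule set_lebesgue_integral_eq_integral(2)[OF ai])
  finally show "integral\<^sup>L (lebesgue_on U) f = integral (cbox a b) f" .
qed

section \<open>From bounded weak derivatives to Lipschitz bounds\<close>

lemma weak_deriv_Linf_le_uminus:
  assumes "weak_deriv_Linf_le U e u M"
  shows "weak_deriv_Linf_le U e (\<lambda>z. - u z) M"
proof -
  obtain g where g: "g \<in> borel_measurable (lebesgue_on U)" "is_weak_deriv U e u g" "Linf_norm U g \<le> ereal M"
    using assms unfolding weak_deriv_Linf_le_def by blast
  have "is_weak_deriv U e (\<lambda>z. - u z) (\<lambda>z. - g z)"
    using g(2) unfolding is_weak_deriv_def by simp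
  moreover have "Linf_norm U (\<lambda>z. - g z) \<le> ereal M"
    using g(3) unfolding Linf_norm_def by simp
  ultimately show ?thesis using g(1) unfolding weak_deriv_Linf_le_def
    by (intro exI[of _ "\<lambda>z. - g z"]) auto
qed

lemma outside_cbox_cases:
  fixes p q a b :: real
  assumes "(s, y) \<notin> cbox (p, a) (q, b)"
  shows "s < p \<or> q < s \<or> y \<notin> {a<..<b}"
  using assms by (auto simp: cbox_Pair_eq)

lemma test_fun_ramp_bump:
  assumes r: "0 < r" and t: "t1 \<le> t2" and K: "cbox (t1, a) (t2 + 2 * r, b) \<subseteq> U"
  defines "\<psi> \<equiv> \<lambda>z. (ramp t1 r (fst z) - ramp t2 r (fst z)) * bump a b (snd z)"
  shows "test_fun U \<psi>"
    and "frechet_derivative \<psi> (at z) (1, 0) = (hat t1 r (fst z) - hat t2 r (fst z)) * bump a b (snd z)"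
proof -
  have rd: "(ramp s r has_derivative (\<lambda>y. hat s r t * y)) (at t within S)" for s t S
    using ramp_deriv[of r s t S] r by (simp add: has_field_derivative_def mult_commute_abs)
  have bd: "(bump a b has_derivative (\<lambda>y. bump' a b t * y)) (at t within S)" for t S
    using bump_deriv[of a b t S] by (simp add: has_field_derivative_def mult_commute_abs)
  define D where "D = (\<lambda>z e. (hat t1 r (fst z) - hat t2 r (fst z)) * fst e * bump a b (snd z)
     + (ramp t1 r (fst z) - ramp t2 r (fst z)) * (bump' a b (snd z) * snd e))"
  have d: "(\<psi> has_derivative D z) (at z)" for z
    unfolding \<psi>_def D_def
    by (auto intro!: derivative_eq_intros has_derivative_compose[OF has_derivative_fst[OF has_derivative_ident] rd]
        has_derivative_compose[OF has_derivative_snd[OF has_derivative_ident] bd] simp: algebra_simps)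
  have fd: "frechet_derivative \<psi> (at z) = D z" for z
    using frechet_derivative_at[OF d[of z]] by simp
  show "frechet_derivative \<psi> (at z) (1, 0) = (hat t1 r (fst z) - hat t2 r (fst z)) * bump a b (snd z)"
    by (simp add: fd D_def)
  show "test_fun U \<psi>"
    unfolding test_fun_def
  proof (intro conjI allI)
    show "\<psi> differentiable (at z)" for z using d differentiableI by blast
    show "continuous_on UNIV (\<lambda>z. frechet_derivative \<psi> (at z) e)" for e
      unfolding fd D_def by (intro continuous_intros)
    have "\<psi> z = 0" if out: "z \<notin> cbox (t1, a) (t2 + 2 * r, b)" for z
    proof (cases z)
      case (Pair s y)
      then consider "s < t1" | "t2 + 2 * r < s" | "y \<notin> {a<..<b}"
        using outside_cbox_cases[OF out[unfolded Pair]] by blast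
      then show ?thesis
      proof cases
        case 1
        then show ?thesis using ramp_left[of r s] r t Pair by (simp add: \<psi>_def)
      next
        case 2
        then show ?thesis using ramp_right[of r _ s] r t Pair by (simp add: \<psi>_def)
      next
        case 3
        then show ?thesis using bump_outside(1) Pair by (simp add: \<psi>_def)
      qed
    qed
    then show "\<exists>K. compact K \<and> K \<subseteq> U \<and> (\<forall>z. z \<notin> K \<longrightarrow> \<psi> z = 0)"
      using K compact_cbox by blast
  qed
qed

text \<open>The test function is a ramp up near \<open>t1\<close> followed by a ramp down near
  \<open>t2\<close>, times a profile in space. Its time derivative is a difference of two tents, so
  the weak formulation compares averages of \<open>u\<close> near the two times; the right-hand side
  is at most \<open>M\<close> times the integral of the test function.\<close>

lemma weak_deriv_increment:
  fixes u :: "real \<times> real \<Rightarrow> real"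
  assumes wd: "weak_deriv_Linf_le U (1, 0) u M" and U: "open U" and M: "0 \<le> M"
    and u: "continuous_on U u"
    and r: "0 < r" and t: "t1 \<le> t2" and ab: "a < b" and K: "cbox (t1, a) (t2 + 2 * r, b) \<subseteq> U"
    and u1: "\<And>z. z \<in> cbox (t1, a) (t1 + 2 * r, b) \<Longrightarrow> u z \<le> v1"
    and u2: "\<And>z. z \<in> cbox (t2, a) (t2 + 2 * r, b) \<Longrightarrow> v2 \<le> u z"
  shows "v2 - v1 \<le> M * (t2 - t1 + 2 * r)"
proof -
  define K where "K = cbox (t1, a) (t2 + 2 * r, b)"
  define \<psi> where "\<psi> = (\<lambda>z. (ramp t1 r (fst z) - ramp t2 r (fst z)) * bump a b (snd z))"
  define F where "F = (\<lambda>z. u z * ((hat t1 r (fst z) - hat t2 r (fst z)) * bump a b (snd z)))"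
  define I where "I = integral {a..b} (bump a b)"
  have I: "0 < I" unfolding I_def by (rule bump_integral_pos[OF ab])
  note tf = test_fun_ramp_bump[OF r t K, folded \<psi>_def]
  obtain g where g: "is_weak_deriv U (1, 0) u g" "Linf_norm U g \<le> ereal M"
    using wd unfolding weak_deriv_Linf_le_def by blast
  have eq: "integral\<^sup>L (lebesgue_on U) F = - integral\<^sup>L (lebesgue_on U) (\<lambda>z. g z * \<psi> z)"
    using g(1)[unfolded is_weak_deriv_def, rule_format, OF tf(1)] unfolding F_def tf(2) .
  have KU: "K \<subseteq> U" using K by (simp add: K_def)
  have bc: "continuous_on {a..b} (bump a b)" using bump_cont(1)[OF continuous_on_id] by simp
  have hc: "continuous_on {c..d} (hat s r)" for s c d using hat_cont[OF continuous_on_id] by simp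
  have Hc: "continuous_on K (\<lambda>z. (hat t1 r (fst z) - hat t2 r (fst z)) * bump a b (snd z))"
    by (intro continuous_intros)
  have psi0: "0 \<le> \<psi> z" "\<psi> z \<le> bump a b (snd z)" for z
  proof -
    have "ramp t2 r (fst z) = ramp t1 r (fst z - (t2 - t1))" using ramp_shift[of t1 "t2 - t1" r] by simp
    also have "\<dots> \<le> ramp t1 r (fst z)" using ramp_mono[OF r] t by simp
    finally have "0 \<le> ramp t1 r (fst z) - ramp t2 r (fst z)" by simp
    moreover have "ramp t1 r (fst z) - ramp t2 r (fst z) \<le> 1"
      using ramp_bounds[OF r, of t1 "fst z"] ramp_bounds[OF r, of t2 "fst z"] by linarith
    ultimately show "0 \<le> \<psi> z" "\<psi> z \<le> bump a b (snd z)"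
      unfolding \<psi>_def using bump_nonneg[of a b "snd z"] by (auto simp: mult_left_le_one_le)
  qed
  have psi_out: "\<psi> z = 0" if out: "z \<notin> K" for z
  proof (cases z)
    case (Pair s y)
    then consider "s < t1" | "t2 + 2 * r < s" | "y \<notin> {a<..<b}"
      using outside_cbox_cases[OF out[unfolded Pair K_def]] by blast
    then show ?thesis
      by cases (use ramp_left[of r s] ramp_right[of r _ s] bump_outside(1) r t Pair in \<open>auto simp: \<psi>_def\<close>)
  qed
  have F_out: "F z = 0" if out: "z \<notin> K" for z
  proof (cases z)
    case (Pair s y)
    then consider "s < t1" | "t2 + 2 * r < s" | "y \<notin> {a<..<b}"
      using outside_cbox_cases[OF out[unfolded Pair K_def]] by blast
    then show ?thesis
      by cases (use hat_outside[of r s] bump_outside(1) r t Pair in \<open>auto simp: F_def\<close>)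
  qed
  have psi_c: "continuous_on K \<psi>" unfolding \<psi>_def by (intro continuous_intros)
  have F_c: "continuous_on K F" unfolding F_def
    by (intro continuous_on_mult Hc continuous_on_subset[OF u KU])
  note psiL = lebesgue_on_supported[OF KU[unfolded K_def] U psi_c[unfolded K_def] psi_out[unfolded K_def], folded K_def]
  note FL = lebesgue_on_supported[OF KU[unfolded K_def] U F_c[unfolded K_def] F_out[unfolded K_def], folded K_def]
  have "AE z in lebesgue_on U. ereal \<bar>g z\<bar> \<le> ereal M"
    using esssup_AE[of "\<lambda>z. ereal \<bar>g z\<bar>" "lebesgue_on U"] g(2) unfolding Linf_norm_def
    by (elim eventually_mono) (rule order_trans)
  then have gM: "AE z in lebesgue_on U. g z * \<psi> z \<le> M * \<psi> z"
    by eventually_elim (use psi0(1) in \<open>auto intro!: mult_right_mono\<close>)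
  have psiI: "integral K \<psi> \<le> (t2 + 2 * r - t1) * I"
  proof -
    have "integral K \<psi> \<le> integral K (\<lambda>z. (\<lambda>_. 1) (fst z) * bump a b (snd z))"
    proof (rule integral_le)
      show "\<psi> integrable_on K" using psi_c unfolding K_def by (rule integrable_continuous)
      have "continuous_on K (\<lambda>z. 1 * bump a b (snd z))" by (intro continuous_intros)
      then show "(\<lambda>z. (\<lambda>_. 1) (fst z) * bump a b (snd z)) integrable_on K"
        unfolding K_def by (rule integrable_continuous)
    qed (use psi0 in auto)
    also have "\<dots> = integral {t1..t2 + 2 * r} (\<lambda>_. 1) * I"
      unfolding K_def I_def by (rule integral_prod_mult) (auto intro: bc)
    also have "\<dots> = (t2 + 2 * r - t1) * I" using t r by simp
    finally show ?thesis .
  qed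
  have "integral\<^sup>L (lebesgue_on U) (\<lambda>z. g z * \<psi> z) \<le> integral\<^sup>L (lebesgue_on U) (\<lambda>z. M * \<psi> z)"
  \<comment> \<open>If the product is not integrable, its integral is 0 by convention, and the bound
    holds because the right-hand side is nonnegative.\<close>
  proof (cases "integrable (lebesgue_on U) (\<lambda>z. g z * \<psi> z)")
    case True
    then show ?thesis using gM psiL(1) by (intro integral_mono_AE) auto
  next
    case False
    then show ?thesis using psi0(1) M by (simp add: not_integrable_integral_eq Bochner_Integration.integral_nonneg)
  qed
  also have "\<dots> = M * integral K \<psi>" using psiL(2) by simp
  also have "\<dots> \<le> M * ((t2 + 2 * r - t1) * I)" using psiI M by (rule mult_left_mono)
  finally have low: "- integral K F \<le> M * (t2 + 2 * r - t1) * I"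
    using eq FL(2) by simp
  have hatI: "integral {t1..t2 + 2 * r} (hat s r) = 1" if "s \<in> {t1, t2}" for s
  proof -
    have "(hat s r has_integral (ramp s r (t2 + 2 * r) - ramp s r t1)) {t1..t2 + 2 * r}"
    proof (rule fundamental_theorem_of_calculus)
      show "t1 \<le> t2 + 2 * r" using t r by simp
      show "(ramp s r has_vector_derivative hat s r x) (at x within {t1..t2 + 2 * r})" for x
        using ramp_deriv[of r] r by (simp add: has_real_derivative_iff_has_vector_derivative)
    qed
    moreover have "ramp s r (t2 + 2 * r) = 1" using that r t by (intro ramp_right) auto
    moreover have "ramp s r t1 = 0" using that r t by (intro ramp_left) auto
    ultimately show ?thesis by (simp add: integral_unique)
  qed
  have G: "integral K (\<lambda>z. hat s r (fst z) * bump a b (snd z)) = I" if "s \<in> {t1, t2}" for s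
    unfolding K_def I_def by (subst integral_prod_mult[OF hc bc]) (simp add: hatI[OF that])
  have Gi: "(\<lambda>z. hat s r (fst z) * bump a b (snd z)) integrable_on K" for s
    unfolding K_def by (intro integrable_continuous continuous_intros)
  \<comment> \<open>Each tent is supported where the corresponding one-sided bound on
    \<open>u\<close> is available, so \<open>u\<close> may be replaced by the constants
    \<open>v1\<close> and \<open>v2\<close>.\<close>
  have "integral K F \<le> integral K (\<lambda>z. v1 * (hat t1 r (fst z) * bump a b (snd z))
       - v2 * (hat t2 r (fst z) * bump a b (snd z)))"
  proof (rule integral_le)
    show "F integrable_on K" using F_c unfolding K_def by (rule integrable_continuous)
    show "(\<lambda>z. v1 * (hat t1 r (fst z) * bump a b (snd z))
       - v2 * (hat t2 r (fst z) * bump a b (snd z))) integrable_on K"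
      by (intro integrable_diff integrable_on_mult_right Gi)
    fix z assume z: "z \<in> K"
    have b: "0 \<le> hat s r (fst z) * bump a b (snd z)" for s using hat_nonneg[OF r] bump_nonneg by simp
    have 1: "u z * (hat t1 r (fst z) * bump a b (snd z)) \<le> v1 * (hat t1 r (fst z) * bump a b (snd z))"
    proof (cases "z \<in> cbox (t1, a) (t1 + 2 * r, b)")
      case True
      then show ?thesis using u1 b by (intro mult_right_mono) auto
    next
      case False
      then have "fst z \<notin> {t1..t1 + 2 * r}" using z by (cases z) (auto simp: K_def cbox_Pair_eq)
      then show ?thesis using hat_outside[OF r] by simp
    qed
    have 2: "v2 * (hat t2 r (fst z) * bump a b (snd z)) \<le> u z * (hat t2 r (fst z) * bump a b (snd z))"
    proof (cases "z \<in> cbox (t2, a) (t2 + 2 * r, b)")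
      case True
      then show ?thesis using u2 b by (intro mult_right_mono) auto
    next
      case False
      then have "fst z \<notin> {t2..t2 + 2 * r}" using z by (cases z) (auto simp: K_def cbox_Pair_eq)
      then show ?thesis using hat_outside[OF r] by simp
    qed
    show "F z \<le> v1 * (hat t1 r (fst z) * bump a b (snd z)) - v2 * (hat t2 r (fst z) * bump a b (snd z))"
      using 1 2 by (simp add: F_def algebra_simps)
  qed
  also have "\<dots> = v1 * I - v2 * I"
    by (subst integral_diff) (auto intro!: integrable_on_mult_right Gi simp: G)
  finally have "(v2 - v1) * I \<le> (M * (t2 + 2 * r - t1)) * I"
    using low by (simp add: algebra_simps)
  then have "v2 - v1 \<le> M * (t2 + 2 * r - t1)" using I by (rule mult_right_le_imp_le)
  then show ?thesis by (simp add: algebra_simps)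
qed

text \<open>Continuity of \<open>u\<close> lets the averages of \<open>weak_deriv_increment\<close>
  shrink to point values, and compactness of the segment keeps the thin boxes inside
  \<open>U\<close>.\<close>

lemma weak_deriv_lipschitz_aux:
  fixes u :: "real \<times> real \<Rightarrow> real"
  assumes wd: "weak_deriv_Linf_le U (1, 0) u M" and U: "open U" and M: "0 \<le> M"
    and u: "continuous_on U u" and t: "t1 \<le> t2" and seg: "{t1..t2} \<times> {x} \<subseteq> U"
  shows "u (t2, x) - u (t1, x) \<le> M * (t2 - t1)"
proof (rule field_le_epsilon)
  fix e :: real assume e: "0 < e"
  have z1: "(t1, x) \<in> U" and z2: "(t2, x) \<in> U" using seg t by auto
  have near: "\<exists>d>0. \<forall>z. dist z y < d \<longrightarrow> z \<in> U \<and> \<bar>u z - u y\<bar> < e / 4" if "y \<in> U" for y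
  proof -
    have "isCont u y" using u U that continuous_on_eq_continuous_at by blast
    then have "(u \<longlongrightarrow> u y) (nhds y)"
      by (simp add: isCont_def tendsto_at_iff_tendsto_nhds)
    then have "\<forall>\<^sub>F z in nhds y. dist (u z) (u y) < e / 4"
      by (rule tendstoD) (use e in simp)
    moreover have "\<forall>\<^sub>F z in nhds y. z \<in> U"
      by (rule eventually_nhds_in_open[OF U that])
    ultimately have "\<forall>\<^sub>F z in nhds y. z \<in> U \<and> \<bar>u z - u y\<bar> < e / 4"
      by eventually_elim (simp add: dist_real_def)
    then show ?thesis by (simp add: eventually_nhds_metric)
  qed
  obtain d1 where d1: "d1 > 0" "\<And>z. dist z (t1, x) < d1 \<Longrightarrow> z \<in> U \<and> \<bar>u z - u (t1, x)\<bar> < e / 4"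
    using near[OF z1] by blast
  obtain d2 where d2: "d2 > 0" "\<And>z. dist z (t2, x) < d2 \<Longrightarrow> z \<in> U \<and> \<bar>u z - u (t2, x)\<bar> < e / 4"
    using near[OF z2] by blast
  have "compact ({t1..t2} \<times> {x})" by (intro compact_Times) auto
  from compact_subset_open_imp_ball_epsilon_subset[OF this U seg]
  obtain d3 where d3_pos: "d3 > 0" and d3_sub: "(\<Union>y\<in>{t1..t2} \<times> {x}. ball y d3) \<subseteq> U" .
  have d3: "z \<in> U" if "y \<in> {t1..t2} \<times> {x}" "dist z y < d3" for y z
  proof (rule subsetD[OF d3_sub], rule UN_I[OF that(1)])
    show "z \<in> ball y d3" using that(2) by (simp add: dist_commute)
  qed
  define d where "d = min d1 (min d2 d3)"
  have d: "0 < d" "d \<le> d1" "d \<le> d2" "d \<le> d3" using d1 d2 d3_pos by (auto simp: d_def)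
  \<comment> \<open>The first bound keeps the boxes within distance \<open>d\<close> of the segment,
    the second makes the excess \<open>2 * M * r\<close> at most \<open>e / 2\<close>;
    \<open>M + 1\<close> is a safe denominator also for \<open>M = 0\<close>.\<close>
  define r where "r = min (d / 4) (e / (4 * (M + 1)))"
  have "0 < r" using d e M by (simp add: r_def)
  moreover have "r \<le> d / 4" unfolding r_def by (rule min.cobounded1)
  moreover have "r \<le> e / (4 * (M + 1))" unfolding r_def by (rule min.cobounded2)
  ultimately have r: "0 < r" "r \<le> d / 4" "r \<le> e / (4 * (M + 1))" .
  have rM: "2 * M * r \<le> e / 2"
  proof -
    have "r * (4 * (M + 1)) \<le> e" using r(3) M by (simp add: pos_le_divide_eq)
    then show ?thesis using r(1) by (simp add: algebra_simps)
  qed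
  have close: "dist (s, y) (s', x) < d" if "\<bar>s - s'\<bar> \<le> 2 * r" "\<bar>y - x\<bar> \<le> r" for s s' y
  proof -
    have "dist (s, y) (s', x) \<le> dist s s' + dist y x"
      unfolding dist_Pair_Pair by (rule sqrt_sum_squares_le_sum) auto
    also have "\<dots> < d" using that r d by (auto simp: dist_real_def)
    finally show ?thesis .
  qed
  have "(u (t2, x) - e / 4) - (u (t1, x) + e / 4) \<le> M * (t2 - t1 + 2 * r)"
  proof (rule weak_deriv_increment[OF wd U M u r(1) t])
    show "x - r < x + r" using r by simp
    show "cbox (t1, x - r) (t2 + 2 * r, x + r) \<subseteq> U"
    proof
      fix z assume z: "z \<in> cbox (t1, x - r) (t2 + 2 * r, x + r)"
      obtain s y where [simp]: "z = (s, y)" by force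
      have sy: "t1 \<le> s" "s \<le> t2 + 2 * r" "\<bar>y - x\<bar> \<le> r" using z by (auto simp: cbox_Pair_eq)
      have "dist z (min s t2, x) < d" using close[of s "min s t2" y] sy r by auto
      then show "z \<in> U" using d3[of "(min s t2, x)" z] sy t d by auto
    qed
    fix z
    { assume z: "z \<in> cbox (t1, x - r) (t1 + 2 * r, x + r)"
      obtain s y where [simp]: "z = (s, y)" by force
      have "dist z (t1, x) < d" using close[of s t1 y] z by (auto simp: cbox_Pair_eq)
      then have "\<bar>u z - u (t1, x)\<bar> < e / 4" using d1(2)[of z] d by auto
      then show "u z \<le> u (t1, x) + e / 4" by linarith }
    { assume z: "z \<in> cbox (t2, x - r) (t2 + 2 * r, x + r)"
      obtain s y where [simp]: "z = (s, y)" by force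
      have "dist z (t2, x) < d" using close[of s t2 y] z by (auto simp: cbox_Pair_eq)
      then have "\<bar>u z - u (t2, x)\<bar> < e / 4" using d2(2)[of z] d by auto
      then show "u (t2, x) - e / 4 \<le> u z" by linarith }
  qed
  then show "u (t2, x) - u (t1, x) \<le> M * (t2 - t1) + e"
    using rM by (simp add: algebra_simps)
qed

lemma weak_deriv_lipschitz:
  fixes u :: "real \<times> real \<Rightarrow> real"
  assumes wd: "weak_deriv_Linf_le U (1, 0) u M" and U: "open U" and M: "0 \<le> M"
    and u: "continuous_on U u" and t: "t1 \<le> t2" and seg: "{t1..t2} \<times> {x} \<subseteq> U"
  shows "\<bar>u (t2, x) - u (t1, x)\<bar> \<le> M * (t2 - t1)"
  using weak_deriv_lipschitz_aux[OF wd U M u t seg]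
    weak_deriv_lipschitz_aux[OF weak_deriv_Linf_le_uminus[OF wd] U M continuous_on_minus[OF u] t seg]
  by simp

section \<open>Solutions of the boundary value problem in components\<close>

lemma sup_norm_le_iff: "sup_norm S f \<le> ereal r \<longleftrightarrow> (\<forall>i. \<forall>z\<in>S. \<bar>f z $ i\<bar> \<le> r)"
  unfolding sup_norm_def by (subst Max_le_iff) (auto simp: SUP_le_iff)

lemma C1_norm_I_le_iff:
  "C1_norm_I S f \<le> ereal r \<longleftrightarrow> (\<forall>i. \<forall>z\<in>S. \<bar>f z $ i\<bar> \<le> r \<and> \<bar>d1 S f z $ i\<bar> \<le> r)"
  unfolding C1_norm_I_def by (auto simp: sup_norm_le_iff)

lemma C1_norm_D_le_iff:
  "C1_norm_D p f \<le> ereal r \<longleftrightarrow> (\<forall>i. \<forall>t\<ge>0. \<forall>x\<in>{0..len p}.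
     \<bar>f t x $ i\<bar> \<le> r \<and> \<bar>dt f t x $ i\<bar> \<le> r \<and> \<bar>dx p f t x $ i\<bar> \<le> r)"
  unfolding C1_norm_D_def by (subst Max_le_iff) (auto simp: sup_norm_le_iff Dom_def)

lemma C1s_component:
  assumes "C1_D p (\<phi> :: real \<Rightarrow> real \<Rightarrow> real ^ 2)"
  shows "C1s (len p) (\<lambda>t x. \<phi> t x $ i) (\<lambda>t x. dt \<phi> t x $ i) (\<lambda>t x. dx p \<phi> t x $ i)"
  unfolding C1s_def
proof (intro conjI allI impI ballI)
  fix t x :: real assume tx: "0 \<le> t" "x \<in> {0..len p}"
  have "(\<lambda>s. \<phi> s x) differentiable (at t within {0..})"
    "(\<lambda>y. \<phi> t y) differentiable (at x within {0..len p})"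
    using assms tx unfolding C1_D_def Dom_def by auto
  then have "((\<lambda>s. \<phi> s x) has_vector_derivative dt \<phi> t x) (at t within {0..})"
    "(\<phi> t has_vector_derivative dx p \<phi> t x) (at x within {0..len p})"
    unfolding dt_def dx_def by (simp_all add: vector_derivative_works)
  from this[THEN bounded_linear.has_vector_derivative[OF bounded_linear_vec_nth[of i]]]
  show "((\<lambda>s. \<phi> s x $ i) has_real_derivative dt \<phi> t x $ i) (at t within {0..})"
    "((\<lambda>y. \<phi> t y $ i) has_real_derivative dx p \<phi> t x $ i) (at x within {0..len p})"
    by (simp_all add: has_real_derivative_iff_has_vector_derivative)
next
  have "continuous_on ({0..} \<times> {0..len p}) (\<lambda>(t, x). \<phi> t x)"
    "continuous_on ({0..} \<times> {0..len p}) (\<lambda>(t, x). dt \<phi> t x)"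
    "continuous_on ({0..} \<times> {0..len p}) (\<lambda>(t, x). dx p \<phi> t x)"
    using assms unfolding C1_D_def Dom_def by auto
  from this[THEN continuous_on_component[of _ _ i]]
  show "continuous_on ({0..} \<times> {0..len p}) (\<lambda>(t, x). \<phi> t x $ i)"
    "continuous_on ({0..} \<times> {0..len p}) (\<lambda>(t, x). dt \<phi> t x $ i)"
    "continuous_on ({0..} \<times> {0..len p}) (\<lambda>(t, x). dx p \<phi> t x $ i)"
    by (simp_all add: case_prod_unfold)
qed

lemma C1s_real:
  assumes "C1_D p (f :: real \<Rightarrow> real \<Rightarrow> real)"
  shows "C1s (len p) f (dt f) (dx p f)"
  unfolding C1s_def
proof (intro conjI allI impI ballI)
  fix t x :: real assume tx: "0 \<le> t" "x \<in> {0..len p}"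
  have "(\<lambda>s. f s x) differentiable (at t within {0..})"
    "(\<lambda>y. f t y) differentiable (at x within {0..len p})"
    using assms tx unfolding C1_D_def Dom_def by auto
  then show "((\<lambda>s. f s x) has_real_derivative dt f t x) (at t within {0..})"
    "(f t has_real_derivative dx p f t x) (at x within {0..len p})"
    unfolding dt_def dx_def has_real_derivative_iff_has_vector_derivative
    by (simp_all add: vector_derivative_works)
qed (use assms in \<open>auto simp: C1_D_def Dom_def\<close>)

lemma at_within_atLeast_neq_bot: "0 \<le> t \<Longrightarrow> at (t::real) within {0..} \<noteq> bot"
proof -
  assume t: "0 \<le> t"
  have "t islimpt {t..t + 1}" by (simp add: islimpt_Icc)
  then have "t islimpt {0..}" by (rule islimpt_subset) (use t in auto)
  then show ?thesis by (simp add: trivial_limit_within)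
qed

section \<open>Wave speeds near the background state\<close>

definition sound :: "params \<Rightarrow> real" where
  "sound p = (gam p - 1) * (sqrt (gam p) / (gam p - 1) * rho p powr ((gam p - 1) / 2))"

definition slope :: "params \<Rightarrow> real" where
  "slope p = (gam p + 1) / 2 + \<bar>3 - gam p\<bar> / 2"

lemma sound_pos: "valid_params p \<Longrightarrow> 0 < sound p"
  unfolding sound_def valid_params_def by simp

lemma slope_pos: "valid_params p \<Longrightarrow> 0 < slope p"
  unfolding slope_def valid_params_def by (intro add_pos_nonneg) auto

text \<open>\<open>lam p i\<close> is linear, and at \<open>Phi p\<close> the two speeds are exactly
  opposite, which is what the decoupling exploits. For \<open>gam p > 1\<close> the value of
  \<open>sound p\<close> is \<open>sqrt (gam p) * rho p powr ((gam p - 1) / 2)\<close>.\<close>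

lemma lam_Phi: "lam p i (v + Phi p) = sg i * sound p + lam p i v"
proof -
  define n where "n = sqrt (gam p) / (gam p - 1) * rho p powr ((gam p - 1) / 2)"
  have "Phi p $ 1 = - n" "Phi p $ 2 = n" "sound p = (gam p - 1) * n"
    by (simp_all add: Phi_def sound_def n_def Let_def)
  then show ?thesis
    using exhaust_2[of i] by (auto simp: lam_def field_simps)
qed

lemma lam_diff: "lam p i (v - w) = lam p i v - lam p i w"
  by (simp add: lam_def field_simps)

lemma lam_bound:
  assumes "valid_params p"
  shows "\<bar>lam p i v\<bar> \<le> slope p * (\<bar>v $ 1\<bar> + \<bar>v $ 2\<bar>)"
proof -
  have g: "0 \<le> (gam p + 1) / 2" using assms by (simp add: valid_params_def)
  have a: "\<bar>a * x + b * y\<bar> \<le> (\<bar>a\<bar> + \<bar>b\<bar>) * (\<bar>x\<bar> + \<bar>y\<bar>)" for a b x y :: real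
  proof -
    have "\<bar>a * x + b * y\<bar> \<le> \<bar>a\<bar> * \<bar>x\<bar> + \<bar>b\<bar> * \<bar>y\<bar>"
      using abs_triangle_ineq[of "a * x" "b * y"] by (simp add: abs_mult)
    also have "\<dots> \<le> (\<bar>a\<bar> + \<bar>b\<bar>) * (\<bar>x\<bar> + \<bar>y\<bar>)" by (simp add: algebra_simps)
    finally show ?thesis .
  qed
  show ?thesis
    using a[of "(gam p + 1) / 2" "v $ 1" "(3 - gam p) / 2" "v $ 2"]
      a[of "(3 - gam p) / 2" "v $ 1" "(gam p + 1) / 2" "v $ 2"] g
    unfolding slope_def lam_def by (auto simp: add.commute)
qed

lemma lam_bound_unif:
  assumes "valid_params p" "\<And>j. \<bar>v $ j\<bar> \<le> r"
  shows "\<bar>lam p i v\<bar> \<le> 2 * slope p * r"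
proof -
  have "slope p * (\<bar>v $ 1\<bar> + \<bar>v $ 2\<bar>) \<le> slope p * (r + r)"
    using slope_pos[OF assms(1)] assms(2)[of 1] assms(2)[of 2] by (intro mult_left_mono) auto
  then show ?thesis using lam_bound[OF assms(1), of i v] by simp
qed

lemma C1s_lam:
  assumes "C1_D p \<phi>"
  shows "C1s (len p) (\<lambda>t x. lam p i (\<phi> t x + Phi p)) (\<lambda>t x. lam p i (dt \<phi> t x))
    (\<lambda>t x. lam p i (dx p \<phi> t x))"
proof -
  have *: "C1s (len p) (\<lambda>t x. sg i * sound p + (a * \<phi> t x $ 1 + b * \<phi> t x $ 2))
    (\<lambda>t x. 0 + (a * dt \<phi> t x $ 1 + b * dt \<phi> t x $ 2)) (\<lambda>t x. 0 + (a * dx p \<phi> t x $ 1 + b * dx p \<phi> t x $ 2))"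
    for a b
    by (intro C1s_add C1s_const C1s_cmult C1s_component assms)
  show ?thesis
    unfolding lam_Phi
    using *[of "(gam p + 1) / 2" "(3 - gam p) / 2"] *[of "(3 - gam p) / 2" "(gam p + 1) / 2"]
    by (cases "i = 1") (simp_all add: lam_def)
qed

section \<open>Reflection laws and initial values\<close>

definition kap :: "params \<Rightarrow> 2 \<Rightarrow> real" where
  "kap p i = (if i = 1 then kap1 p else kap2 p)"

lemma kap_simps [simp]: "kap p 1 = kap1 p" "kap p 2 = kap2 p"
  by (simp_all add: kap_def)

lemma kap_le_1: "valid_params p \<Longrightarrow> \<bar>kap p i\<bar> \<le> 1"
  by (simp add: kap_def valid_params_def)

lemma IBVP_D:
  assumes "IBVP_sol p \<beta> b \<phi>0 \<phi>"
  shows "C1_D p \<phi>"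
    and "\<And>t x i. 0 \<le> t \<Longrightarrow> x \<in> {0..len p} \<Longrightarrow>
       dt \<phi> t x $ i + lam p i (\<phi> t x + Phi p) * dx p \<phi> t x $ i = \<beta> t x / 2 * (\<phi> t x $ 1 + \<phi> t x $ 2)"
    and "\<And>x. x \<in> {0..len p} \<Longrightarrow> \<phi> 0 x = \<phi>0 x"
    and "\<And>t i. 0 \<le> t \<Longrightarrow>
       \<phi> t (inflow (len p) i) $ i = b t $ i + kap p i * \<phi> t (inflow (len p) i) $ oth i"
proof -
  show "\<phi> t (inflow (len p) i) $ i = b t $ i + kap p i * \<phi> t (inflow (len p) i) $ oth i" if "0 \<le> t" for t i
    using assms that exhaust_2[of i] unfolding IBVP_sol_def by auto
qed (use assms in \<open>auto simp: IBVP_sol_def Dom_def\<close>)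

text \<open>The reflection law holds for all \<open>t \<ge> 0\<close> and may be differentiated in
  time; for two solutions with the same boundary data the term with \<open>d1\<close>
  cancels.\<close>

lemma inflow_dt:
  assumes sol: "IBVP_sol p \<beta> b \<phi>0 \<phi>" and b: "C1_I {0..} b" and L: "0 < len p" and t: "0 \<le> t"
  shows "dt \<phi> t (inflow (len p) i) $ i
     = d1 {0..} b t $ i + kap p i * dt \<phi> t (inflow (len p) i) $ oth i"
proof -
  define y where "y = inflow (len p) i"
  have y: "y \<in> {0..len p}" unfolding y_def by (rule inflow_mem) (use L in simp)
  note \<phi> = C1s_D(1)[OF C1s_component[OF IBVP_D(1)[OF sol]] t y]
  have "(b has_vector_derivative d1 {0..} b t) (at t within {0..})"
    using b t unfolding C1_I_def d1_def differentiable_on_def by (simp add: vector_derivative_works)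
  from bounded_linear.has_vector_derivative[OF bounded_linear_vec_nth[of i] this]
  have bd: "((\<lambda>s. b s $ i) has_real_derivative d1 {0..} b t $ i) (at t within {0..})"
    by (simp add: has_real_derivative_iff_has_vector_derivative)
  have "((\<lambda>s. b s $ i + kap p i * \<phi> s y $ oth i) has_real_derivative
     d1 {0..} b t $ i + kap p i * dt \<phi> t y $ oth i) (at t within {0..})"
    by (intro DERIV_add bd DERIV_cmult \<phi>)
  moreover have "\<phi> s y $ i = b s $ i + kap p i * \<phi> s y $ oth i" if "s \<in> {0..}" for s
    using IBVP_D(4)[OF sol, of s i] that by (simp add: y_def)
  ultimately have "((\<lambda>s. \<phi> s y $ i) has_real_derivative
     d1 {0..} b t $ i + kap p i * dt \<phi> t y $ oth i) (at t within {0..})"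
    using t by (auto intro: has_field_derivative_transform_within[where d=1])
  with \<phi>[of i] show ?thesis
    unfolding y_def has_real_derivative_iff_has_vector_derivative
    using vector_derivative_unique_within[OF at_within_atLeast_neq_bot[OF t]] by blast
qed

lemma initial_dx:
  assumes "IBVP_sol p \<beta> b \<phi>0 \<phi>" "x \<in> {0..len p}"
  shows "dx p \<phi> 0 x = d1 {0..len p} \<phi>0 x"
  unfolding dx_def d1_def
  by (rule vector_derivative_cong_eq) (use assms IBVP_D(3)[OF assms(1)] in \<open>auto simp: eventually_at_filter\<close>)

text \<open>A real supremum is informative only for a bounded set; \<open>A0\<close> provides the
  bound, and the point 0 of \<open>Psi\<close> contributes a positive term.\<close>

lemma T0_pos:
  assumes "valid_params p" "valid_nbhd p Psi A0"
  shows "0 < T0 p Psi"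
proof -
  have L: "0 < len p" using assms by (simp add: valid_params_def)
  have z: "0 \<in> Psi" using assms(2) interior_subset unfolding valid_nbhd_def by blast
  define S where "S = (SUP v\<in>Psi. len p / \<bar>lam p 1 (v + Phi p)\<bar>)"
  have bdd: "bdd_above ((\<lambda>v. len p / \<bar>lam p 1 (v + Phi p)\<bar>) ` Psi)"
  proof (rule bdd_aboveI2)
    fix v assume "v \<in> Psi"
    then have "\<bar>inverse (lam p 1 (v + Phi p))\<bar> \<le> A0" using assms(2) by (auto simp: valid_nbhd_def)
    then have "len p * \<bar>inverse (lam p 1 (v + Phi p))\<bar> \<le> len p * A0" using L by (intro mult_left_mono) auto
    then show "len p / \<bar>lam p 1 (v + Phi p)\<bar> \<le> len p * A0" by (simp add: divide_inverse)
  qed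
  have "0 < len p / \<bar>lam p 1 (0 + Phi p)\<bar>"
    using L z assms(2) unfolding valid_nbhd_def by (intro divide_pos_pos) fastforce+
  also have "\<dots> \<le> S" unfolding S_def by (rule cSUP_upper[OF z bdd])
  also have "S \<le> T0 p Psi" unfolding T0_def S_def by (intro Max_ge) auto
  finally show ?thesis .
qed

text \<open>\<open>\<sigma>\<close> is chosen so that
  \<open>exp (- \<sigma> * \<tau>) = \<xi>\<close>; rounding the exponent down to an integer costs
  at most one factor \<open>\<xi>\<close>.\<close>

lemma pow_floor_bounds:
  fixes \<xi> \<tau> t :: real
  assumes "0 < \<xi>" "\<xi> < 1" "0 < \<tau>" "0 \<le> t"
  defines "\<sigma> \<equiv> - ln \<xi> / \<tau>"
  shows "exp (- \<sigma> * t) \<le> \<xi> ^ nat \<lfloor>t / \<tau>\<rfloor>" "\<xi> ^ nat \<lfloor>t / \<tau>\<rfloor> \<le> exp (- \<sigma> * t) / \<xi>"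
proof -
  define n where "n = nat \<lfloor>t / \<tau>\<rfloor>"
  have "0 \<le> t / \<tau>" using assms by simp
  then have n: "real n \<le> t / \<tau>" "t / \<tau> < real n + 1" unfolding n_def by linarith+
  have l: "ln \<xi> < 0" using assms by simp
  have pw: "\<xi> ^ n = exp (real n * ln \<xi>)" using assms(1) by (simp add: exp_of_nat_mult)
  have e: "- \<sigma> * t = t / \<tau> * ln \<xi>" by (simp add: \<sigma>_def)
  have "t / \<tau> * ln \<xi> \<le> real n * ln \<xi>" using n(1) l by (intro mult_right_mono_neg) auto
  then show "exp (- \<sigma> * t) \<le> \<xi> ^ nat \<lfloor>t / \<tau>\<rfloor>" unfolding n_def[symmetric] pw e by simp
  have "(real n + 1) * ln \<xi> \<le> t / \<tau> * ln \<xi>" using n(2) l by (intro mult_right_mono_neg) auto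
  then have "exp (real n * ln \<xi>) * exp (ln \<xi>) \<le> exp (t / \<tau> * ln \<xi>)"
    by (simp add: algebra_simps flip: exp_add)
  then show "\<xi> ^ nat \<lfloor>t / \<tau>\<rfloor> \<le> exp (- \<sigma> * t) / \<xi>"
    unfolding n_def[symmetric] pw e using assms(1) by (simp add: field_simps)
qed

text \<open>(S) asserts the convergence for some solution; uniqueness transfers it to the given one,
  at least on the domain, where alone the norms look.\<close>

lemma stability_C0:
  assumes "stability_property p Psi per \<epsilon>1 CE \<epsilon>2 CS \<xi>"
    and "0 < \<epsilon>" "\<epsilon> < \<epsilon>2" "damping p \<epsilon> \<beta>" "bdry_data p \<epsilon> b" "init_data p (CE * \<epsilon>) \<phi>0"
    "compatible p \<beta> b \<phi>0" "IBVP_sol p \<beta> b \<phi>0 \<phi>"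
  shows "C0_convergence p Psi (CS * \<epsilon>) \<xi> \<phi> (per \<epsilon> \<beta> b)"
proof -
  obtain \<phi>' where \<phi>': "\<And>\<phi>. IBVP_sol p \<beta> b \<phi>0 \<phi> \<Longrightarrow> \<forall>(t, x)\<in>Dom p. \<phi> t x = \<phi>' t x"
    "C0_convergence p Psi (CS * \<epsilon>) \<xi> \<phi>' (per \<epsilon> \<beta> b)"
    using assms unfolding stability_property_def by blast
  have "\<phi> t x = \<phi>' t x" if "0 \<le> t" "x \<in> {0..len p}" for t x
    using \<phi>'(1)[OF assms(8)] that by (auto simp: Dom_def)
  then show ?thesis
    using \<phi>'(2) unfolding C0_convergence_def sup_norm_le_iff by simp
qed

text \<open>The weak derivative lives on the open strip. The resulting increment bound extends by
  continuity to the closure, which is needed at \<open>t = 0\<close> and at both ends of the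
  duct.\<close>

lemma W2inf_dx_lipschitz:
  assumes W: "W2inf_D p f M" and f: "C1_D p f" and L: "0 < len p" and M: "0 \<le> M"
    and t: "0 \<le> t" and h: "0 \<le> h" and x: "x \<in> {0..len p}"
  shows "\<bar>dx p f (t + h) x $ i - dx p f t x $ i\<bar> \<le> M * h"
proof -
  define U :: "(real \<times> real) set" where "U = {0<..} \<times> {0<..<len p}"
  define u where "u = (\<lambda>(t, x). dx p f t x $ i)"
  have wd: "weak_deriv_Linf_le U (1, 0) u M"
    using W unfolding W2inf_D_def U_def u_def by auto
  have U: "open U" unfolding U_def by (intro open_Times) auto
  have c: "continuous_on ({0..} \<times> {0..len p}) u"
    using C1s_cont(3)[OF C1s_component[OF f, of i]] by (simp add: u_def)
  have cU: "continuous_on U u" by (rule continuous_on_subset[OF c]) (auto simp: U_def)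
  define g where "g = (\<lambda>z. \<bar>u (fst z + h, snd z) - u z\<bar>)"
  have cl: "closure U = {0..} \<times> {0..len p}" using L by (simp add: U_def closure_Times)
  have gc: "continuous_on (closure U) g"
    unfolding g_def cl
    by (intro continuous_intros c continuous_on_compose2[OF c]) (use h in auto)
  have gU: "g z \<le> M * h" if "z \<in> U" for z
  proof -
    obtain s y where z: "z = (s, y)" by force
    have "\<bar>u (s + h, y) - u (s, y)\<bar> \<le> M * (s + h - s)"
      by (rule weak_deriv_lipschitz[OF wd U M cU]) (use that h z in \<open>auto simp: U_def\<close>)
    then show ?thesis by (simp add: g_def z)
  qed
  have "(t, x) \<in> closure U" using t x by (simp add: cl)
  then have "g (t, x) \<le> M * h" using continuous_le_on_closure[OF gc _ gU] by blast
  then show ?thesis by (simp add: g_def u_def)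
qed

section \<open>A strict bound for the decay rate\<close>

text \<open>The maximum principle run backwards in time: if all weighted values were below
  \<open>N\<close> at time \<open>T\<close>, going back to \<open>s\<close> there would be a first
  contact with the level \<open>N\<close>. In the interior this contradicts
  \<open>sg i * lam i t x * \<alpha> < \<sigma>\<close>, and at the ends the weights are such that
  the reflections amplify. So the weighted maximum cannot drop.\<close>

lemma backward_growth:
  fixes w wt wx lam :: "2 \<Rightarrow> real \<Rightarrow> real \<Rightarrow> real"
  assumes L: "0 < L" and a: "\<And>i. 0 < a i" and w: "\<And>i. C1s L (w i) (wt i) (wx i)"
    and s: "0 \<le> s" "s \<le> T" and al: "0 \<le> \<alpha>"
    and sp: "\<And>i t x. s \<le> t \<Longrightarrow> t \<le> T \<Longrightarrow> x \<in> {0..L} \<Longrightarrow> 0 \<le> sg i * lam i t x \<and> sg i * lam i t x * \<alpha> < \<sigma>"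
    and pde: "\<And>i t x. s \<le> t \<Longrightarrow> t \<le> T \<Longrightarrow> x \<in> {0..L} \<Longrightarrow> wt i t x + lam i t x * wx i t x = 0"
    and bd: "\<And>i t. s \<le> t \<Longrightarrow> t \<le> T \<Longrightarrow> \<bar>w i t (inflow L i)\<bar> = \<bar>k i\<bar> * \<bar>w (oth i) t (inflow L i)\<bar>"
    and k: "\<And>i. wgt \<alpha> a (oth i) (inflow L i) < wgt \<alpha> a i (inflow L i) * \<bar>k i\<bar>"
    and N: "0 < N" "x0 \<in> {0..L}" "N \<le> \<bar>w i0 s x0\<bar> * (exp (\<sigma> * s) * wgt \<alpha> a i0 x0)"
  obtains i x where "x \<in> {0..L}" "N \<le> \<bar>w i T x\<bar> * (exp (\<sigma> * T) * wgt \<alpha> a i x)"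
proof (rule ccontr)
  note found = that
  assume no: "\<not> thesis"
  have small: "\<bar>w i T x\<bar> * (exp (\<sigma> * T) * wgt \<alpha> a i x) < N" if "x \<in> {0..L}" for i x
    using found[OF that] no not_le by blast
  define f where "f = (\<lambda>i t x. \<bar>w i t x\<bar> * (exp (\<sigma> * t) * wgt \<alpha> a i x))"
  have wp: "0 < wgt \<alpha> a i x" for i x using wgt_pos[OF a] .
  have cont: "continuous_on ({0..T - s} \<times> {0..L}) (\<lambda>(r, x). f i (T - r) x)" for i
  proof -
    have "continuous_on ({0..T - s} \<times> {0..L}) (\<lambda>z. (\<lambda>(t, x). w i t x) (T - fst z, snd z))"
      by (rule continuous_on_compose2[OF C1s_cont(1)[OF w[of i]]]) (use s in \<open>auto intro!: continuous_intros\<close>)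
    then show ?thesis
      unfolding f_def wgt_def by (auto intro!: continuous_intros simp: case_prod_unfold)
  qed
  have "f i (T - 0) x < N" if "x \<in> {0..L}" for i x using small[OF that] by (simp add: f_def)
  moreover have "T - s \<in> {0..T - s}" "N \<le> f i0 (T - (T - s)) x0" using s N by (auto simp: f_def)
  ultimately obtain i r x where r: "0 < r" "r \<le> T - s" and x: "x \<in> {0..L}" and eqN: "f i (T - r) x = N"
    and le: "\<And>j q y. 0 \<le> q \<Longrightarrow> q \<le> r \<Longrightarrow> y \<in> {0..L} \<Longrightarrow> f j (T - q) y \<le> N"
    using first_touch[where f="\<lambda>i r x. f i (T - r) x", OF cont _ _ N(2)] by metis
  define t where "t = T - r"
  have t: "s \<le> t" "t \<le> T" "0 \<le> t" using r s by (auto simp: t_def)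
  have le': "f j q y \<le> N" if "t \<le> q" "q \<le> T" "y \<in> {0..L}" for j q y
    using le[of "T - q" y j] that by (simp add: t_def)
  define W where "W = exp (\<sigma> * t) * wgt \<alpha> a i x"
  have W: "0 < W" unfolding W_def using wp by simp
  have NW: "N = \<bar>w i t x\<bar> * W" using eqN by (simp add: f_def W_def t_def)
  have wn: "0 < \<bar>w i t x\<bar>" using NW N(1) by auto
  show False
  \<comment> \<open>This is the end where component \<open>i\<close> leaves, hence enters in
    reversed time; there the reflection law of the other component determines its modulus.\<close>
  proof (cases "x = inflow L (oth i)")
    case True
    have "N = \<bar>w i t x\<bar> * exp (\<sigma> * t) * wgt \<alpha> a i x" using NW by (simp add: W_def)
    also have "\<dots> < \<bar>w i t x\<bar> * exp (\<sigma> * t) * (wgt \<alpha> a (oth i) x * \<bar>k (oth i)\<bar>)"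
      using k[of "oth i"] True wn by (intro mult_strict_left_mono) auto
    also have "\<dots> = f (oth i) t x" using bd[OF t(1,2), of "oth i"] True by (simp add: f_def)
    also have "\<dots> \<le> N" using le'[of t x "oth i"] t x by simp
    finally show False by simp
  next
    case False
    define z where "z = sgn (w i t x)"
    have zw: "z * w i t x = \<bar>w i t x\<bar>" by (simp add: z_def abs_sgn)
    have z1: "\<bar>z\<bar> \<le> 1" by (simp add: z_def sgn_if)
    define u where "u = (\<lambda>r y. z * w i r y * (exp (\<sigma> * r) * wgt \<alpha> a i y))"
    have d: "((\<lambda>r. w i r x) has_real_derivative wt i t x) (at t within {t..T})"
      "(w i t has_real_derivative wx i t x) (at x within {0..L})"
      using C1s_D[OF w[of i] t(3) x] t by (auto intro: DERIV_subset)
    note wd = weighted_derivs[OF d, where z=z and \<sigma>=\<sigma> and \<alpha>=\<alpha> and a=a and i=i, folded W_def]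
    have umax: "u q y \<le> u t x" if "t \<le> q" "q \<le> T" "y \<in> {0..L}" for q y
    proof -
      have "z * w i q y \<le> 1 * \<bar>w i q y\<bar>" by (intro abs_le_mult_bound z1)
      then have "u q y \<le> f i q y" unfolding u_def f_def
        using wp[of i y] by (intro mult_right_mono) auto
      also have "\<dots> \<le> N" using le' that by simp
      also have "\<dots> = u t x" using NW zw by (simp add: u_def W_def)
      finally show ?thesis .
    qed
    have ut: "z * (wt i t x + \<sigma> * w i t x) * W \<le> 0"
      by (rule deriv_at_right_max[OF wd(1), of r]) (use r umax[OF _ _ x] in \<open>auto simp: u_def t_def\<close>)
    have "0 \<le> sg (oth i) * (z * (wx i t x - sg i * \<alpha> * w i t x) * W)"
      by (rule space_deriv_at_max[OF wd(2) x False L]) (use umax[of t] t in \<open>auto simp: u_def\<close>)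
    then have ux: "sg i * (z * (wx i t x - sg i * \<alpha> * w i t x) * W) \<le> 0" by simp
    have sl: "0 \<le> sg i * lam i t x" "sg i * lam i t x * \<alpha> < \<sigma>" using sp[OF t(1,2) x, of i] by auto
    have "(sg i * lam i t x) * (sg i * (z * (wx i t x - sg i * \<alpha> * w i t x) * W)) \<le> 0"
      by (rule mult_nonneg_nonpos[OF sl(1) ux])
    moreover have "(sg i * lam i t x) * (sg i * (z * (wx i t x - sg i * \<alpha> * w i t x) * W))
       = (sg i * sg i) * lam i t x * z * (wx i t x - sg i * \<alpha> * w i t x) * W"
      by (simp only: mult_ac)
    ultimately have "lam i t x * z * (wx i t x - sg i * \<alpha> * w i t x) * W
       + z * (wt i t x + \<sigma> * w i t x) * W \<le> 0" using ut by simp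
    also have "lam i t x * z * (wx i t x - sg i * \<alpha> * w i t x) * W + z * (wt i t x + \<sigma> * w i t x) * W
      = (z * (wt i t x + lam i t x * wx i t x) + (\<sigma> - sg i * lam i t x * \<alpha>) * (z * w i t x)) * W"
      by (simp add: algebra_simps)
    also have "\<dots> = (\<sigma> - sg i * lam i t x * \<alpha>) * \<bar>w i t x\<bar> * W"
      using pde[OF t(1,2) x, of i] zw by simp
    finally have "(\<sigma> - sg i * lam i t x * \<alpha>) * \<bar>w i t x\<bar> * W \<le> 0" .
    moreover have "0 < (\<sigma> - sg i * lam i t x * \<alpha>) * \<bar>w i t x\<bar> * W"
      using sl wn W by simp
    ultimately show False by simp
  qed
qed

text \<open>Counterpart of \<open>weights_exist\<close> with the inequalities reversed: without the
  gap, any \<open>\<alpha>\<close> above \<open>\<sigma> / c\<close> makes a round trip expand in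
  the weighted norm, and because \<open>c' < c\<close> such an \<open>\<alpha>\<close> can still
  satisfy \<open>c' * \<alpha> < \<sigma>\<close>.\<close>

lemma slow_weights_exist:
  fixes c c' L \<sigma> k1 k2 :: real
  assumes c: "0 < c'" "c' < c" and L: "0 < L" and s: "0 < \<sigma>"
    and gap: "1 \<le> \<bar>k1 * k2\<bar> * exp (2 * \<sigma> * L / c)"
  obtains \<alpha> K where "0 < \<alpha>" "c' * \<alpha> < \<sigma>" "0 < K" "1 < K * \<bar>k2\<bar>" "K < exp (2 * \<alpha> * L) * \<bar>k1\<bar>"
proof -
  have "\<sigma> / c < \<sigma> / c'" using c s by (simp add: field_simps)
  then obtain \<alpha> where al: "\<sigma> / c < \<alpha>" "\<alpha> < \<sigma> / c'" using dense by blast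
  have "0 < \<sigma> / c" using s c by simp
  then have a0: "0 < \<alpha>" using al by linarith
  have ac: "c' * \<alpha> < \<sigma>" using al(2) c by (simp add: field_simps)
  have kn: "0 < \<bar>k1 * k2\<bar>" using gap by (cases "k1 * k2 = 0") auto
  then have k2: "0 < \<bar>k2\<bar>" by auto
  have "\<sigma> / c * L < \<alpha> * L" using al(1) L by (rule mult_strict_right_mono)
  then have "exp (2 * \<sigma> * L / c) < exp (2 * \<alpha> * L)" by simp
  then have "\<bar>k1 * k2\<bar> * exp (2 * \<sigma> * L / c) < \<bar>k1 * k2\<bar> * exp (2 * \<alpha> * L)"
    using kn by (intro mult_strict_left_mono)
  then have "1 < \<bar>k1 * k2\<bar> * exp (2 * \<alpha> * L)" using gap by linarith
  then have "1 / \<bar>k2\<bar> < exp (2 * \<alpha> * L) * \<bar>k1\<bar>" using k2 by (simp add: field_simps abs_mult)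
  then obtain K where K: "1 / \<bar>k2\<bar> < K" "K < exp (2 * \<alpha> * L) * \<bar>k1\<bar>" using dense by blast
  have "0 < 1 / \<bar>k2\<bar>" using k2 by simp
  then have K0: "0 < K" using K(1) by linarith
  have "1 < K * \<bar>k2\<bar>" using K(1) k2 by (simp add: field_simps)
  then show ?thesis using that[OF a0 ac K0 _ K(2)] by blast
qed

section \<open>Constant functions as data and as solutions\<close>

lemma at_within_Icc_neq_bot: "0 < L \<Longrightarrow> x \<in> {0..L} \<Longrightarrow> at (x::real) within {0..L} \<noteq> bot"
proof -
  assume "0 < L" "x \<in> {0..L}"
  then have "x islimpt {0..L}" by (simp add: islimpt_Icc)
  then show ?thesis by (simp add: trivial_limit_within)
qed

lemma d1_const:
  "0 \<le> t \<Longrightarrow> d1 {0..} (\<lambda>_. a) t = 0"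
  "0 < L \<Longrightarrow> x \<in> {0..L} \<Longrightarrow> d1 {0..L} (\<lambda>_. a) x = 0"
  unfolding d1_def
  by (rule vector_derivative_within, erule at_within_atLeast_neq_bot, rule has_vector_derivative_const)
     (rule vector_derivative_within, erule (1) at_within_Icc_neq_bot, rule has_vector_derivative_const)

lemma C1_I_const: "C1_I {0..} (\<lambda>_. a)" "0 < L \<Longrightarrow> C1_I {0..L} (\<lambda>_. a)"
proof -
  have "continuous_on {0..} (d1 {0..} (\<lambda>_. a))"
    by (rule continuous_on_eq[OF continuous_on_const[of _ 0]]) (simp add: d1_const)
  then show "C1_I {0..} (\<lambda>_. a)" by (simp add: C1_I_def)
  assume "0 < L"
  then have "continuous_on {0..L} (d1 {0..L} (\<lambda>_. a))"
    by (intro continuous_on_eq[OF continuous_on_const[of _ 0]]) (simp add: d1_const)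
  then show "C1_I {0..L} (\<lambda>_. a)" by (simp add: C1_I_def)
qed

lemma C1_D_const_on:
  assumes "0 < len p" "\<And>t x. 0 \<le> t \<Longrightarrow> x \<in> {0..len p} \<Longrightarrow> f t x = a"
  shows "C1_D p f" "0 \<le> t \<Longrightarrow> x \<in> {0..len p} \<Longrightarrow> dt f t x = 0"
    "0 \<le> t \<Longrightarrow> x \<in> {0..len p} \<Longrightarrow> dx p f t x = 0"
proof -
  have vt: "((\<lambda>s. f s x) has_vector_derivative 0) (at t within {0..})" if "0 \<le> t" "x \<in> {0..len p}" for t x
    by (rule has_vector_derivative_transform[OF _ _ has_vector_derivative_const]) (use assms that in auto)
  have vx: "(f t has_vector_derivative 0) (at x within {0..len p})" if "0 \<le> t" "x \<in> {0..len p}" for t x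
    by (rule has_vector_derivative_transform[OF _ _ has_vector_derivative_const]) (use assms that in auto)
  have dt0: "dt f t x = 0" if "0 \<le> t" "x \<in> {0..len p}" for t x
    unfolding dt_def
    by (rule vector_derivative_within[OF at_within_atLeast_neq_bot[OF that(1)] vt[OF that]])
  have dx0: "dx p f t x = 0" if "0 \<le> t" "x \<in> {0..len p}" for t x
    unfolding dx_def
    by (rule vector_derivative_within[OF at_within_Icc_neq_bot[OF assms(1) that(2)] vx[OF that]])
  show "0 \<le> t \<Longrightarrow> x \<in> {0..len p} \<Longrightarrow> dt f t x = 0" "0 \<le> t \<Longrightarrow> x \<in> {0..len p} \<Longrightarrow> dx p f t x = 0"
    using dt0 dx0 by auto
  have c: "continuous_on (Dom p) (\<lambda>(t, x). g t x)" if "\<And>t x. 0 \<le> t \<Longrightarrow> x \<in> {0..len p} \<Longrightarrow> g t x = k" for g k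
    by (rule continuous_on_eq[OF continuous_on_const[of _ k]]) (use that in \<open>auto simp: Dom_def\<close>)
  have "continuous_on (Dom p) (\<lambda>(t, x). f t x)" by (rule c, rule assms(2))
  moreover have "continuous_on (Dom p) (\<lambda>(t, x). dt f t x)" by (rule c, rule dt0)
  moreover have "continuous_on (Dom p) (\<lambda>(t, x). dx p f t x)" by (rule c, rule dx0)
  ultimately show "C1_D p f"
    unfolding C1_D_def
    using vt[THEN differentiableI_vector] vx[THEN differentiableI_vector] by (auto simp: Dom_def)
qed

text \<open>The constant states \<open>(\<eta>, -\<eta>)\<close> have both wave speeds smaller than the sound speed. A
  perturbation of such a state decays at the rate dictated by these slower speeds, and property (S)
  must accommodate it; hence the inequality is strict.\<close>

lemma rate_gap:
  assumes vp: "valid_params p" and nb: "valid_nbhd p Psi A0"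
    and ex: "existence_property p per \<epsilon>1 CE"
    and st: "stability_property p Psi per \<epsilon>1 CE \<epsilon>2 CS \<xi>"
  shows "\<bar>kap1 p * kap2 p\<bar> * exp (2 * (- ln \<xi> / T0 p Psi) * len p / sound p) < 1"
proof (rule ccontr)
  define \<sigma> where "\<sigma> = - ln \<xi> / T0 p Psi"
  define L where "L = len p"
  define c where "c = sound p"
  define B where "B = slope p"
  assume "\<not> ?thesis"
  then have ng: "1 \<le> \<bar>kap1 p * kap2 p\<bar> * exp (2 * \<sigma> * L / c)" by (simp add: \<sigma>_def L_def c_def)
  have c: "0 < c" and B: "0 < B" and L: "0 < L"
    using sound_pos[OF vp] slope_pos[OF vp] vp by (auto simp: c_def B_def L_def valid_params_def)
  have \<xi>: "0 < \<xi>" "\<xi> < 1" and CS: "0 < CS" and e2: "0 < \<epsilon>2" "\<epsilon>2 < \<epsilon>1"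
    using st by (auto simp: stability_property_def)
  have CE: "0 < CE" using ex by (simp add: existence_property_def)
  have T0: "0 < T0 p Psi" by (rule T0_pos[OF vp nb])
  have s0: "0 < \<sigma>" unfolding \<sigma>_def using \<xi> T0 by (simp add: divide_neg_pos)
  have g: "1 < gam p" using vp by (simp add: valid_params_def)
  \<comment> \<open>The second bound keeps the speeds of every solution considered here between 0
    and \<open>2 * c\<close>, by \<open>eB\<close>.\<close>
  define \<epsilon> where "\<epsilon> = min (\<epsilon>2 / 2) (c / (4 * B * (CE + 2 * CS)))"
  have \<epsilon>: "0 < \<epsilon>" "\<epsilon> < \<epsilon>2" using e2 c B CE CS by (auto simp: \<epsilon>_def)
  have eB: "2 * B * (CE * \<epsilon> + 2 * CS * \<epsilon>) \<le> c / 2"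
  proof -
    have "\<epsilon> \<le> c / (4 * B * (CE + 2 * CS))" unfolding \<epsilon>_def by (rule min.cobounded2)
    moreover have "0 < 4 * B * (CE + 2 * CS)" using B CE CS by simp
    ultimately have "\<epsilon> * (4 * B * (CE + 2 * CS)) \<le> c" by (simp only: pos_le_divide_eq)
    then show ?thesis by (simp add: algebra_simps)
  qed
  \<comment> \<open>The boundary values of the constant state are at most \<open>2 * \<eta>\<close>,
    hence at most \<open>\<epsilon>\<close>, and the state uses at most half of the size
    \<open>CE * \<epsilon>\<close> allowed for initial data. The other half, \<open>CB\<close>, is
    left for the perturbation.\<close>
  define \<eta> where "\<eta> = \<epsilon> * min (1 / 2) (CE / 2)"
  have eta: "0 < \<eta>" using \<epsilon> CE by (simp add: \<eta>_def)
  have eta1: "2 * \<eta> \<le> \<epsilon>"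
  proof -
    have "\<eta> \<le> \<epsilon> * (1 / 2)" unfolding \<eta>_def using \<epsilon> by (intro mult_left_mono) auto
    then show ?thesis by simp
  qed
  have eta2: "\<eta> \<le> CE * \<epsilon> / 2"
  proof -
    have "\<eta> \<le> \<epsilon> * (CE / 2)" unfolding \<eta>_def using \<epsilon> by (intro mult_left_mono) auto
    then show ?thesis by (simp add: mult.commute)
  qed
  \<comment> \<open>\<open>b0\<close> is the boundary value which makes the constant \<open>v\<close> a solution.\<close>
  define v :: "real ^ 2" where "v = (\<chi> i. - sg i * \<eta>)"
  define b0 :: "real ^ 2" where "b0 = (\<chi> i. - sg i * \<eta> * (1 + kap p i))"
  define b where "b = (\<lambda>_::real. b0)"
  define \<beta> where "\<beta> = (\<lambda>(_::real) (_::real). 0::real)"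
  have vabs: "\<bar>v $ i\<bar> = \<eta>" for i using eta by (simp add: v_def abs_mult)
  have k1: "\<bar>kap p i\<bar> \<le> 1" for i using kap_le_1[OF vp] .
  have babs: "\<bar>b0 $ i\<bar> \<le> \<epsilon>" for i
  proof -
    have "\<bar>b0 $ i\<bar> = \<eta> * \<bar>1 + kap p i\<bar>" using eta by (simp add: b0_def abs_mult)
    also have "\<dots> \<le> \<eta> * 2" using k1[of i] eta by (intro mult_left_mono) auto
    finally show ?thesis using eta1 by simp
  qed
  have damp: "damping p \<epsilon> \<beta>"
  proof -
    have Lp: "0 < len p" using L by (simp add: L_def)
    note z = C1_D_const_on[OF Lp, of \<beta> 0]
    have z0: "\<beta> t x = 0" for t x by (simp add: \<beta>_def)
    have "C1_D p (dt \<beta>)" by (rule C1_D_const_on(1)[OF Lp]) (use z z0 in auto)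
    moreover have "C1_D p (dx p \<beta>)" by (rule C1_D_const_on(1)[OF Lp]) (use z z0 in auto)
    ultimately show ?thesis
      using z z0 vp \<epsilon> unfolding damping_def C2_D_def by (auto simp: Dom_def valid_params_def)
  qed
  have bd: "bdry_data p \<epsilon> b"
    unfolding bdry_data_def C1_norm_I_le_iff b_def using babs \<epsilon>
    by (auto simp: C1_I_const d1_const)
  have sgv: "- sg i * \<eta> = - sg i * \<eta> * (1 + kap p i) + kap p i * (- sg (oth i) * \<eta>)" for i
    by (simp add: algebra_simps)
  have vb: "v $ i = b0 $ i + kap p i * v $ oth i" for i
    unfolding v_def b0_def using sgv[of i] by simp
  define CB where "CB = CE * \<epsilon> / 2"
  have CB: "0 < CB" using CE \<epsilon> by (simp add: CB_def)
  have "compact (bump 0 L ` {0..L} \<union> bump' 0 L ` {0..L})"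
    by (intro compact_Un compact_continuous_image bump_cont continuous_on_id compact_Icc)
  from compact_imp_bounded[OF this] obtain b1 where b1: "0 < b1"
    and bb: "\<forall>y\<in>bump 0 L ` {0..L} \<union> bump' 0 L ` {0..L}. norm y \<le> b1"
    unfolding bounded_pos by blast
  have bb': "\<bar>bump 0 L x\<bar> \<le> b1" "\<bar>bump' 0 L x\<bar> \<le> b1" if "x \<in> {0..L}" for x
    using bb that by auto
  define \<delta> where "\<delta> = CB / b1"
  have de: "0 < \<delta>" using CB b1 by (simp add: \<delta>_def)
  have db: "\<delta> * b1 = CB" using b1 by (simp add: \<delta>_def)
  have dB: "\<bar>\<delta> * bump 0 L x\<bar> \<le> CB" "\<bar>\<delta> * bump' 0 L x\<bar> \<le> CB" if "x \<in> {0..L}" for x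
  proof -
    have "\<delta> * \<bar>bump 0 L x\<bar> \<le> \<delta> * b1" "\<delta> * \<bar>bump' 0 L x\<bar> \<le> \<delta> * b1"
      using bb'[OF that] de by (auto intro!: mult_left_mono)
    then show "\<bar>\<delta> * bump 0 L x\<bar> \<le> CB" "\<bar>\<delta> * bump' 0 L x\<bar> \<le> CB"
      using db de by (simp_all add: abs_mult)
  qed
  \<comment> \<open>The bump vanishes together with its derivative at both ends, so the
    compatibility conditions reduce to those of the constant \<open>v\<close>.\<close>
  define \<phi>0 where "\<phi>0 = (\<lambda>x. v + (\<delta> * bump 0 L x) *\<^sub>R axis 1 1)"
  have d\<phi>0: "(\<phi>0 has_vector_derivative (\<delta> * bump' 0 L x) *\<^sub>R axis 1 1) (at x within S)" for x S
  proof -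
    have "((\<lambda>x. \<delta> * bump 0 L x) has_vector_derivative \<delta> * bump' 0 L x) (at x within S)"
      using DERIV_cmult[OF bump_deriv] by (simp add: has_real_derivative_iff_has_vector_derivative)
    from has_vector_derivative_add[OF has_vector_derivative_const
        bounded_linear.has_vector_derivative[OF bounded_linear_scaleR_left this]]
    show ?thesis by (simp add: \<phi>0_def)
  qed
  have d1\<phi>0: "d1 {0..L} \<phi>0 x = (\<delta> * bump' 0 L x) *\<^sub>R axis 1 1" if "x \<in> {0..L}" for x
    unfolding d1_def by (rule vector_derivative_within[OF at_within_Icc_neq_bot[OF L that] d\<phi>0])
  have init\<phi>0: "init_data p (CE * \<epsilon>) \<phi>0"
    unfolding init_data_def C1_norm_I_le_iff C1_I_def L_def[symmetric]
  proof (intro conjI allI ballI)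
    show "\<phi>0 differentiable_on {0..L}"
      using d\<phi>0 unfolding differentiable_on_def by (blast intro: differentiableI_vector)
    have "continuous_on {0..L} (\<lambda>x. (\<delta> * bump' 0 L x) *\<^sub>R (axis 1 1 :: real ^ 2))"
      by (intro continuous_intros)
    then show "continuous_on {0..L} (d1 {0..L} \<phi>0)"
      by (rule continuous_on_eq) (simp add: d1\<phi>0)
    fix i :: 2 and x assume x: "x \<in> {0..L}"
    have "\<bar>\<phi>0 x $ i\<bar> \<le> \<bar>v $ i\<bar> + \<bar>\<delta> * bump 0 L x\<bar>"
      unfolding \<phi>0_def by (auto simp: axis_def)
    then show "\<bar>\<phi>0 x $ i\<bar> \<le> CE * \<epsilon>" using vabs[of i] dB(1)[OF x] eta2 by (simp add: CB_def)
    have "\<bar>d1 {0..L} \<phi>0 x $ i\<bar> \<le> \<bar>\<delta> * bump' 0 L x\<bar>" by (simp add: d1\<phi>0[OF x] axis_def)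
    then show "\<bar>d1 {0..L} \<phi>0 x $ i\<bar> \<le> CE * \<epsilon>" using dB(2)[OF x] CB by (simp add: CB_def)
  qed
  have ends: "\<phi>0 0 = v" "\<phi>0 L = v" "d1 {0..L} \<phi>0 0 = 0" "d1 {0..L} \<phi>0 L = 0"
    using L d1\<phi>0[of 0] d1\<phi>0[of L] by (auto simp: \<phi>0_def bump_outside)
  have comp\<phi>0: "compatible p \<beta> b \<phi>0"
    unfolding compatible_def compat_q_def L_def[symmetric] ends using vb[of 1] vb[of 2]
    by (simp add: b_def \<beta>_def d1_const)
  have initv: "init_data p (CE * \<epsilon>) (\<lambda>_. v)"
    unfolding init_data_def C1_norm_I_le_iff using vabs eta eta2 CE \<epsilon> L
    by (auto simp: C1_I_const d1_const L_def)
  have compv: "compatible p \<beta> b (\<lambda>_. v)"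
    unfolding compatible_def compat_q_def using vb[of 1] vb[of 2] L
    by (simp add: b_def \<beta>_def d1_const L_def)
  have solv: "IBVP_sol p \<beta> b (\<lambda>_. v) (\<lambda>_ _. v)"
    unfolding IBVP_sol_def using vb[of 1] vb[of 2] L
    by (auto simp: C1_D_const_on[where a=v] b_def \<beta>_def L_def Dom_def)
  obtain \<phi> where sol: "IBVP_sol p \<beta> b \<phi>0 \<phi>"
    using st \<epsilon> damp bd init\<phi>0 comp\<phi>0 unfolding stability_property_def by blast
  note conv1 = stability_C0[OF st \<epsilon> damp bd init\<phi>0 comp\<phi>0 sol]
  note conv2 = stability_C0[OF st \<epsilon> damp bd initv compv solv]
  define w where "w = (\<lambda>i t x. \<phi> t x $ i - v $ i)"
  define wt where "wt = (\<lambda>i t x. dt \<phi> t x $ i - 0)"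
  define wx where "wx = (\<lambda>i t x. dx p \<phi> t x $ i - 0)"
  define lm where "lm = (\<lambda>i t x. lam p i (\<phi> t x + Phi p))"
  have C1w: "C1s L (w i) (wt i) (wx i)" for i
    unfolding w_def wt_def wx_def L_def
    by (intro C1s_diff C1s_const C1s_component IBVP_D(1)[OF sol])
  \<comment> \<open>The perturbed and the constant solution share the boundary data and so converge
    to the same periodic solution; the triangle inequality gives the factor 2.\<close>
  have wb: "\<bar>w i t x\<bar> \<le> 2 * CS * \<epsilon> * \<xi> ^ nat \<lfloor>t / T0 p Psi\<rfloor>" if "0 \<le> t" "x \<in> {0..L}" for i t x
  proof -
    have "\<bar>\<phi> t x $ i - per \<epsilon> \<beta> b t x $ i\<bar> \<le> CS * \<epsilon> * \<xi> ^ nat \<lfloor>t / T0 p Psi\<rfloor>"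
      "\<bar>v $ i - per \<epsilon> \<beta> b t x $ i\<bar> \<le> CS * \<epsilon> * \<xi> ^ nat \<lfloor>t / T0 p Psi\<rfloor>"
      using conv1 conv2 that unfolding C0_convergence_def sup_norm_le_iff L_def by auto
    then show ?thesis by (simp add: w_def)
  qed
  have wb1: "\<bar>w i t x\<bar> \<le> 2 * CS * \<epsilon>" if "0 \<le> t" "x \<in> {0..L}" for i t x
  proof -
    have "2 * CS * \<epsilon> * \<xi> ^ nat \<lfloor>t / T0 p Psi\<rfloor> \<le> 2 * CS * \<epsilon> * 1"
      using \<xi> CS \<epsilon> by (intro mult_left_mono power_le_one) auto
    then show ?thesis using wb[OF that, of i] by simp
  qed
  define C where "C = 2 * CS * \<epsilon> / \<xi>"
  have C0: "0 < C" using CS \<epsilon> \<xi> by (simp add: C_def)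
  have wb2: "\<bar>w i t x\<bar> \<le> C * exp (- \<sigma> * t)" if "0 \<le> t" "x \<in> {0..L}" for i t x
  proof -
    have "2 * CS * \<epsilon> * \<xi> ^ nat \<lfloor>t / T0 p Psi\<rfloor> \<le> 2 * CS * \<epsilon> * (exp (- \<sigma> * t) / \<xi>)"
      using pow_floor_bounds(2)[OF \<xi> T0 that(1)] CS \<epsilon> unfolding \<sigma>_def by (intro mult_left_mono) auto
    then show ?thesis using wb[OF that, of i] by (simp add: C_def)
  qed
  have lamv: "sg i * (sg i * c + lam p i v) = c - (gam p - 1) * \<eta>" for i
    using exhaust_2[of i] by (auto simp: v_def lam_def field_simps)
  have lmw: "\<bar>sg i * lm i t x - (c - (gam p - 1) * \<eta>)\<bar> \<le> 2 * B * r"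
    if "\<And>j. \<bar>w j t x\<bar> \<le> r" for i t x r
  proof -
    have "lm i t x = (sg i * c + lam p i v) + lam p i (\<phi> t x - v)"
      unfolding lm_def lam_Phi lam_diff c_def by simp
    then have "sg i * lm i t x - (c - (gam p - 1) * \<eta>) = sg i * lam p i (\<phi> t x - v)"
      using lamv[of i] by (simp add: distrib_left)
    moreover have "\<bar>lam p i (\<phi> t x - v)\<bar> \<le> 2 * B * r"
      unfolding B_def using that by (intro lam_bound_unif[OF vp]) (simp add: w_def)
    ultimately show ?thesis by (simp add: abs_mult)
  qed
  have ge: "0 < (gam p - 1) * \<eta>" using g eta by simp
  have ge2: "(gam p - 1) * \<eta> \<le> B * (CE * \<epsilon>)"
  proof -
    have "2 * B = gam p + 1 + \<bar>3 - gam p\<bar>" by (simp add: B_def slope_def field_simps)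
    then have "gam p - 1 \<le> 2 * B" by linarith
    then have "(gam p - 1) * \<eta> \<le> 2 * B * (CE * \<epsilon> / 2)" using eta2 eta B by (intro mult_mono) auto
    then show ?thesis by simp
  qed
  have spd: "0 \<le> sg i * lm i t x" "sg i * lm i t x \<le> 2 * c" if "0 \<le> t" "x \<in> {0..L}" for i t x
  proof -
    have "\<bar>sg i * lm i t x - (c - (gam p - 1) * \<eta>)\<bar> \<le> 2 * B * (2 * CS * \<epsilon>)"
      using lmw[OF wb1[OF that]] .
    moreover have "(gam p - 1) * \<eta> + 2 * B * (2 * CS * \<epsilon>) \<le> c"
      using ge2 eB c B CE \<epsilon> mult_pos_pos[OF B mult_pos_pos[OF CE \<epsilon>(1)]] unfolding distrib_left by linarith
    ultimately show "0 \<le> sg i * lm i t x" "sg i * lm i t x \<le> 2 * c" using c ge by linarith+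
  qed
  \<comment> \<open>Halfway between \<open>c\<close> and the limiting speed
    \<open>c - (gam p - 1) * \<eta>\<close>; the decay of \<open>w\<close> pushes all speeds below
    it from \<open>t1\<close> on.\<close>
  define c' where "c' = c - (gam p - 1) * \<eta> / 2"
  have c': "0 < c'" "c' < c"
  proof -
    have "0 < B * (CE * \<epsilon>)" "0 < B * (CS * \<epsilon>)" using B CE CS \<epsilon> by simp_all
    then have "B * (CE * \<epsilon>) < c" using eB c by (simp add: distrib_left)
    then show "0 < c'" "c' < c" using ge ge2 c unfolding c'_def by linarith+
  qed
  have "((\<lambda>t. 2 * B * (C * exp (- \<sigma> * t))) \<longlongrightarrow> 0) at_top"
    using s0 by real_asymp
  then have "\<forall>\<^sub>F t in at_top. 2 * B * (C * exp (- \<sigma> * t)) < (gam p - 1) * \<eta> / 2"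
    by (rule order_tendstoD(2)) (use ge in simp)
  then obtain t0 where t0: "\<And>t. t0 \<le> t \<Longrightarrow> 2 * B * (C * exp (- \<sigma> * t)) < (gam p - 1) * \<eta> / 2"
    by (auto simp: eventually_at_top_linorder)
  define t1 where "t1 = max 0 t0"
  have t1: "0 \<le> t1" by (simp add: t1_def)
  have slow: "sg i * lm i t x \<le> c'" if "t1 \<le> t" "x \<in> {0..L}" for i t x
  proof -
    have t: "0 \<le> t" "t0 \<le> t" using that by (auto simp: t1_def)
    have "\<bar>sg i * lm i t x - (c - (gam p - 1) * \<eta>)\<bar> \<le> 2 * B * (C * exp (- \<sigma> * t))"
      using lmw[OF wb2[OF t(1) that(2)]] .
    then show ?thesis using t0[OF t(2)] unfolding c'_def by linarith
  qed
  obtain \<alpha> K where al: "0 < \<alpha>" "c' * \<alpha> < \<sigma>" and K: "0 < K" "1 < K * \<bar>kap2 p\<bar>" "K < exp (2 * \<alpha> * L) * \<bar>kap1 p\<bar>"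
    using slow_weights_exist[OF c' L s0 ng] by blast
  define a where "a = (\<lambda>i::2. if i = 1 then 1 else K)"
  have a: "0 < a i" for i using K by (simp add: a_def)
  have two: "2 * \<alpha> * L = \<alpha> * L + \<alpha> * L" by simp
  have ka: "wgt \<alpha> a (oth i) (inflow L i) < wgt \<alpha> a i (inflow L i) * \<bar>kap p i\<bar>" for i
  proof (cases "i = 1")
    case True
    have "K * exp (- \<alpha> * L) < exp (\<alpha> * L) * \<bar>kap1 p\<bar>"
      using K(3) unfolding two exp_add by (simp add: exp_minus field_simps)
    then show ?thesis using True by (simp add: wgt_def a_def)
  next
    case False
    then have "i = 2" using exhaust_2[of i] by simp
    then show ?thesis using K by (simp add: wgt_def a_def)
  qed
  have pde: "wt i t x + lm i t x * wx i t x = 0" if "0 \<le> t" "x \<in> {0..L}" for i t x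
    using IBVP_D(2)[OF sol that[unfolded L_def], of i] by (simp add: wt_def wx_def lm_def \<beta>_def)
  have bdw: "\<bar>w i t (inflow L i)\<bar> = \<bar>kap p i\<bar> * \<bar>w (oth i) t (inflow L i)\<bar>" if "0 \<le> t" for i t
  proof -
    have "w i t (inflow L i) = kap p i * w (oth i) t (inflow L i)"
      using IBVP_D(4)[OF sol that, of i] vb[of i] by (simp add: w_def b_def L_def algebra_simps)
    then show ?thesis by (simp add: abs_mult)
  qed
  have half: "L / 2 \<in> {0..L}" using L by simp
  have "\<bar>w 1 0 (L / 2)\<bar> = \<delta> * bump 0 L (L / 2)"
    using IBVP_D(3)[OF sol, of "L / 2"] half de bump_nonneg[of 0 L "L / 2"] by (simp add: w_def \<phi>0_def L_def)
  also have "0 < \<dots>" using de bump_pos[of "L / 2" 0 L] L by simp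
  finally have w0: "0 < \<bar>w 1 0 (L / 2)\<bar>" .
  have wp: "0 < wgt \<alpha> a i x" for i x using wgt_pos[OF a] .
  \<comment> \<open>Up to \<open>t1\<close> only the crude bound \<open>2 * c\<close> on the speeds
    is known. The correspondingly crude rate serves a single purpose: to show that \<open>w\<close>
    has not vanished at \<open>t1\<close>.\<close>
  define N1 where "N1 = \<bar>w 1 0 (L / 2)\<bar> * (exp ((2 * c * \<alpha> + 1) * 0) * wgt \<alpha> a 1 (L / 2))"
  have N1: "0 < N1" using w0 wp by (simp add: N1_def)
  obtain i1 x1 where x1: "x1 \<in> {0..L}" "N1 \<le> \<bar>w i1 t1 x1\<bar> * (exp ((2 * c * \<alpha> + 1) * t1) * wgt \<alpha> a i1 x1)"
  proof (rule backward_growth[where \<alpha>=\<alpha> and k="kap p" and lam=lm and w=w and wt=wt and wx=wx and s=0 and T=t1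
        and N=N1 and \<sigma>="2 * c * \<alpha> + 1" and a=a, OF L a C1w order_refl t1 _ _ _ _ ka N1 half])
    show "0 \<le> sg i * lm i t x \<and> sg i * lm i t x * \<alpha> < 2 * c * \<alpha> + 1" if "0 \<le> t" "x \<in> {0..L}" for i t x
    proof -
      have "sg i * lm i t x * \<alpha> \<le> 2 * c * \<alpha>" using spd(2)[OF that, of i] al by (intro mult_right_mono) auto
      then show ?thesis using spd(1)[OF that, of i] by simp
    qed
  qed (use al pde bdw in \<open>auto simp: N1_def\<close>)
  \<comment> \<open>From \<open>t1\<close> on, \<open>w\<close> cannot decay faster than
    \<open>exp (- \<sigma>' * t)\<close>, while (S) forces decay at the larger rate
    \<open>\<sigma>\<close>.\<close>
  obtain \<sigma>' where s': "c' * \<alpha> < \<sigma>'" "\<sigma>' < \<sigma>" using dense[OF al(2)] by blast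
  define N where "N = \<bar>w i1 t1 x1\<bar> * (exp (\<sigma>' * t1) * wgt \<alpha> a i1 x1)"
  have "\<bar>w i1 t1 x1\<bar> \<noteq> 0" using x1(2) N1 by auto
  then have N: "0 < N" using wp by (simp add: N_def)
  define A where "A = exp (\<alpha> * L) + K"
  have A: "wgt \<alpha> a i x \<le> A" if "x \<in> {0..L}" for i x
  proof -
    have "exp (\<alpha> * x) \<le> exp (\<alpha> * L)" using that al by simp
    moreover have "K * exp (- \<alpha> * x) \<le> K" using that al K by simp
    moreover have "wgt \<alpha> a 1 x = exp (\<alpha> * x)" "wgt \<alpha> a 2 x = K * exp (- \<alpha> * x)"
      by (simp_all add: wgt_def a_def)
    moreover have "0 < exp (\<alpha> * L)" by simp
    ultimately have "wgt \<alpha> a 1 x \<le> A" "wgt \<alpha> a 2 x \<le> A" using K(1) unfolding A_def by linarith+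
    then show ?thesis using exhaust_2[of i] by auto
  qed
  have low: "N \<le> C * A * exp (- (\<sigma> - \<sigma>') * T)" if T: "t1 \<le> T" for T
  proof -
    have T0': "0 \<le> T" using T t1 by simp
    obtain i x where ix: "x \<in> {0..L}" "N \<le> \<bar>w i T x\<bar> * (exp (\<sigma>' * T) * wgt \<alpha> a i x)"
    proof (rule backward_growth[where \<alpha>=\<alpha> and k="kap p" and lam=lm and w=w and wt=wt and wx=wx and s=t1 and T=T
          and N=N and \<sigma>=\<sigma>' and a=a, OF L a C1w t1 T _ _ _ _ ka N x1(1)])
      show "0 \<le> sg i * lm i t x \<and> sg i * lm i t x * \<alpha> < \<sigma>'" if "t1 \<le> t" "x \<in> {0..L}" for i t x
      proof -
        have "sg i * lm i t x * \<alpha> \<le> c' * \<alpha>" using slow[OF that, of i] al by (intro mult_right_mono) auto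
        then show ?thesis using spd(1)[of t x i] that t1 s' by auto
      qed
    qed (use al pde bdw t1 in \<open>auto simp: N_def\<close>)
    note ix(2)
    also have "\<bar>w i T x\<bar> * (exp (\<sigma>' * T) * wgt \<alpha> a i x) \<le> (C * exp (- \<sigma> * T)) * (exp (\<sigma>' * T) * A)"
      using wb2[OF T0' ix(1), of i] A[OF ix(1), of i] wp[of i x] C0
      by (intro mult_mono) (auto intro: mult_nonneg_nonneg less_imp_le)
    also have "\<dots> = C * A * exp (- (\<sigma> - \<sigma>') * T)"
      by (simp add: algebra_simps flip: exp_add)
    finally show ?thesis .
  qed
  have "((\<lambda>t. C * A * exp (- (\<sigma> - \<sigma>') * t)) \<longlongrightarrow> 0) at_top"
  proof -
    have "0 < \<sigma> - \<sigma>'" using s' by simp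
    then show ?thesis by real_asymp
  qed
  then have "\<forall>\<^sub>F t in at_top. C * A * exp (- (\<sigma> - \<sigma>') * t) < N"
    by (rule order_tendstoD(2)) (rule N)
  then obtain t2 where "\<And>t. t2 \<le> t \<Longrightarrow> C * A * exp (- (\<sigma> - \<sigma>') * t) < N"
    by (auto simp: eventually_at_top_linorder)
  from this[of "max t1 t2"] low[of "max t1 t2"] show False by simp
qed

section \<open>Convergence of the first derivatives\<close>

lemma damping_D:
  assumes "damping p \<epsilon> \<beta>"
  shows "C1s (len p) \<beta> (dt \<beta>) (dx p \<beta>)"
    and "0 \<le> t \<Longrightarrow> x \<in> {0..len p} \<Longrightarrow>
      - (- beta_lo p) \<le> \<beta> t x \<and> \<beta> t x \<le> 0 \<and> \<bar>dt \<beta> t x\<bar> \<le> \<epsilon> \<and> \<bar>dx p \<beta> t x\<bar> \<le> \<epsilon>"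
  using assms C1s_real[of p \<beta>] unfolding damping_def C2_D_def Dom_def by auto

lemma half_sum_bound:
  fixes \<beta> u v r b0 :: real
  assumes "\<bar>\<beta>\<bar> \<le> b0" "\<bar>u\<bar> \<le> r" "\<bar>v\<bar> \<le> r"
  shows "\<bar>\<beta> / 2 * (u + v)\<bar> \<le> b0 * r"
proof -
  have "\<bar>\<beta> / 2 * (u + v)\<bar> = \<bar>\<beta>\<bar> * (\<bar>u + v\<bar> / 2)" by (simp add: abs_mult)
  also have "\<dots> \<le> b0 * r" using assms by (intro mult_mono) auto
  finally show ?thesis .
qed

lemma speed_bounds:
  assumes vp: "valid_params p" and v: "\<And>j. \<bar>v $ j\<bar> \<le> r" and r: "2 * slope p * r \<le> \<theta>" "\<theta> \<le> sound p / 2"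
  shows "\<bar>lam p i (v + Phi p) - sg i * sound p\<bar> \<le> \<theta>"
    "sound p / 2 \<le> \<bar>lam p i (v + Phi p)\<bar>" "\<bar>lam p i (v + Phi p)\<bar> \<le> 2 * sound p"
proof -
  have *: "\<bar>lam p i v\<bar> \<le> \<theta>" using lam_bound_unif[OF vp v, of i] r(1) by linarith
  then show "\<bar>lam p i (v + Phi p) - sg i * sound p\<bar> \<le> \<theta>" by (simp add: lam_Phi)
  show "sound p / 2 \<le> \<bar>lam p i (v + Phi p)\<bar>" "\<bar>lam p i (v + Phi p)\<bar> \<le> 2 * sound p"
    using * r(2) sound_pos[OF vp] exhaust_2[of i] by (auto simp: lam_Phi)
qed

text \<open>A continuation argument: up to the first time at which \<open>dt \<phi>\<close> reaches
  \<open>K1 * \<epsilon>\<close>, the speeds vary slowly enough for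
  \<open>transport_pair_dt_bound\<close>, used with \<open>\<phi>\<close> itself, rate 0 and no
  source; its conclusion is strictly better than \<open>K1 * \<epsilon>\<close>. At rate 0 the gap
  is just \<open>\<bar>kap1 p * kap2 p\<bar> < 1\<close>.\<close>

lemma time_derivative_bound:
  assumes vp: "valid_params p" and CE: "0 < CE" and M0: "0 < M0"
  obtains \<delta> K1 :: real where "0 < \<delta>" "0 < K1"
    "\<And>\<epsilon> \<beta> b \<phi>0 \<phi> i t x. \<lbrakk>0 < \<epsilon>; \<epsilon> < \<delta>; damping p \<epsilon> \<beta>; bdry_data p \<epsilon> b; init_data p (CE * \<epsilon>) \<phi>0;
       IBVP_sol p \<beta> b \<phi>0 \<phi>; \<And>i t x. 0 \<le> t \<Longrightarrow> x \<in> {0..len p} \<Longrightarrow> \<bar>\<phi> t x $ i\<bar> \<le> M0 * \<epsilon>;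
       0 \<le> t; x \<in> {0..len p}\<rbrakk> \<Longrightarrow> \<bar>dt \<phi> t x $ i\<bar> \<le> K1 * \<epsilon>"
proof -
  define L where "L = len p"
  define c where "c = sound p"
  define b0 where "b0 = - beta_lo p"
  define B where "B = slope p"
  have c: "0 < c" and B: "0 < B" and L: "0 < L" and b0: "0 < b0"
    using sound_pos[OF vp] slope_pos[OF vp] vp by (auto simp: c_def B_def L_def b0_def valid_params_def)
  have gap: "\<bar>kap p 1 * kap p 2\<bar> * exp (2 * 0 * L / c) < 1"
    using vp abs_mult_less[of "kap1 p" 1 "kap2 p" 1] by (simp add: abs_mult valid_params_def)
  obtain \<theta> C :: real where \<theta>: "0 < \<theta>" and C: "0 < C" and ap:
    "\<And>T J \<beta> \<beta>t \<beta>x lam lamt lamx w wt wx S i t x.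
      \<lbrakk>transport_pair L c b0 0 (kap p) \<theta> T J \<beta> \<beta>t \<beta>x lam lamt lamx w wt wx S; 0 \<le> t; t \<le> T; x \<in> {0..L}\<rbrakk>
      \<Longrightarrow> \<bar>wt i t x\<bar> \<le> C * J * exp (- 0 * t)"
    by (rule transport_pair_dt_bound[OF c L less_imp_le[OF b0] order_refl[of 0] kap_le_1[OF vp] gap]) blast
  \<comment> \<open>\<open>M0\<close> bounds the solution, 1 the derivative of the boundary data,
    and the bracket the initial time derivative as given by the equation, all in units of
    \<open>\<epsilon>\<close>.\<close>
  define J0 where "J0 = M0 + 1 + (b0 * CE + 2 * c * CE)"
  have J0: "0 < J0" unfolding J0_def using M0 b0 CE c by (intro add_pos_pos mult_pos_pos) auto
  \<comment> \<open>Exceeds both the initial size \<open>J0\<close> and the outcome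
    \<open>C * J0\<close> of the estimate.\<close>
  define K1 where "K1 = (2 * C + 2) * J0"
  have K1: "0 < K1" unfolding K1_def using C J0 by simp
  define \<theta>' where "\<theta>' = min \<theta> (c / 2)"
  have \<theta>': "0 < \<theta>'" "\<theta>' \<le> \<theta>" "\<theta>' \<le> c / 2" using \<theta> c by (auto simp: \<theta>'_def)
  \<comment> \<open>Makes \<open>2 * B * (K1 * \<epsilon>)\<close> at most \<open>\<theta>'\<close>:
    the bound to be improved already guarantees slow variation of the speeds.\<close>
  define \<delta> where "\<delta> = min 1 (\<theta>' / (2 * B * (M0 + CE + K1)))"
  have den: "0 < 2 * B * (M0 + CE + K1)" using B M0 CE K1 by simp
  have de: "0 < \<delta>" using \<theta>' den by (simp add: \<delta>_def)
  show thesis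
  proof (rule that[OF de K1])
    fix \<epsilon> \<beta> b \<phi>0 \<phi> i and t x :: real
    assume \<epsilon>: "0 < \<epsilon>" "\<epsilon> < \<delta>" and damp: "damping p \<epsilon> \<beta>" and bd: "bdry_data p \<epsilon> b"
      and init: "init_data p (CE * \<epsilon>) \<phi>0" and sol: "IBVP_sol p \<beta> b \<phi>0 \<phi>"
      and M: "\<And>i t x. 0 \<le> t \<Longrightarrow> x \<in> {0..len p} \<Longrightarrow> \<bar>\<phi> t x $ i\<bar> \<le> M0 * \<epsilon>"
      and t: "0 \<le> t" and x: "x \<in> {0..len p}"
    have \<epsilon>1: "\<epsilon> \<le> 1" using \<epsilon> by (simp add: \<delta>_def)
    have "\<epsilon> \<le> \<theta>' / (2 * B * (M0 + CE + K1))" using \<epsilon>(2) by (simp add: \<delta>_def)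
    then have "\<epsilon> * (2 * B * (M0 + CE + K1)) \<le> \<theta>'" using den by (simp only: pos_le_divide_eq)
    then have sm: "2 * B * (M0 * \<epsilon>) + 2 * B * (CE * \<epsilon>) + 2 * B * (K1 * \<epsilon>) \<le> \<theta>'" by (simp add: algebra_simps)
    have nn: "0 \<le> 2 * B * (M0 * \<epsilon>)" "0 \<le> 2 * B * (CE * \<epsilon>)" "0 \<le> 2 * B * (K1 * \<epsilon>)"
      using B M0 CE K1 \<epsilon> by simp_all
    note C1 = IBVP_D(1)[OF sol]
    have smM: "2 * slope p * (M0 * \<epsilon>) \<le> \<theta>'" "\<theta>' \<le> sound p / 2"
      using sm nn \<theta>' unfolding B_def c_def by linarith+
    note spd = speed_bounds[OF vp M smM, unfolded L_def[symmetric] c_def[symmetric]]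
    have bb: "\<bar>\<beta> t x\<bar> \<le> b0" if "0 \<le> t" "x \<in> {0..L}" for t x
      using damping_D(2)[OF damp] that unfolding b0_def L_def by fastforce
    have dphi0: "\<bar>dx p \<phi> 0 x $ i\<bar> \<le> CE * \<epsilon>" if "x \<in> {0..L}" for i x
      using init initial_dx[OF sol] that unfolding init_data_def C1_norm_I_le_iff L_def by auto
    have phi0: "\<bar>\<phi> 0 x $ i\<bar> \<le> CE * \<epsilon>" if "x \<in> {0..L}" for i x
      using init IBVP_D(3)[OF sol] that unfolding init_data_def C1_norm_I_le_iff L_def by auto
    have i0: "\<bar>dt \<phi> 0 x $ i\<bar> \<le> J0 * \<epsilon>" if x: "x \<in> {0..L}" for i x
    proof -
      have "dt \<phi> 0 x $ i = \<beta> 0 x / 2 * (\<phi> 0 x $ 1 + \<phi> 0 x $ 2) - lam p i (\<phi> 0 x + Phi p) * dx p \<phi> 0 x $ i"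
        using IBVP_D(2)[OF sol order_refl, of x i] x by (simp add: L_def)
      moreover have "\<bar>\<beta> 0 x / 2 * (\<phi> 0 x $ 1 + \<phi> 0 x $ 2)\<bar> \<le> b0 * (CE * \<epsilon>)"
        by (rule half_sum_bound) (use bb phi0 x in auto)
      moreover have "\<bar>lam p i (\<phi> 0 x + Phi p) * dx p \<phi> 0 x $ i\<bar> \<le> 2 * c * (CE * \<epsilon>)"
        unfolding abs_mult using spd(3)[OF order_refl x] dphi0[OF x] c by (intro mult_mono) auto
      ultimately have "\<bar>dt \<phi> 0 x $ i\<bar> \<le> (b0 * CE + 2 * c * CE) * \<epsilon>"
        by (simp add: algebra_simps)
      also have "\<dots> \<le> J0 * \<epsilon>" unfolding J0_def using M0 \<epsilon> by (intro mult_right_mono) auto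
      finally show ?thesis .
    qed
    show "\<bar>dt \<phi> t x $ i\<bar> \<le> K1 * \<epsilon>"
    proof (rule ccontr)
      assume "\<not> ?thesis"
      then have ge: "K1 * \<epsilon> \<le> \<bar>dt \<phi> t x $ i\<bar>" by simp
      have cont: "continuous_on ({0..t} \<times> {0..L}) (\<lambda>(t, x). \<bar>dt \<phi> t x $ i\<bar>)" for i
      proof -
        have "continuous_on ({0..t} \<times> {0..L}) (\<lambda>(t, x). dt \<phi> t x $ i)"
          by (rule continuous_on_subset[OF C1s_cont(2)[OF C1s_component[OF C1, of i]]]) (auto simp: L_def)
        then show ?thesis by (auto intro!: continuous_intros simp: case_prod_unfold)
      qed
      have lt0: "\<bar>dt \<phi> 0 x $ i\<bar> < K1 * \<epsilon>" if "x \<in> {0..L}" for i x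
      proof -
        have "J0 * \<epsilon> < K1 * \<epsilon>"
          unfolding K1_def using C J0 \<epsilon> by (intro mult_strict_right_mono) (auto simp: algebra_simps add_pos_pos)
        then show ?thesis using i0[OF that, of i] by linarith
      qed
      have "t \<in> {0..t}" using t by simp
      from first_touch[where f="\<lambda>i t x. \<bar>dt \<phi> t x $ i\<bar>", OF cont lt0 this x[folded L_def] ge] obtain j s y where
        s: "0 < s" "y \<in> {0..L}" and eq: "\<bar>dt \<phi> s y $ j\<bar> = K1 * \<epsilon>"
        and le: "\<And>k r z. 0 \<le> r \<Longrightarrow> r \<le> s \<Longrightarrow> z \<in> {0..L} \<Longrightarrow> \<bar>dt \<phi> r z $ k\<bar> \<le> K1 * \<epsilon>"
        by metis
      have "\<bar>dt \<phi> s y $ j\<bar> \<le> C * (J0 * \<epsilon>) * exp (- 0 * s)"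
      proof (rule ap[where T=s and t=s and i=j and x=y and wt="\<lambda>i t x. dt \<phi> t x $ i"])
        show "transport_pair L c b0 0 (kap p) \<theta> s (J0 * \<epsilon>) \<beta> (dt \<beta>) (dx p \<beta>) (\<lambda>i t x. lam p i (\<phi> t x + Phi p))
          (\<lambda>i t x. lam p i (dt \<phi> t x)) (\<lambda>i t x. lam p i (dx p \<phi> t x))
          (\<lambda>i t x. \<phi> t x $ i) (\<lambda>i t x. dt \<phi> t x $ i) (\<lambda>i t x. dx p \<phi> t x $ i) (\<lambda>_ _ _. 0)"
        proof
          show "0 < J0 * \<epsilon>" using J0 \<epsilon> by simp
          show "C1s L \<beta> (dt \<beta>) (dx p \<beta>)" using damping_D(1)[OF damp] by (simp add: L_def)
          show "C1s L (\<lambda>t x. lam p i (\<phi> t x + Phi p)) (\<lambda>t x. lam p i (dt \<phi> t x)) (\<lambda>t x. lam p i (dx p \<phi> t x))" for i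
            unfolding L_def by (rule C1s_lam[OF C1])
          show "C1s L (\<lambda>t x. \<phi> t x $ i) (\<lambda>t x. dt \<phi> t x $ i) (\<lambda>t x. dx p \<phi> t x $ i)" for i
            unfolding L_def by (rule C1s_component[OF C1])
          show "- b0 \<le> \<beta> t x \<and> \<beta> t x \<le> 0 \<and> \<bar>dt \<beta> t x\<bar> \<le> 1 \<and> \<bar>dx p \<beta> t x\<bar> \<le> 1" if "0 \<le> t" "x \<in> {0..L}" for t x
            using damping_D(2)[OF damp that(1) that(2)[unfolded L_def]] \<epsilon>1 by (simp add: b0_def)
          show "\<bar>lam p i (\<phi> t x + Phi p) - sg i * c\<bar> \<le> \<theta>" if "0 \<le> t" "x \<in> {0..L}" for i t x
            using spd(1)[OF that, of i] \<theta>' by linarith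
          show "\<bar>lam p i (dt \<phi> t x)\<bar> \<le> \<theta>" if "0 \<le> t" "t \<le> s" "x \<in> {0..L}" for i t x
            using lam_bound_unif[OF vp le[OF that], of i] sm nn \<theta>' unfolding B_def by linarith
          show "dt \<phi> t x $ i + lam p i (\<phi> t x + Phi p) * dx p \<phi> t x $ i
              = \<beta> t x / 2 * (\<phi> t x $ 1 + \<phi> t x $ 2) - 0" if "0 \<le> t" "x \<in> {0..L}" for i t x
            using IBVP_D(2)[OF sol that[unfolded L_def], of i] by simp
          have MJ: "M0 * \<epsilon> \<le> J0 * \<epsilon>" "\<epsilon> \<le> J0 * \<epsilon>"
          proof -
            have "0 \<le> b0 * CE + 2 * c * CE" using b0 CE c by simp
            then have "M0 \<le> J0" "1 \<le> J0" using M0 unfolding J0_def by linarith+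
            then show "M0 * \<epsilon> \<le> J0 * \<epsilon>" "\<epsilon> \<le> J0 * \<epsilon>" using \<epsilon> by simp_all
          qed
          show "\<bar>\<phi> t x $ i\<bar> \<le> J0 * \<epsilon> * exp (- 0 * t)" if "0 \<le> t" "x \<in> {0..L}" for i t x
            using M[OF that[unfolded L_def], of i] MJ by simp
          show "\<bar>0\<bar> \<le> J0 * \<epsilon> * exp (- 0 * t)" for t :: real using J0 \<epsilon> by simp
          show "\<forall>\<^sub>F h in at_right 0. \<forall>t\<in>{0..s}. \<forall>x\<in>{0..L}. \<bar>(0 - 0) / h\<bar>
              \<le> J0 * \<epsilon> * exp (- 0 * t) + \<theta> * (\<bar>dt \<phi> t x $ 1\<bar> + \<bar>dt \<phi> t x $ 2\<bar>) + e" if "0 < e" for e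
            using J0 \<epsilon> \<theta> that by (intro always_eventually) (auto intro!: add_nonneg_nonneg)
          show "\<bar>dt \<phi> t (inflow L i) $ i - kap p i * dt \<phi> t (inflow L i) $ oth i\<bar> \<le> J0 * \<epsilon> * exp (- 0 * t)"
            if "0 \<le> t" "t \<le> s" for i t
          proof -
            have "C1_I {0..} b" "\<bar>d1 {0..} b t $ i\<bar> \<le> \<epsilon>"
              using bd that unfolding bdry_data_def C1_norm_I_le_iff by auto
            then show ?thesis using inflow_dt[OF sol _ _ that(1), of i] L MJ by (simp add: L_def)
          qed
          show "\<bar>dt \<phi> 0 x $ i\<bar> \<le> J0 * \<epsilon>" if "x \<in> {0..L}" for i x using i0[OF that] .
        qed
      qed (use s in auto)
      also have "\<dots> < K1 * \<epsilon>"
        unfolding K1_def using C J0 \<epsilon> by (simp add: algebra_simps add_pos_pos)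
      finally show False using eq by simp
    qed
  qed
qed

theorem theorem2p4:
  fixes p :: params and Psi :: "(real ^ 2) set" and per :: periodic_solutions
    and A0 \<epsilon>1 CE \<epsilon>2 CS \<xi> M2 \<epsilon>4 :: real
    and CR :: "(real \<Rightarrow> real \<Rightarrow> real) \<Rightarrow> real"
  assumes "valid_params p"
    and "valid_nbhd p Psi A0"
    and "existence_property p per \<epsilon>1 CE"
    and "stability_property p Psi per \<epsilon>1 CE \<epsilon>2 CS \<xi>"
    and "regularity_property p A0 per \<epsilon>1 M2 CR \<epsilon>4"
  shows "\<exists>(CS' :: (real \<Rightarrow> real \<Rightarrow> real) \<Rightarrow> real) \<epsilon>5.
     (\<forall>\<beta>. 0 < CS' \<beta>) \<and> 0 < \<epsilon>5 \<and> \<epsilon>5 < min \<epsilon>2 \<epsilon>4 \<and>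
     (\<forall>\<epsilon> \<beta> b \<phi>0 \<phi>.
        0 < \<epsilon> \<and> \<epsilon> < \<epsilon>5 \<and> damping p \<epsilon> \<beta> \<and> bdry_data p \<epsilon> b \<and> W2inf_bdry b M2 \<and>
        init_data p (CE * \<epsilon>) \<phi>0 \<and> compatible p \<beta> b \<phi>0 \<and> IBVP_sol p \<beta> b \<phi>0 \<phi> \<longrightarrow>
        C0_convergence p Psi (CS * \<epsilon>) \<xi> \<phi> (per \<epsilon> \<beta> b) \<and>
        C1_convergence p Psi (A0 * CS' \<beta> * \<epsilon>) \<xi> \<phi> (per \<epsilon> \<beta> b))"
proof -
  note vp = assms(1) and nb = assms(2) and ex = assms(3) and st = assms(4) and reg = assms(5)
  define L where "L = len p"
  define c where "c = sound p"
  define b0 where "b0 = - beta_lo p"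
  define B where "B = slope p"
  define \<sigma> where "\<sigma> = - ln \<xi> / T0 p Psi"
  define MR where "MR = (\<lambda>\<beta>. (1 + A0)\<^sup>2 * CR \<beta>)"
  have c: "0 < c" and B: "0 < B" and L: "0 < L" and b0: "0 < b0"
    using sound_pos[OF vp] slope_pos[OF vp] vp by (auto simp: c_def B_def L_def b0_def valid_params_def)
  have \<xi>: "0 < \<xi>" "\<xi> < 1" and CS: "0 < CS" and e2: "0 < \<epsilon>2" "\<epsilon>2 < \<epsilon>1"
    using st by (auto simp: stability_property_def)
  have e4: "0 < \<epsilon>4" and CR: "0 < CR \<beta>" for \<beta> using reg by (auto simp: regularity_property_def)
  have CE: "0 < CE" using ex by (simp add: existence_property_def)
  have A0: "0 < A0" using nb by (simp add: valid_nbhd_def)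
  have T0: "0 < T0 p Psi" by (rule T0_pos[OF vp nb])
  have s0: "0 \<le> \<sigma>" unfolding \<sigma>_def using \<xi> T0 by (simp add: divide_nonpos_pos)
  have MR0: "0 < MR \<beta>" for \<beta> using CR A0 by (simp add: MR_def)
  have gap: "\<bar>kap p 1 * kap p 2\<bar> * exp (2 * \<sigma> * L / c) < 1"
    using rate_gap[OF vp nb ex st] by (simp add: \<sigma>_def L_def c_def)
  obtain \<theta> C :: real where \<theta>: "0 < \<theta>" and C: "0 < C" and ap:
    "\<And>T J \<beta> \<beta>t \<beta>x lam lamt lamx w wt wx S i t x.
      \<lbrakk>transport_pair L c b0 \<sigma> (kap p) \<theta> T J \<beta> \<beta>t \<beta>x lam lamt lamx w wt wx S; 0 \<le> t; t \<le> T; x \<in> {0..L}\<rbrakk>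
      \<Longrightarrow> \<bar>wt i t x\<bar> \<le> C * J * exp (- \<sigma> * t)"
    by (rule transport_pair_dt_bound[OF c L less_imp_le[OF b0] s0 kap_le_1[OF vp] gap]) blast
  \<comment> \<open>By (S), \<open>\<phi>\<close> stays within \<open>CS * \<epsilon>\<close> of a
    periodic solution of size \<open>CE * \<epsilon>\<close>.\<close>
  define M0 where "M0 = CE + CS"
  have M0: "0 < M0" using CE CS by (simp add: M0_def)
  obtain \<delta> K1 where de: "0 < \<delta>" and K1: "0 < K1" and dtb:
    "\<And>\<epsilon> \<beta> b \<phi>0 \<phi> i t x. \<lbrakk>0 < \<epsilon>; \<epsilon> < \<delta>; damping p \<epsilon> \<beta>; bdry_data p \<epsilon> b; init_data p (CE * \<epsilon>) \<phi>0;
       IBVP_sol p \<beta> b \<phi>0 \<phi>; \<And>i t x. 0 \<le> t \<Longrightarrow> x \<in> {0..len p} \<Longrightarrow> \<bar>\<phi> t x $ i\<bar> \<le> M0 * \<epsilon>;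
       0 \<le> t; x \<in> {0..len p}\<rbrakk> \<Longrightarrow> \<bar>dt \<phi> t x $ i\<bar> \<le> K1 * \<epsilon>"
    by (rule time_derivative_bound[OF vp CE M0]) blast
  define \<theta>' where "\<theta>' = min \<theta> (c / 2)"
  have \<theta>': "0 < \<theta>'" "\<theta>' \<le> \<theta>" "\<theta>' \<le> c / 2" using \<theta> c by (auto simp: \<theta>'_def)
  have den: "0 < 2 * B * (M0 + CE + K1)" using B M0 CE K1 by simp
  \<comment> \<open>The quotient keeps the deviation of the speeds, their time variation and the
    factor \<open>dx p \<psi>\<close> of the source below the threshold \<open>\<theta>\<close>;
    halving \<open>min \<epsilon>2 \<epsilon>4\<close> gives strictness.\<close>
  define \<epsilon>5 where "\<epsilon>5 = min (min 1 \<delta>) (min (\<theta>' / (2 * B * (M0 + CE + K1))) (min \<epsilon>2 \<epsilon>4 / 2))"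
  \<comment> \<open>The summands bound, in this order, the difference \<open>w\<close>, the source,
    the part of the source increments due to the increments of \<open>dx p \<psi>\<close>, and the
    initial value of \<open>wt\<close>. The damping coefficient enters only through
    \<open>MR\<close>.\<close>
  define J0 where "J0 = (\<lambda>\<beta>. CS / \<xi> + 2 * B * (CS / \<xi>) * CE + 2 * B * (CS / \<xi>) * MR \<beta> + (K1 + CE))"
  have J0: "0 < J0 \<beta>" "CS / \<xi> \<le> J0 \<beta>" "2 * B * (CS / \<xi>) * CE \<le> J0 \<beta>"
    "2 * B * (CS / \<xi>) * MR \<beta> \<le> J0 \<beta>" "K1 + CE \<le> J0 \<beta>" for \<beta>
  proof -
    have "0 < CS / \<xi>" "0 < 2 * B * (CS / \<xi>) * CE" "0 < 2 * B * (CS / \<xi>) * MR \<beta>" "0 < K1 + CE"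
      using CS \<xi> B CE MR0[of \<beta>] K1 by simp_all
    then show "0 < J0 \<beta>" "CS / \<xi> \<le> J0 \<beta>" "2 * B * (CS / \<xi>) * CE \<le> J0 \<beta>"
      "2 * B * (CS / \<xi>) * MR \<beta> \<le> J0 \<beta>" "K1 + CE \<le> J0 \<beta>" unfolding J0_def by linarith+
  qed
  \<comment> \<open>Solving the equation for \<open>wx\<close> divides by a speed of modulus at
    least \<open>c / 2\<close>.\<close>
  define CX where "CX = 2 / c * (b0 + 1 + C)"
  have CX: "0 < CX" using c b0 C by (simp add: CX_def)
  define CS' where "CS' = (\<lambda>\<beta>. (C + CX) * J0 \<beta> / A0)"
  have A0CS: "A0 * CS' \<beta> = (C + CX) * J0 \<beta>" for \<beta> using A0 by (simp add: CS'_def)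
  show ?thesis
  proof (intro exI[of _ CS'] exI[of _ \<epsilon>5] conjI allI impI)
    show "0 < CS' \<beta>" for \<beta> using C CX J0 A0 by (simp add: CS'_def)
    show "0 < \<epsilon>5" using de \<theta>' den e2 e4 by (simp add: \<epsilon>5_def)
    show "\<epsilon>5 < min \<epsilon>2 \<epsilon>4"
    proof -
      have "\<epsilon>5 \<le> min \<epsilon>2 \<epsilon>4 / 2" unfolding \<epsilon>5_def by (intro min.coboundedI2 min.cobounded2)
      moreover have "0 < min \<epsilon>2 \<epsilon>4" using e2 e4 by simp
      ultimately show ?thesis by linarith
    qed
    then have e5: "\<epsilon>5 < \<epsilon>2" "\<epsilon>5 < \<epsilon>4" by simp_all
    fix \<epsilon> \<beta> b \<phi>0 \<phi>
    assume H: "0 < \<epsilon> \<and> \<epsilon> < \<epsilon>5 \<and> damping p \<epsilon> \<beta> \<and> bdry_data p \<epsilon> b \<and> W2inf_bdry b M2 \<and>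
        init_data p (CE * \<epsilon>) \<phi>0 \<and> compatible p \<beta> b \<phi>0 \<and> IBVP_sol p \<beta> b \<phi>0 \<phi>"
    then have \<epsilon>: "0 < \<epsilon>" "\<epsilon> < \<epsilon>2" "\<epsilon> < \<epsilon>4" "\<epsilon> < \<epsilon>1" "\<epsilon> < \<epsilon>5" and damp: "damping p \<epsilon> \<beta>" and bd: "bdry_data p \<epsilon> b"
      and W2: "W2inf_bdry b M2" and init: "init_data p (CE * \<epsilon>) \<phi>0" and comp: "compatible p \<beta> b \<phi>0"
      and sol: "IBVP_sol p \<beta> b \<phi>0 \<phi>"
      using e5 e2 by auto
    have \<epsilon>d: "\<epsilon> < \<delta>" "\<epsilon> \<le> 1" using \<epsilon>(5) by (auto simp: \<epsilon>5_def)
    have "\<epsilon> \<le> \<theta>' / (2 * B * (M0 + CE + K1))" using \<epsilon>(5) by (simp add: \<epsilon>5_def)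
    then have "\<epsilon> * (2 * B * (M0 + CE + K1)) \<le> \<theta>'" using den by (simp only: pos_le_divide_eq)
    then have sm: "2 * B * (M0 * \<epsilon>) + 2 * B * (CE * \<epsilon>) + 2 * B * (K1 * \<epsilon>) \<le> \<theta>'" by (simp add: algebra_simps)
    have nn: "0 \<le> 2 * B * (M0 * \<epsilon>)" "0 \<le> 2 * B * (CE * \<epsilon>)" "0 \<le> 2 * B * (K1 * \<epsilon>)"
      using B M0 CE K1 \<epsilon> by simp_all
    have conv: "C0_convergence p Psi (CS * \<epsilon>) \<xi> \<phi> (per \<epsilon> \<beta> b)"
      by (rule stability_C0[OF st \<epsilon>(1,2) damp bd init comp sol])
    then show "C0_convergence p Psi (CS * \<epsilon>) \<xi> \<phi> (per \<epsilon> \<beta> b)" .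
    define \<psi> where "\<psi> = per \<epsilon> \<beta> b"
    obtain \<psi>0 where sol\<psi>: "IBVP_sol p \<beta> b \<psi>0 \<psi>" and n\<psi>: "C1_norm_D p \<psi> \<le> ereal (CE * \<epsilon>)"
      using ex \<epsilon> damp bd unfolding existence_property_def \<psi>_def by blast
    have \<psi>b: "\<bar>\<psi> t x $ i\<bar> \<le> CE * \<epsilon>" "\<bar>dt \<psi> t x $ i\<bar> \<le> CE * \<epsilon>" "\<bar>dx p \<psi> t x $ i\<bar> \<le> CE * \<epsilon>"
      if "0 \<le> t" "x \<in> {0..L}" for t x i
      using n\<psi> that unfolding C1_norm_D_le_iff L_def by auto
    have W\<psi>: "W2inf_D p \<psi> (MR \<beta>)"
      using reg \<epsilon> damp bd W2 unfolding regularity_property_def \<psi>_def MR_def by blast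
    note C1 = IBVP_D(1)[OF sol] and C1\<psi> = IBVP_D(1)[OF sol\<psi>]
    have lip: "\<bar>dx p \<psi> (t + h) x $ i - dx p \<psi> t x $ i\<bar> \<le> MR \<beta> * h" if "0 \<le> t" "0 \<le> h" "x \<in> {0..L}" for t h x i
      using W2inf_dx_lipschitz[OF W\<psi> C1\<psi> _ less_imp_le[OF MR0] that(1,2)] that(3) L unfolding L_def by blast
    define w where "w = (\<lambda>i t x. \<phi> t x $ i - \<psi> t x $ i)"
    define wt where "wt = (\<lambda>i t x. dt \<phi> t x $ i - dt \<psi> t x $ i)"
    define wx where "wx = (\<lambda>i t x. dx p \<phi> t x $ i - dx p \<psi> t x $ i)"
    \<comment> \<open>As \<open>lam\<close> is linear, subtracting the equations leaves transport
      with the speed of \<open>\<phi>\<close> and this source. It contains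
      \<open>dx p \<psi>\<close> but not \<open>dx p \<phi>\<close>, so (R) is needed for the
      periodic solution alone.\<close>
    define S where "S = (\<lambda>i t x. lam p i (\<phi> t x - \<psi> t x) * dx p \<psi> t x $ i)"
    have C1w: "C1s L (w i) (wt i) (wx i)" for i
      unfolding w_def wt_def wx_def L_def by (intro C1s_diff C1s_component C1 C1\<psi>)
    have wn: "\<bar>w i t x\<bar> \<le> CS * \<epsilon> * \<xi> ^ nat \<lfloor>t / T0 p Psi\<rfloor>" if "0 \<le> t" "x \<in> {0..L}" for i t x
      using conv that unfolding C0_convergence_def sup_norm_le_iff L_def w_def \<psi>_def by auto
    have \<phi>b: "\<bar>\<phi> t x $ i\<bar> \<le> M0 * \<epsilon>" if "0 \<le> t" "x \<in> {0..L}" for t x i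
    proof -
      have "CS * \<epsilon> * \<xi> ^ nat \<lfloor>t / T0 p Psi\<rfloor> \<le> CS * \<epsilon> * 1"
        using \<xi> CS \<epsilon> by (intro mult_left_mono power_le_one) auto
      then show ?thesis using wn[OF that, of i] \<psi>b(1)[OF that, of i]
        unfolding w_def M0_def distrib_right by linarith
    qed
    define E where "E = (\<lambda>t. exp (- \<sigma> * t))"
    have E0: "0 < E t" for t by (simp add: E_def)
    define G where "G = CS / \<xi> * \<epsilon>"
    have G0: "0 < G" using CS \<xi> \<epsilon> by (simp add: G_def)
    have wb: "\<bar>w i t x\<bar> \<le> G * E t" if "0 \<le> t" "x \<in> {0..L}" for i t x
    proof -
      have "CS * \<epsilon> * \<xi> ^ nat \<lfloor>t / T0 p Psi\<rfloor> \<le> CS * \<epsilon> * (E t / \<xi>)"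
        using pow_floor_bounds(2)[OF \<xi> T0 that(1)] CS \<epsilon> unfolding \<sigma>_def E_def by (intro mult_left_mono) auto
      then show ?thesis using wn[OF that, of i] by (simp add: G_def)
    qed
    have lamw: "\<bar>lam p i (\<phi> t x - \<psi> t x)\<bar> \<le> 2 * B * (G * E t)" if "0 \<le> t" "x \<in> {0..L}" for i t x
      unfolding B_def by (rule lam_bound_unif[OF vp]) (use wb[OF that] in \<open>simp add: w_def\<close>)
    define J where "J = J0 \<beta> * \<epsilon>"
    have J: "0 < J" using J0 \<epsilon> by (simp add: J_def)
    have GJ: "G \<le> J" unfolding G_def J_def using J0(2) \<epsilon> by (intro mult_right_mono) auto
    have SJ: "\<bar>S i t x\<bar> \<le> J * E t" if "0 \<le> t" "x \<in> {0..L}" for i t x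
    proof -
      have "\<bar>S i t x\<bar> \<le> 2 * B * (G * E t) * (CE * 1)"
        unfolding S_def abs_mult
      proof (rule mult_mono)
        have "CE * \<epsilon> \<le> CE * 1" using CE \<epsilon>d by (intro mult_left_mono) auto
        then show "\<bar>dx p \<psi> t x $ i\<bar> \<le> CE * 1" using \<psi>b(3)[OF that, of i] by linarith
      qed (use lamw[OF that] B G0 E0[of t] in auto)
      also have "\<dots> = (2 * B * (CS / \<xi>) * CE) * (\<epsilon> * E t)" by (simp add: G_def)
      also have "\<dots> \<le> J0 \<beta> * (\<epsilon> * E t)" using J0(3) \<epsilon> E0[of t] by (intro mult_right_mono) auto
      finally show ?thesis by (simp add: J_def)
    qed
    have smM: "2 * slope p * (M0 * \<epsilon>) \<le> \<theta>'" "\<theta>' \<le> sound p / 2"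
      using sm nn \<theta>' unfolding B_def c_def by linarith+
    note spd = speed_bounds[OF vp \<phi>b smM, unfolded c_def[symmetric]]
    have dt\<phi>: "\<bar>dt \<phi> t x $ i\<bar> \<le> K1 * \<epsilon>" if "0 \<le> t" "x \<in> {0..L}" for t x i
      by (rule dtb[OF \<epsilon>(1) \<epsilon>d(1) damp bd init sol]) (use \<phi>b that in \<open>auto simp: L_def\<close>)
    have pde: "wt i t x + lam p i (\<phi> t x + Phi p) * wx i t x = \<beta> t x / 2 * (w 1 t x + w 2 t x) - S i t x"
      if "0 \<le> t" "x \<in> {0..L}" for i t x
    proof -
      have "lam p i (\<phi> t x + Phi p) = lam p i (\<psi> t x + Phi p) + lam p i (\<phi> t x - \<psi> t x)"
        unfolding lam_Phi lam_diff by simp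
      then have "lam p i (\<phi> t x + Phi p) * wx i t x + S i t x
          = lam p i (\<phi> t x + Phi p) * dx p \<phi> t x $ i - lam p i (\<psi> t x + Phi p) * dx p \<psi> t x $ i"
        unfolding wx_def S_def by (simp add: algebra_simps)
      then show ?thesis
        using IBVP_D(2)[OF sol that[unfolded L_def], of i] IBVP_D(2)[OF sol\<psi> that[unfolded L_def], of i]
        unfolding wt_def w_def by (simp add: field_simps)
    qed
    have bb: "\<bar>\<beta> t x\<bar> \<le> b0" if "0 \<le> t" "x \<in> {0..L}" for t x
      using damping_D(2)[OF damp] that unfolding b0_def L_def by fastforce
    have wtb: "\<bar>wt i t x\<bar> \<le> C * J * exp (- \<sigma> * t)" if tx: "0 \<le> t" "x \<in> {0..L}" for i t x
    proof (rule ap[where T=t and wt=wt and J=J and i=i and t=t and x=x])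
      show "transport_pair L c b0 \<sigma> (kap p) \<theta> t J \<beta> (dt \<beta>) (dx p \<beta>) (\<lambda>i t x. lam p i (\<phi> t x + Phi p))
        (\<lambda>i t x. lam p i (dt \<phi> t x)) (\<lambda>i t x. lam p i (dx p \<phi> t x)) w wt wx S"
      proof
        show "0 < J" by (rule J)
        show "C1s L (w i) (wt i) (wx i)" for i by (rule C1w)
        show "C1s L \<beta> (dt \<beta>) (dx p \<beta>)" using damping_D(1)[OF damp] by (simp add: L_def)
        show "C1s L (\<lambda>t x. lam p i (\<phi> t x + Phi p)) (\<lambda>t x. lam p i (dt \<phi> t x)) (\<lambda>t x. lam p i (dx p \<phi> t x))" for i
          unfolding L_def by (rule C1s_lam[OF C1])
        show "- b0 \<le> \<beta> t x \<and> \<beta> t x \<le> 0 \<and> \<bar>dt \<beta> t x\<bar> \<le> 1 \<and> \<bar>dx p \<beta> t x\<bar> \<le> 1" if "0 \<le> t" "x \<in> {0..L}" for t x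
          using damping_D(2)[OF damp that(1) that(2)[unfolded L_def]] \<epsilon>d by (simp add: b0_def)
        show "\<bar>lam p i (\<phi> t x + Phi p) - sg i * c\<bar> \<le> \<theta>" if "0 \<le> t" "x \<in> {0..L}" for i t x
          using spd(1)[OF that, of i] \<theta>' by linarith
        show "\<bar>lam p i (dt \<phi> t x)\<bar> \<le> \<theta>" if "0 \<le> t" "x \<in> {0..L}" for i t x
          using lam_bound_unif[OF vp dt\<phi>[OF that], of i] sm nn \<theta>' unfolding B_def by linarith
        show "wt i t x + lam p i (\<phi> t x + Phi p) * wx i t x = \<beta> t x / 2 * (w 1 t x + w 2 t x) - S i t x"
          if "0 \<le> t" "x \<in> {0..L}" for i t x
          using pde[OF that] .
        show "\<bar>w i t x\<bar> \<le> J * exp (- \<sigma> * t)" if "0 \<le> t" "x \<in> {0..L}" for i t x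
          using wb[OF that, of i] mult_right_mono[OF GJ, of "E t"] E0[of t] unfolding E_def by linarith
        show "\<bar>S i t x\<bar> \<le> J * exp (- \<sigma> * t)" if "0 \<le> t" "x \<in> {0..L}" for i t x
          using SJ[OF that, of i] unfolding E_def .
        show "\<bar>wt i t (inflow L i) - kap p i * wt (oth i) t (inflow L i)\<bar> \<le> J * exp (- \<sigma> * t)" if "0 \<le> t" for i t
        proof -
          have b: "C1_I {0..} b" using bd by (simp add: bdry_data_def)
          have Lp: "0 < len p" using L by (simp add: L_def)
          \<comment> \<open>Both solutions carry the same boundary data, so the reflection law of
            the difference is homogeneous.\<close>
          have "wt i t (inflow L i) - kap p i * wt (oth i) t (inflow L i) = 0"
            using inflow_dt[OF sol b Lp that, of i] inflow_dt[OF sol\<psi> b Lp that, of i]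
            unfolding wt_def L_def by (simp add: algebra_simps)
          then show ?thesis using J by simp
        qed
        show "\<bar>wt i 0 x\<bar> \<le> J" if "x \<in> {0..L}" for i x
        proof -
          have "\<bar>wt i 0 x\<bar> \<le> (K1 + CE) * \<epsilon>"
            using dt\<phi>[OF order_refl that, of i] \<psi>b(2)[OF order_refl that, of i]
            unfolding wt_def distrib_right by linarith
          also have "\<dots> \<le> J" unfolding J_def using J0(5) \<epsilon> by (intro mult_right_mono) auto
          finally show ?thesis .
        qed
        show "\<forall>\<^sub>F h in at_right 0. \<forall>r\<in>{0..t}. \<forall>x\<in>{0..L}. \<bar>(S i (r + h) x - S i r x) / h\<bar>
            \<le> J * exp (- \<sigma> * r) + \<theta> * (\<bar>wt 1 r x\<bar> + \<bar>wt 2 r x\<bar>) + e" if e: "0 < e" for i e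
        proof -
          \<comment> \<open>Both components contribute an error \<open>e'\<close>, multiplied by at
            most \<open>\<theta>\<close>.\<close>
          define e' where "e' = e / (2 * \<theta>)"
          have e': "0 < e'" "\<theta> * (2 * e') = e" using e \<theta> by (simp_all add: e'_def)
          have "\<forall>\<^sub>F h in at_right 0. 0 < h \<and> (\<forall>r\<in>{0..t}. \<forall>x\<in>{0..L}. \<bar>(w 1 (r + h) x - w 1 r x) / h - wt 1 r x\<bar> < e') \<and>
              (\<forall>r\<in>{0..t}. \<forall>x\<in>{0..L}. \<bar>(w 2 (r + h) x - w 2 r x) / h - wt 2 r x\<bar> < e')"
            by (intro eventually_conj eventually_at_right_less unif_quot[OF C1w e'(1)])
          then show ?thesis
          proof eventually_elim
            case (elim h)
            show ?case
            proof (intro ballI)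
              fix r x assume r: "r \<in> {0..t}" and x: "x \<in> {0..L}"
              have h: "0 < h" and r0: "0 \<le> r" "0 \<le> r + h" using elim r by auto
              define d where "d = (\<phi> (r + h) x - \<psi> (r + h) x) - (\<phi> r x - \<psi> r x)"
              have dj: "d $ j = w j (r + h) x - w j r x" for j by (simp add: d_def w_def)
              have q: "\<bar>d $ j\<bar> \<le> h * (\<bar>wt j r x\<bar> + e')" for j
              proof -
                have "\<bar>(w j (r + h) x - w j r x) / h - wt j r x\<bar> < e'"
                  using elim r x exhaust_2[of j] by auto
                then have "\<bar>d $ j / h\<bar> \<le> \<bar>wt j r x\<bar> + e'" unfolding dj by linarith
                then show ?thesis using h by (simp add: abs_divide field_simps)
              qed
              have "\<bar>lam p i d\<bar> \<le> B * (\<bar>d $ 1\<bar> + \<bar>d $ 2\<bar>)" unfolding B_def by (rule lam_bound[OF vp])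
              also have "\<dots> \<le> B * (h * (\<bar>wt 1 r x\<bar> + \<bar>wt 2 r x\<bar> + 2 * e'))"
                using q[of 1] q[of 2] B by (intro mult_left_mono) (auto simp: algebra_simps)
              finally have ld: "\<bar>lam p i d\<bar> \<le> B * (h * (\<bar>wt 1 r x\<bar> + \<bar>wt 2 r x\<bar> + 2 * e'))" .
              have "\<bar>lam p i d * dx p \<psi> (r + h) x $ i\<bar> \<le> B * (h * (\<bar>wt 1 r x\<bar> + \<bar>wt 2 r x\<bar> + 2 * e')) * (CE * \<epsilon>)"
                unfolding abs_mult using ld \<psi>b(3)[OF r0(2) x, of i] B h e' by (intro mult_mono) auto
              also have "\<dots> = (B * (CE * \<epsilon>)) * (h * (\<bar>wt 1 r x\<bar> + \<bar>wt 2 r x\<bar> + 2 * e'))" by simp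
              also have "\<dots> \<le> \<theta> * (h * (\<bar>wt 1 r x\<bar> + \<bar>wt 2 r x\<bar> + 2 * e'))"
                using sm nn \<theta>' h e' by (intro mult_right_mono) auto
              finally have p1: "\<bar>lam p i d * dx p \<psi> (r + h) x $ i\<bar>
                  \<le> h * (\<theta> * (\<bar>wt 1 r x\<bar> + \<bar>wt 2 r x\<bar>) + e)"
                unfolding e'(2)[symmetric] by (simp add: algebra_simps)
              have "\<bar>lam p i (\<phi> r x - \<psi> r x) * (dx p \<psi> (r + h) x $ i - dx p \<psi> r x $ i)\<bar> \<le> 2 * B * (G * E r) * (MR \<beta> * h)"
                unfolding abs_mult using lamw[OF r0(1) x, of i] lip[OF r0(1) less_imp_le[OF h] x, of i] B G0 E0[of r]
                by (intro mult_mono) auto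
              also have "\<dots> = h * ((2 * B * (CS / \<xi>) * MR \<beta>) * (\<epsilon> * E r))" by (simp add: G_def)
              also have "\<dots> \<le> h * (J0 \<beta> * (\<epsilon> * E r))"
                using J0(4) \<epsilon> E0[of r] h by (intro mult_left_mono mult_right_mono) auto
              finally have p2: "\<bar>lam p i (\<phi> r x - \<psi> r x) * (dx p \<psi> (r + h) x $ i - dx p \<psi> r x $ i)\<bar> \<le> h * (J * E r)"
                by (simp add: J_def mult.assoc)
              \<comment> \<open>Discrete product rule: the increment of \<open>w\<close> meets the
                small factor \<open>dx p \<psi>\<close> and yields the term with
                \<open>\<theta>\<close>, while the increment of \<open>dx p \<psi>\<close>, merely
                Lipschitz, meets \<open>w\<close>, which decays.\<close>
              have "S i (r + h) x - S i r x = lam p i d * dx p \<psi> (r + h) x $ i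
                  + lam p i (\<phi> r x - \<psi> r x) * (dx p \<psi> (r + h) x $ i - dx p \<psi> r x $ i)"
                unfolding S_def d_def lam_diff by (simp add: algebra_simps)
              then have "\<bar>S i (r + h) x - S i r x\<bar>
                  \<le> h * (\<theta> * (\<bar>wt 1 r x\<bar> + \<bar>wt 2 r x\<bar>) + e) + h * (J * E r)"
                using p1 p2 by linarith
              also have "\<dots> = (J * E r + \<theta> * (\<bar>wt 1 r x\<bar> + \<bar>wt 2 r x\<bar>) + e) * h" by (simp add: algebra_simps)
              finally show "\<bar>(S i (r + h) x - S i r x) / h\<bar>
                  \<le> J * exp (- \<sigma> * r) + \<theta> * (\<bar>wt 1 r x\<bar> + \<bar>wt 2 r x\<bar>) + e"
                using h by (simp add: abs_divide pos_divide_le_eq E_def)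
            qed
          qed
        qed
      qed
    qed (use tx in auto)
    have wxb: "\<bar>wx i t x\<bar> \<le> CX * J * E t" if tx: "0 \<le> t" "x \<in> {0..L}" for i t x
    proof -
      define l where "l = lam p i (\<phi> t x + Phi p)"
      have l: "c / 2 \<le> \<bar>l\<bar>" using spd(2)[OF tx, of i] by (simp add: l_def)
      have wJ: "\<bar>w j t x\<bar> \<le> J * E t" for j
        using wb[OF tx, of j] mult_right_mono[OF GJ, of "E t"] E0[of t] by linarith
      have "\<bar>\<beta> t x / 2 * (w 1 t x + w 2 t x)\<bar> \<le> b0 * (J * E t)"
        by (rule half_sum_bound) (use bb[OF tx] wJ in auto)
      moreover have "l * wx i t x = \<beta> t x / 2 * (w 1 t x + w 2 t x) - S i t x - wt i t x"
        using pde[OF tx, of i] by (simp add: l_def)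
      moreover have "\<bar>wt i t x\<bar> \<le> C * (J * E t)" using wtb[OF tx, of i] by (simp add: E_def mult.assoc)
      ultimately have "\<bar>l * wx i t x\<bar> \<le> b0 * (J * E t) + J * E t + C * (J * E t)"
        using SJ[OF tx, of i] by linarith
      moreover have "c / 2 * \<bar>wx i t x\<bar> \<le> \<bar>l\<bar> * \<bar>wx i t x\<bar>" using l by (rule mult_right_mono) simp
      ultimately have "c / 2 * \<bar>wx i t x\<bar> \<le> (b0 + 1 + C) * (J * E t)"
        by (simp add: abs_mult algebra_simps)
      then show ?thesis using c by (simp add: CX_def field_simps)
    qed
    show "C1_convergence p Psi (A0 * CS' \<beta> * \<epsilon>) \<xi> \<phi> (per \<epsilon> \<beta> b)"
      unfolding C1_convergence_def max.bounded_iff sup_norm_le_iff \<psi>_def[symmetric] L_def[symmetric]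
    proof (intro allI impI conjI ballI)
      fix t :: real and i :: 2 and x assume t: "0 \<le> t" and x: "x \<in> {0..L}"
      define P where "P = \<xi> ^ nat \<lfloor>t / T0 p Psi\<rfloor>"
      have EP: "E t \<le> P" using pow_floor_bounds(1)[OF \<xi> T0 t] unfolding E_def \<sigma>_def P_def .
      have tot: "A0 * CS' \<beta> * \<epsilon> * P = C * J * P + CX * J * P"
        unfolding A0CS J_def by (simp add: algebra_simps)
      have pos: "0 \<le> C * J * P" "0 \<le> CX * J * P" using C J CX \<xi> by (simp_all add: P_def)
      have Et: "exp (- \<sigma> * t) = E t" by (simp add: E_def)
      have "C * J * E t \<le> C * J * P" "CX * J * E t \<le> CX * J * P"
        using EP C J CX by (auto intro!: mult_left_mono)
      then show "\<bar>(dt \<phi> t x - dt \<psi> t x) $ i\<bar> \<le> A0 * CS' \<beta> * \<epsilon> * \<xi> ^ nat \<lfloor>t / T0 p Psi\<rfloor>"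
        "\<bar>(dx p \<phi> t x - dx p \<psi> t x) $ i\<bar> \<le> A0 * CS' \<beta> * \<epsilon> * \<xi> ^ nat \<lfloor>t / T0 p Psi\<rfloor>"
        using wtb[OF t x, of i] wxb[OF t x, of i] tot pos
        unfolding P_def[symmetric] wt_def wx_def Et by simp_all
    qed
  qed
qed

end
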